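(* Let $\mu$ be a probability measure with finite entropy $H(\mu)=-\sum_g\mu(g)\log\mu(g)$ on a countable group $G$, let $\check\mu(g)=\mu(g^{-1})$ be the reflected measure, and let $(B_-,\lambda_-)$ and $(B_+,\lambda_+)$ be $\check\mu$- and $\mu$-boundaries, respectively. Suppose there exist a gauge $\mathcal{G}=(\mathcal{G}_k)$ on $G$ with gauge function $|\cdot|=|\cdot|_{\mathcal{G}}$ and a measurable $G$-equivariant map $S$ assigning to pairs of points $(b_-,b_+)\in B_-\times B_+$ nonempty "strips" $S(b_-,b_+)\subset G$ such that for all $g\in G$ and $\lambda_-\otimes\lambda_+$-a.e. $(b_-,b_+)\in B_-\times B_+$ $$\frac1n\log\operatorname{card}\bigl[S(b_-,b_+)g\cap\mathcal{G}_{|x_n|}\bigr]\xrightarrow[n\to\infty]{}0$$ in probability with respect to the measure $\mathbf{P}$ on the space of sample paths $\boldsymbol{x}=\{x_n\}_{n\ge0}$ of the random walk $(G,\mu)$. Then the boundary $(B_+,\lambda_+)$ is maximal.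
   Context: Random walks. For a countable group $G$ and a probability measure $\mu$ on $G$, the (right) random walk $(G,\mu)$ is the Markov chain on $G$ with transition probabilities $p(x,y)=\mu(x^{-1}y)$; thus $x_n=x_0h_1h_2\cdots h_n$ with independent $\mu$-distributed increments $h_i$. $G^{\mathbb{Z}_+}$ is the space of sample paths $\boldsymbol{x}=\{x_n\}_{n\ge 0}$, on which $G$ acts coordinatewise from the left. $\mathbf{P}_\theta$ is the Markov measure on $G^{\mathbb{Z}_+}$ with initial distribution $\theta$; $\mathbf{P}=\mathbf{P}_{\delta_e}$; $m$ is the counting measure on $G$; $T$ is the time shift $\{x_n\}\mapsto\{x_{n+1}\}$. The Poisson boundary $\Gamma$ is the space of ergodic components of $T$ in the Lebesgue space $(G^{\mathbb{Z}_+},\mathbf{P}_m)$: there is a projection $\mathrm{bnd}:G^{\mathbb{Z}_+}\to\Gamma$ such that the $\sigma$-algebra of $T$-invariant measurable sets coincides (mod 0) with the $\sigma$-algebra of $\mathrm{bnd}$-preimages of measurable subsets of $\Gamma$. The $G$-action descends to $\Gamma$, and $\Gamma$ is endowed with the harmonic measure $\nu=\mathrm{bnd}(\mathbf{P})$. A $\mu$-boundary is the quotient $(\Gamma_\xi,\nu_\xi)$ of $(\Gamma,\nu)$ by a $G$-invariant measurable partition $\xi$. It is maximal if the quotient map $(\Gamma,\nu)\to(\Gamma_\xi,\nu_\xi)$ is an isomorphism mod 0, i.e. if it is the whole Poisson boundary of $(G,\mu)$. A $\check\mu$-boundary is the same notion for the measure $\check\mu$. Gauges. A gauge on $G$ is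 an increasing sequence $\mathcal{G}=(\mathcal{G}_k)_{k\ge1}$ of subsets (not assumed finite) exhausting $G$; its gauge function is $|g|_{\mathcal{G}}=\min\{k:g\in\mathcal{G}_k\}$. Equivariance of $S$ means $S(gb_-,gb_+)=gS(b_-,b_+)$ for $g\in G$. *)

theory Defs
  imports
    "HOL-Probability.Probability"
    "HOL-Algebra.Group_Action"
    "HOL-Library.Disjoint_Sets"
begin

section \<open>Random walks\<close>

text \<open>
  A probability measure on a countable group \<open>G\<close> is a \<open>pmf\<close> whose support lies in \<open>carrier G\<close>.
\<close>

definition reflected :: "('a, 'b) monoid_scheme \<Rightarrow> 'a pmf \<Rightarrow> 'a pmf" where
  "reflected G \<mu> = map_pmf (m_inv G) \<mu>"

text \<open>
  All summands are nonnegative and \<open>0 * ln 0 = 0\<close>, so the sum always makes sense in \<open>[0, \<infinity>]\<close>.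
\<close>

definition entropy_on :: "('a, 'b) monoid_scheme \<Rightarrow> 'a pmf \<Rightarrow> ennreal" where
  "entropy_on G \<mu> = (\<integral>\<^sup>+ g. ennreal (- pmf \<mu> g * ln (pmf \<mu> g)) \<partial>count_space (carrier G))"

definition path_space :: "('a, 'b) monoid_scheme \<Rightarrow> (nat \<Rightarrow> 'a) measure" where
  "path_space G = (\<Pi>\<^sub>M n\<in>UNIV. count_space (carrier G))"

text \<open>
  \<open>walk G y h n\<close> is \<open>y h\<^sub>1 h\<^sub>2 \<dots> h\<^sub>n\<close>, where the \<open>k\<close>-th increment is stored as \<open>h (k - 1)\<close>.
\<close>

primrec walk :: "('a, 'b) monoid_scheme \<Rightarrow> 'a \<Rightarrow> (nat \<Rightarrow> 'a) \<Rightarrow> nat \<Rightarrow> 'a" where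
  "walk G y h 0 = y"
| "walk G y h (Suc n) = walk G y h n \<otimes>\<^bsub>G\<^esub> h n"

text \<open>
  The Markov measure with initial distribution \<open>\<theta>\<close>, a measure on \<open>count_space (carrier G)\<close> that
  need not be finite. The increments are restricted to \<open>carrier G\<close> so that \<open>walk\<close> is a map into the
  path space.
\<close>

definition markov_measure ::
  "('a, 'b) monoid_scheme \<Rightarrow> 'a pmf \<Rightarrow> 'a measure \<Rightarrow> (nat \<Rightarrow> 'a) measure" where
  "markov_measure G \<mu> \<theta> =
     distr (\<theta> \<Otimes>\<^sub>M (\<Pi>\<^sub>M n\<in>(UNIV :: nat set). restrict_space (measure_pmf \<mu>) (carrier G)))
       (path_space G) (\<lambda>(y, h). walk G y h)"

definition walk_measure :: "('a, 'b) monoid_scheme \<Rightarrow> 'a pmf \<Rightarrow> (nat \<Rightarrow> 'a) measure" where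
  "walk_measure G \<mu> = markov_measure G \<mu> (return (count_space (carrier G)) \<one>\<^bsub>G\<^esub>)"

definition walk_measure_counting :: "('a, 'b) monoid_scheme \<Rightarrow> 'a pmf \<Rightarrow> (nat \<Rightarrow> 'a) measure" where
  "walk_measure_counting G \<mu> = markov_measure G \<mu> (count_space (carrier G))"

definition shift :: "(nat \<Rightarrow> 'a) \<Rightarrow> nat \<Rightarrow> 'a" where
  "shift x = (\<lambda>n. x (Suc n))"

definition shift_invariant_sets :: "('a, 'b) monoid_scheme \<Rightarrow> (nat \<Rightarrow> 'a) set set" where
  "shift_invariant_sets G =
     {A \<in> sets (path_space G). shift -` A \<inter> space (path_space G) = A}"

section \<open>The Poisson boundary and its quotients\<close>

text \<open>
  Lebesgue spaces are represented by standard Borel spaces: every Lebesgue space is, mod 0, the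
  completion of a measure on such a space.
\<close>

definition standard_borel :: "'p measure \<Rightarrow> bool" where
  "standard_borel M \<longleftrightarrow>
     (\<exists>A \<in> sets (borel :: real measure).
        \<exists>f \<in> M \<rightarrow>\<^sub>M restrict_space borel A. \<exists>h \<in> restrict_space borel A \<rightarrow>\<^sub>M M.
          (\<forall>p \<in> space M. h (f p) = p) \<and> (\<forall>t \<in> A. f (h t) = t))"

text \<open>
  \<open>(\<Gamma>, bnd)\<close> is the space of ergodic components of the shift with respect to the path measure
  started from the counting measure (which is what ``mod 0'' refers to in the conditions on \<open>bnd\<close>),
  \<open>act\<close> is the action induced by the coordinatewise left action on paths, and the measure carried
  by \<open>\<Gamma>\<close> is the harmonic measure. These data are determined up to isomorphism mod 0.
\<close>

definition poisson_boundary ::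
  "('a, 'b) monoid_scheme \<Rightarrow> 'a pmf \<Rightarrow> 'p measure \<Rightarrow> ('a \<Rightarrow> 'p \<Rightarrow> 'p) \<Rightarrow> ((nat \<Rightarrow> 'a) \<Rightarrow> 'p) \<Rightarrow> bool"
where
  "poisson_boundary G \<mu> \<Gamma> act bnd \<longleftrightarrow>
     standard_borel \<Gamma> \<and>
     bnd \<in> path_space G \<rightarrow>\<^sub>M \<Gamma> \<and>
     (\<forall>A \<in> shift_invariant_sets G. \<exists>E \<in> sets \<Gamma>.
        AE x in walk_measure_counting G \<mu>. x \<in> A \<longleftrightarrow> bnd x \<in> E) \<and>
     (\<forall>E \<in> sets \<Gamma>. \<exists>A \<in> shift_invariant_sets G.
        AE x in walk_measure_counting G \<mu>. x \<in> A \<longleftrightarrow> bnd x \<in> E) \<and>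
     group_action G (space \<Gamma>) act \<and>
     (\<forall>g \<in> carrier G. act g \<in> \<Gamma> \<rightarrow>\<^sub>M \<Gamma>) \<and>
     (\<forall>g \<in> carrier G.
        AE x in walk_measure_counting G \<mu>. bnd (\<lambda>n. g \<otimes>\<^bsub>G\<^esub> x n) = act g (bnd x)) \<and>
     distr (walk_measure G \<mu>) \<Gamma> bnd = \<Gamma>"

text \<open>
  Measurability of a partition is in the sense of Rokhlin: a countable family of measurable unions
  of blocks separates the blocks.
\<close>

definition measurable_partition :: "'p measure \<Rightarrow> 'p set set \<Rightarrow> bool" where
  "measurable_partition M \<xi> \<longleftrightarrow>
     partition_on (space M) \<xi> \<and>
     (\<exists>E :: nat \<Rightarrow> 'p set.
        (\<forall>i. E i \<in> sets M \<and> (\<exists>\<A> \<subseteq> \<xi>. E i = \<Union>\<A>)) \<and>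
        (\<forall>C \<in> \<xi>. \<forall>D \<in> \<xi>. C \<noteq> D \<longrightarrow>
           (\<exists>i. (C \<subseteq> E i \<and> D \<inter> E i = {}) \<or> (D \<subseteq> E i \<and> C \<inter> E i = {}))))"

definition invariant_partition ::
  "('a, 'b) monoid_scheme \<Rightarrow> ('a \<Rightarrow> 'p \<Rightarrow> 'p) \<Rightarrow> 'p set set \<Rightarrow> bool" where
  "invariant_partition G act \<xi> \<longleftrightarrow> (\<forall>g \<in> carrier G. \<forall>C \<in> \<xi>. act g ` C \<in> \<xi>)"

definition block_of :: "'p set set \<Rightarrow> 'p \<Rightarrow> 'p set" where
  "block_of \<xi> p = (THE C. C \<in> \<xi> \<and> p \<in> C)"

definition quotient_measure :: "'p measure \<Rightarrow> 'p set set \<Rightarrow> 'p set measure" where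
  "quotient_measure M \<xi> =
     distr M (sigma \<xi> {\<A>. \<A> \<subseteq> \<xi> \<and> \<Union>\<A> \<in> sets M}) (block_of \<xi>)"

text \<open>
  \<open>B\<close> is the \<open>\<mu>\<close>-boundary \<open>\<Gamma>\<^sub>\<xi>\<close>. Its points are the blocks of \<open>\<xi>\<close>, on which \<open>g\<close> acts by
  \<open>C \<mapsto> act g ` C\<close>.
\<close>

definition mu_boundary ::
  "('a, 'b) monoid_scheme \<Rightarrow> 'a pmf \<Rightarrow> 'p measure \<Rightarrow> ('a \<Rightarrow> 'p \<Rightarrow> 'p) \<Rightarrow> ((nat \<Rightarrow> 'a) \<Rightarrow> 'p) \<Rightarrow>
   'p set set \<Rightarrow> 'p set measure \<Rightarrow> bool"
where
  "mu_boundary G \<mu> \<Gamma> act bnd \<xi> B \<longleftrightarrow>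
     poisson_boundary G \<mu> \<Gamma> act bnd \<and>
     measurable_partition \<Gamma> \<xi> \<and> invariant_partition G act \<xi> \<and>
     B = quotient_measure \<Gamma> \<xi>"

definition isomorphism_mod0 :: "'p measure \<Rightarrow> 'q measure \<Rightarrow> ('p \<Rightarrow> 'q) \<Rightarrow> bool" where
  "isomorphism_mod0 M N f \<longleftrightarrow>
     f \<in> M \<rightarrow>\<^sub>M N \<and> distr M N f = N \<and>
     (\<exists>A \<in> null_sets M. \<exists>B \<in> null_sets N.
        f \<in> restrict_space M (space M - A) \<rightarrow>\<^sub>M restrict_space N (space N - B) \<and>
        (\<exists>h \<in> restrict_space N (space N - B) \<rightarrow>\<^sub>M restrict_space M (space M - A).
           (\<forall>p \<in> space M - A. h (f p) = p) \<and> (\<forall>q \<in> space N - B. f (h q) = q)))"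

definition maximal_boundary :: "'p measure \<Rightarrow> 'p set set \<Rightarrow> 'p set measure \<Rightarrow> bool" where
  "maximal_boundary \<Gamma> \<xi> B \<longleftrightarrow> isomorphism_mod0 \<Gamma> B (block_of \<xi>)"

section \<open>Gauges and strips\<close>

text \<open>Only the values at indices \<open>k \<ge> 1\<close> matter.\<close>

definition gauge_on :: "('a, 'b) monoid_scheme \<Rightarrow> (nat \<Rightarrow> 'a set) \<Rightarrow> bool" where
  "gauge_on G \<G> \<longleftrightarrow> (\<forall>k\<ge>1. \<G> k \<subseteq> \<G> (Suc k)) \<and> (\<Union>k\<in>{1..}. \<G> k) = carrier G"

definition gauge_fun :: "(nat \<Rightarrow> 'a set) \<Rightarrow> 'a \<Rightarrow> nat" where
  "gauge_fun \<G> g = (LEAST k. 1 \<le> k \<and> g \<in> \<G> k)"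

definition subset_space :: "('a, 'b) monoid_scheme \<Rightarrow> 'a set measure" where
  "subset_space G =
     sigma (Pow (carrier G)) ((\<lambda>g. {A \<in> Pow (carrier G). g \<in> A}) ` carrier G)"

text \<open>
  The gauge sets need not be finite, and \<open>card\<close> is \<open>0\<close> on infinite sets, so the logarithm of the
  cardinality is taken in the extended reals.
\<close>

definition log_card :: "'a set \<Rightarrow> ereal" where
  "log_card A =
     (if infinite A then \<infinity> else if A = {} then -\<infinity> else ereal (ln (real (card A))))"

definition tendsto_zero_in_prob :: "'w measure \<Rightarrow> (nat \<Rightarrow> 'w \<Rightarrow> ereal) \<Rightarrow> bool" where
  "tendsto_zero_in_prob M X \<longleftrightarrow>
     (\<forall>\<epsilon>>0. (\<lambda>n. measure M {w \<in> space M. \<bar>X n w\<bar> > ereal \<epsilon>}) \<longlonglongrightarrow> 0)"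

end

theory Submission
  imports Defs
begin

text \<open>
  The walk is written as a function of independent increments \<open>h\<close>, with positions
  \<open>x\<^sub>n = h\<^sub>0 \<otimes> \<dots> \<otimes> h\<^bsub>n-1\<^esub>\<close>, and a boundary is a \<^emph>\<open>stationary system\<close>: a probability space \<open>X\<close> on which
  \<open>G\<close> acts, with a map \<open>\<beta>\<close> of the increments such that \<open>\<beta>\<close> has law \<open>X\<close> and
  \<open>\<beta> h = h\<^sub>0 \<beta> (shift h)\<close>. Both the Poisson boundary and its quotients are of this kind. Let \<open>r g\<close> be the
  density of the translate of \<open>X\<close> by \<open>g\<close>. Conditionally on \<open>\<beta> h = y\<close>, the walk is at \<open>g\<close> at time \<open>n\<close> with
  probability \<open>P(x\<^sub>n = g) r g y\<close>. The \<^emph>\<open>information\<close> \<open>info n h\<close> is minus the logarithm of this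
  conditional probability at \<open>g = x\<^sub>n\<close>, \<open>y = \<beta> h\<close>. It is nonnegative, subadditive along the path
  (because \<open>r\<close> is a cocycle), and for \<open>n = 1\<close> it is integrable when the entropy is finite.

  \<^emph>\<open>Strips make the information of the quotient sublinear.\<close> Take a \<open>\<mu>\<close>-boundary point from the walk
  and an independent boundary point of the reflected walk. Applying \<open>x\<^sub>n\<inverse>\<close> to both preserves their joint law, so by
  equivariance the probability that \<open>x\<^sub>n\<close> lies in a finite union of right translates of the strip is
  the same for all \<open>n\<close>; as strips are nonempty it is as close to one as desired. Intersecting
  with a set of the gauge whose index is a quantile of the gauge of \<open>x\<^sub>n\<close> costs little probability
  and leaves, by the growth condition, subexponentially many candidates for \<open>x\<^sub>n\<close>. A candidate of
  conditional probability below an exponentially small threshold is then unlikely, so \<open>info n / n\<close>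
  tends to zero in probability. Since \<open>info n\<close> is bounded by a sum of \<open>n\<close> identically distributed
  integrable variables, the convergence holds in mean along suitable \<open>n\<close>. Taking the probability close to one, rather
  than merely positive, replaces an equipartition theorem by this uniform integrability.

  \<^emph>\<open>Sublinear information makes the quotient full.\<close> Let \<open>\<rho>\<close> be the densities of the quotient, read
  on the Poisson boundary. The mean of \<open>ln (r x\<^sub>n) - ln (\<rho> x\<^sub>n)\<close> equals \<open>n\<close> times its value for \<open>n = 1\<close>, and
  it is at most the mean of \<open>info n\<close> for the quotient because the information of the Poisson
  boundary is nonnegative. Hence the mean for \<open>n = 1\<close>, a relative entropy, is not positive, and the
  equality case of Gibbs' inequality gives \<open>r = \<rho>\<close>. Then a bounded function on the Poisson boundary
  and its conditional expectation given the quotient have the same integral over every cylinder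
  set of increments, so they agree almost everywhere. Thus every function descends to the
  quotient, and the projection is an isomorphism because the Poisson boundary is standard Borel.
\<close>

section \<open>Random walks as functions of independent increments\<close>

locale random_walk = group G for G :: "('a, 'b) monoid_scheme" (structure) +
  fixes \<mu> :: "'a pmf"
  assumes countable_carrier: "countable (carrier G)"
    and support: "set_pmf \<mu> \<subseteq> carrier G"
begin

definition inc :: "'a measure" where
  "inc = restrict_space (measure_pmf \<mu>) (carrier G)"

abbreviation incs :: "(nat \<Rightarrow> 'a) measure" where
  "incs \<equiv> (\<Pi>\<^sub>M n\<in>UNIV. inc)"

abbreviation pos :: "(nat \<Rightarrow> 'a) \<Rightarrow> nat \<Rightarrow> 'a" where
  "pos \<equiv> walk G \<one>"

lemma sets_inc [measurable_cong]: "sets inc = sets (count_space (carrier G))"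
  by (auto simp: inc_def sets_restrict_space)

lemma space_inc [simp]: "space inc = carrier G"
  by (simp add: inc_def space_restrict_space)

lemma space_incs: "space incs = UNIV \<rightarrow> carrier G"
  by (auto simp: space_PiM PiE_def)

lemma prob_space_inc: "prob_space inc"
  unfolding inc_def
proof (rule prob_space_restrict_space)
  show "emeasure (measure_pmf \<mu>) (carrier G) = 1"
    using support by (simp add: measure_pmf.emeasure_eq_1_AE AE_measure_pmf_iff subset_iff)
qed simp

sublocale iid: sequence_space inc
  by (rule sequence_space.intro, intro_locales, unfold product_prob_space_def product_prob_space_axioms_def product_sigma_finite_def)
    (use prob_space_inc prob_space_imp_sigma_finite in auto)

sublocale inc: prob_space inc
  by (rule prob_space_inc)

lemma nn_integral_inc_pmf: "(\<integral>\<^sup>+ g. f g \<partial>inc) = (\<integral>\<^sup>+ g. f g \<partial>measure_pmf \<mu>)"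
proof -
  have "(\<integral>\<^sup>+ g. f g \<partial>inc) = (\<integral>\<^sup>+ g. f g * indicator (carrier G) g \<partial>measure_pmf \<mu>)"
    unfolding inc_def by (rule nn_integral_restrict_space) simp
  also have "\<dots> = (\<integral>\<^sup>+ g. f g \<partial>measure_pmf \<mu>)"
    using support by (intro nn_integral_cong_AE) (auto simp: AE_measure_pmf_iff subset_iff)
  finally show ?thesis .
qed

lemma nn_integral_inc: "(\<integral>\<^sup>+ g. f g \<partial>inc) = (\<integral>\<^sup>+ g. ennreal (pmf \<mu> g) * f g \<partial>count_space (carrier G))"
proof -
  have "(\<integral>\<^sup>+ g. f g \<partial>inc) = (\<integral>\<^sup>+ g. f g * indicator (carrier G) g \<partial>measure_pmf \<mu>)"
    unfolding inc_def by (rule nn_integral_restrict_space) simp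
  also have "\<dots> = (\<integral>\<^sup>+ g. ennreal (pmf \<mu> g) * (f g * indicator (carrier G) g) \<partial>count_space UNIV)"
    by (rule nn_integral_measure_pmf)
  also have "\<dots> = (\<integral>\<^sup>+ g. ennreal (pmf \<mu> g) * f g \<partial>count_space (carrier G))"
    by (subst nn_integral_count_space_indicator[of "carrier G"]) (auto simp: mult.assoc)
  finally show ?thesis .
qed

lemma measurable_mult_discrete [measurable (raw)]:
  assumes "f \<in> N \<rightarrow>\<^sub>M count_space (carrier G)" "g \<in> N \<rightarrow>\<^sub>M count_space (carrier G)"
  shows "(\<lambda>x. f x \<otimes> g x) \<in> N \<rightarrow>\<^sub>M count_space (carrier G)"
proof -
  have "(\<lambda>x. (f x, g x)) \<in> N \<rightarrow>\<^sub>M count_space (carrier G \<times> carrier G)"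
    using assms by (simp add: pair_measure_countable[symmetric] countable_carrier)
  from measurable_compose[OF this, of "\<lambda>(a, b). a \<otimes> b" "count_space (carrier G)"] show ?thesis
    by (simp add: Pi_iff)
qed

lemma measurable_inv_discrete [measurable (raw)]:
  assumes "f \<in> N \<rightarrow>\<^sub>M count_space (carrier G)"
  shows "(\<lambda>x. inv (f x)) \<in> N \<rightarrow>\<^sub>M count_space (carrier G)"
  using measurable_compose[OF assms, of "m_inv G" "count_space (carrier G)"] by auto

lemma borel_measurable_discrete:
  "g \<in> N \<rightarrow>\<^sub>M count_space (carrier G) \<Longrightarrow> (\<lambda>x. f (g x)) \<in> borel_measurable N"
  by (rule measurable_compose) auto

lemma measurable_walk [measurable (raw)]:
  assumes [measurable]: "y \<in> N \<rightarrow>\<^sub>M count_space (carrier G)"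
    and [measurable]: "\<And>n. (\<lambda>x. h x n) \<in> N \<rightarrow>\<^sub>M count_space (carrier G)"
  shows "(\<lambda>x. walk G (y x) (h x) n) \<in> N \<rightarrow>\<^sub>M count_space (carrier G)"
  by (induction n) simp_all

lemma measurable_pos [measurable]: "(\<lambda>h. pos h n) \<in> incs \<rightarrow>\<^sub>M count_space (carrier G)"
  by measurable

lemma measurable_shift [measurable]: "shift \<in> incs \<rightarrow>\<^sub>M incs"
  unfolding shift_def by (rule measurable_PiM_single') (auto simp: space_PiM)

lemma measurable_shift_funpow [measurable]: "(shift ^^ n) \<in> incs \<rightarrow>\<^sub>M incs"
  by (induction n) (auto simp: comp_def intro: measurable_compose[of _ _ incs])

lemma shift_funpow_apply: "(shift ^^ n) h k = h (n + k)"
  by (induction n arbitrary: h k) (simp_all add: shift_def)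

lemma walk_closed: "y \<in> carrier G \<Longrightarrow> h \<in> space incs \<Longrightarrow> walk G y h n \<in> carrier G"
  by (induction n) (auto simp: space_incs)

lemma walk_eq_mult_pos:
  "y \<in> carrier G \<Longrightarrow> h \<in> space incs \<Longrightarrow> walk G y h n = y \<otimes> pos h n"
  by (induction n) (auto simp: space_incs m_assoc walk_closed Pi_iff)

lemma shift_in_space: "h \<in> space incs \<Longrightarrow> shift h \<in> space incs"
  by (auto simp: space_incs shift_def)

lemma shift_walk: "y \<in> carrier G \<Longrightarrow> h \<in> space incs \<Longrightarrow> walk G y h (Suc n) = walk G (y \<otimes> h 0) (shift h) n"
  by (induction n) (auto simp: shift_def)

lemma pos_Suc_left: "h \<in> space incs \<Longrightarrow> pos h (Suc n) = h 0 \<otimes> pos (shift h) n"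
  using walk_eq_mult_pos[of "h 0" "shift h" n] shift_walk[of \<one> h n] shift_in_space[of h]
  by (simp add: space_incs Pi_iff del: walk.simps)

lemma walk_comb_seq: "m \<le> n \<Longrightarrow> walk G y (comb_seq n h h') m = walk G y h m"
  by (induction m) (auto simp: comb_seq_less)

lemma shift_comb_seq: "(shift ^^ n) (comb_seq n h h') = h'"
  by (auto simp: shift_funpow_apply fun_eq_iff comb_seq_def)

text \<open>The Markov property: replacing the increments from time \<open>n\<close> on by an independent copy does not
  change the law.\<close>

lemma nn_integral_split:
  assumes [measurable]: "f \<in> borel_measurable incs"
  shows "(\<integral>\<^sup>+ h. f h \<partial>incs) = (\<integral>\<^sup>+ h. (\<integral>\<^sup>+ h'. f (comb_seq n h h') \<partial>incs) \<partial>incs)"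
proof -
  have "(\<integral>\<^sup>+ h. f h \<partial>incs) = (\<integral>\<^sup>+ h. f h \<partial>distr (incs \<Otimes>\<^sub>M incs) incs (\<lambda>(h, h'). comb_seq n h h'))"
    by (simp add: iid.PiM_comb_seq)
  also have "\<dots> = (\<integral>\<^sup>+ p. f (case p of (h, h') \<Rightarrow> comb_seq n h h') \<partial>(incs \<Otimes>\<^sub>M incs))"
    by (rule nn_integral_distr) (use measurable_comb_seq in auto)
  also have "\<dots> = (\<integral>\<^sup>+ h. (\<integral>\<^sup>+ h'. f (comb_seq n h h') \<partial>incs) \<partial>incs)"
    by (subst iid.P.nn_integral_fst[symmetric]) auto
  finally show ?thesis .
qed

lemma nn_integral_split_first:
  assumes [measurable]: "f \<in> borel_measurable (inc \<Otimes>\<^sub>M incs)"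
  shows "(\<integral>\<^sup>+ h. f (h 0, shift h) \<partial>incs) = (\<integral>\<^sup>+ g. (\<integral>\<^sup>+ h. f (g, h) \<partial>incs) \<partial>inc)"
proof -
  have "(\<integral>\<^sup>+ h. f (h 0, shift h) \<partial>incs)
      = (\<integral>\<^sup>+ h. f (h 0, shift h) \<partial>distr (inc \<Otimes>\<^sub>M incs) incs (\<lambda>(g, h). case_nat g h))"
    by (simp add: iid.PiM_iter)
  also have "\<dots> = (\<integral>\<^sup>+ p. f p \<partial>(inc \<Otimes>\<^sub>M incs))"
  proof (subst nn_integral_distr)
    have "(\<lambda>h. f (h 0, shift h)) \<in> borel_measurable incs" by measurable
    then show "(\<lambda>h. f (h 0, shift h)) \<in> borel_measurable
        (distr (inc \<Otimes>\<^sub>M incs) incs (\<lambda>(g, h). case_nat g h))" by simp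
  qed (auto intro!: nn_integral_cong simp: shift_def)
  also have "\<dots> = (\<integral>\<^sup>+ g. (\<integral>\<^sup>+ h. f (g, h) \<partial>incs) \<partial>inc)"
    by (subst iid.P.nn_integral_fst[symmetric]) auto
  finally show ?thesis .
qed

lemma nn_integral_split_pos:
  assumes [measurable]: "f \<in> borel_measurable (count_space (carrier G) \<Otimes>\<^sub>M incs)"
  shows "(\<integral>\<^sup>+ h. f (pos h n, (shift ^^ n) h) \<partial>incs)
       = (\<integral>\<^sup>+ h. (\<integral>\<^sup>+ h'. f (pos h n, h') \<partial>incs) \<partial>incs)"
  by (subst nn_integral_split[of _ n]) (simp_all add: walk_comb_seq shift_comb_seq)

lemma distr_shift: "distr incs incs (shift ^^ n) = incs"
proof (rule measure_eqI)
  fix A assume "A \<in> sets (distr incs incs (shift ^^ n))"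
  then have [measurable]: "A \<in> sets incs" by simp
  have "emeasure (distr incs incs (shift ^^ n)) A = (\<integral>\<^sup>+ h. indicator A h \<partial>distr incs incs (shift ^^ n))"
    by simp
  also have "\<dots> = (\<integral>\<^sup>+ h. indicator A ((shift ^^ n) h) \<partial>incs)"
    by (rule nn_integral_distr) auto
  also have "\<dots> = emeasure incs A"
    using nn_integral_split_pos[of "\<lambda>(g, h). indicator A h" n]
    by (simp add: iid.P.emeasure_space_1)
  finally show "emeasure (distr incs incs (shift ^^ n)) A = emeasure incs A" .
qed simp

lemma AE_shift: "AE h in incs. P h \<Longrightarrow> AE h in incs. P ((shift ^^ n) h)"
  using AE_distrD[OF measurable_shift_funpow[of n], where P = P] by (simp only: distr_shift)

definition pos_prob :: "nat \<Rightarrow> 'a \<Rightarrow> real" where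
  "pos_prob n g = measure incs {h \<in> space incs. pos h n = g}"

lemma emeasure_pos: "emeasure incs {h \<in> space incs. pos h n = g} = ennreal (pos_prob n g)"
  unfolding pos_prob_def by (rule iid.P.emeasure_eq_measure)

lemma nn_integral_pos:
  "(\<integral>\<^sup>+ h. f (pos h n) \<partial>incs) = (\<integral>\<^sup>+ g. ennreal (pos_prob n g) * f g \<partial>count_space (carrier G))"
proof -
  have "(\<integral>\<^sup>+ h. f (pos h n) \<partial>incs)
      = (\<integral>\<^sup>+ h. (\<integral>\<^sup>+ g. f g * indicator {h \<in> space incs. pos h n = g} h \<partial>count_space (carrier G)) \<partial>incs)"
  proof (rule nn_integral_cong)
    fix h assume h: "h \<in> space incs"
    have "(\<integral>\<^sup>+ g. f g * indicator {h \<in> space incs. pos h n = g} h \<partial>count_space (carrier G))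
        = (\<integral>\<^sup>+ g. f g * indicator {pos h n} g \<partial>count_space (carrier G))"
      using h by (intro nn_integral_cong) (auto simp: indicator_def)
    also have "\<dots> = f (pos h n)"
      using h walk_closed[of \<one> h n] by (subst nn_integral_count_space'[of "{pos h n}"]) auto
    finally show "f (pos h n) = (\<integral>\<^sup>+ g. f g * indicator {h \<in> space incs. pos h n = g} h \<partial>count_space (carrier G))" ..
  qed
  also have "\<dots> = (\<integral>\<^sup>+ g. (\<integral>\<^sup>+ h. f g * indicator {h \<in> space incs. pos h n = g} h \<partial>incs) \<partial>count_space (carrier G))"
    by (rule nn_integral_count_space_nn_integral[OF countable_carrier]) measurable
  also have "\<dots> = (\<integral>\<^sup>+ g. ennreal (pos_prob n g) * f g \<partial>count_space (carrier G))"
    by (intro nn_integral_cong, subst nn_integral_cmult_indicator) (auto simp: emeasure_pos mult.commute)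
  finally show ?thesis .
qed

lemma pos_prob_le_1: "pos_prob n g \<le> 1" and pos_prob_nonneg: "0 \<le> pos_prob n g"
  by (auto simp: pos_prob_def)

lemma AE_pos_prob_pos: "AE h in incs. 0 < pos_prob n (pos h n)"
proof -
  have "(\<integral>\<^sup>+ h. indicator {g. pos_prob n g = 0} (pos h n) \<partial>incs) = 0"
    by (subst nn_integral_pos) (auto intro!: nn_integral_zero' AE_I2 simp: indicator_def)
  then have "AE h in incs. indicator {g. pos_prob n g = 0} (pos h n) = (0::ennreal)"
    by (subst (asm) nn_integral_0_iff_AE) (auto intro!: measurable_compose[OF measurable_pos])
  then show ?thesis
    by eventually_elim (metis (mono_tags) indicator_eq_0_iff less_eq_real_def mem_Collect_eq pos_prob_nonneg)
qed

lemma nn_integral_first: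
  "(\<integral>\<^sup>+ h. f (pos h 1) \<partial>incs) = (\<integral>\<^sup>+ g. f g \<partial>inc)"
proof -
  have "(\<integral>\<^sup>+ h. f (pos h 1) \<partial>incs) = (\<integral>\<^sup>+ h. f (h 0) \<partial>incs)"
    by (intro nn_integral_cong) (auto simp: space_incs Pi_iff)
  also have "\<dots> = (\<integral>\<^sup>+ x. f x \<partial>inc)"
  proof -
    have "f \<in> borel_measurable inc"
      by (simp add: measurable_cong_sets[OF sets_inc refl])
    then have "(\<lambda>p. f (fst p)) \<in> borel_measurable (inc \<Otimes>\<^sub>M incs)"
      by (rule measurable_compose[OF measurable_fst])
    from nn_integral_split_first[OF this] show ?thesis
      by (simp add: iid.P.emeasure_space_1)
  qed
  finally show ?thesis .
qed

lemma nn_integral_point: "g \<in> carrier G \<Longrightarrow> (\<integral>\<^sup>+ x. f x * indicator {g} x \<partial>count_space (carrier G)) = f g"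
  by (subst nn_integral_count_space'[of "{g}"]) auto

lemma pos_prob_eq_nn_integral: "g \<in> carrier G \<Longrightarrow> ennreal (pos_prob n g) = (\<integral>\<^sup>+ h. indicator {g} (pos h n) \<partial>incs)"
  by (simp add: nn_integral_pos nn_integral_point)

lemma pos_prob_1: "g \<in> carrier G \<Longrightarrow> pos_prob 1 g = pmf \<mu> g"
  using nn_integral_first[of "indicator {g}"] pos_prob_eq_nn_integral[of g 1]
  by (simp add: nn_integral_inc nn_integral_point pos_prob_nonneg del: walk.simps)

text \<open>Reaching \<open>g\<close> at time \<open>n\<close> and then making the increment \<open>g'\<close> is one way of being at
  \<open>g \<otimes> g'\<close>. This is the source of the subadditivity of information.\<close>

lemma pos_prob_Suc:
  assumes [simp]: "g \<in> carrier G" "g' \<in> carrier G"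
  shows "pos_prob n g * pmf \<mu> g' \<le> pos_prob (Suc n) (g \<otimes> g')"
proof -
  have "ennreal (pos_prob n g * pmf \<mu> g')
      = (\<integral>\<^sup>+ h. indicator {g} (pos h n) * (\<integral>\<^sup>+ h'. indicator {g'} (pos h' 1) \<partial>incs) \<partial>incs)"
    unfolding pos_prob_eq_nn_integral[OF assms(2), symmetric]
    by (subst nn_integral_multc)
      (auto intro!: measurable_compose[OF measurable_pos] simp: pos_prob_1[symmetric] pos_prob_nonneg ennreal_mult simp flip: pos_prob_eq_nn_integral)
  also have "\<dots> = (\<integral>\<^sup>+ h. (\<integral>\<^sup>+ h'. indicator {g} (pos h n) * indicator {g'} (pos h' 1) \<partial>incs) \<partial>incs)"
    by (subst nn_integral_cmult) (auto intro!: measurable_compose[OF measurable_pos] simp del: walk.simps)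
  also have "\<dots> = (\<integral>\<^sup>+ h. indicator {g} (pos h n) * indicator {g'} (pos ((shift ^^ n) h) 1) \<partial>incs)"
  proof -
    have "(\<lambda>(x, h'). indicator {g} x * indicator {g'} (pos h' 1) :: ennreal)
        \<in> borel_measurable (count_space (carrier G) \<Otimes>\<^sub>M incs)"
      unfolding case_prod_beta
      by (intro borel_measurable_times_ennreal; rule borel_measurable_discrete)
        (auto intro: measurable_compose[OF measurable_snd measurable_pos] simp del: walk.simps)
    from nn_integral_split_pos[OF this, of n] show ?thesis
      by (simp del: walk.simps)
  qed
  also have "\<dots> \<le> (\<integral>\<^sup>+ h. indicator {g \<otimes> g'} (pos h (Suc n)) \<partial>incs)"
    by (intro nn_integral_mono) (auto simp: indicator_def shift_funpow_apply space_incs Pi_iff)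
  also have "\<dots> = ennreal (pos_prob (Suc n) (g \<otimes> g'))"
    by (simp add: pos_prob_eq_nn_integral del: walk.simps)
  finally show ?thesis by (simp add: pos_prob_nonneg)
qed

end

section \<open>Densities of translates\<close>

definition translate :: "'x measure \<Rightarrow> ('a \<Rightarrow> 'x \<Rightarrow> 'x) \<Rightarrow> 'a \<Rightarrow> 'x measure" where
  "translate X act g = distr X X (act g)"

text \<open>A real-valued version of the Radon-Nikodym derivative; where the derivative is infinite, which
  happens on a null set when the translate is absolutely continuous, the value is zero.\<close>

definition translation_density :: "'x measure \<Rightarrow> ('a \<Rightarrow> 'x \<Rightarrow> 'x) \<Rightarrow> 'a \<Rightarrow> 'x \<Rightarrow> real" where
  "translation_density X act g x = enn2real (RN_deriv X (translate X act g) x)"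

lemma translation_density_measurable [measurable]:
  "translation_density X act g \<in> borel_measurable X"
  unfolding translation_density_def by measurable

lemma translation_density_nonneg [simp]: "0 \<le> translation_density X act g x"
  by (simp add: translation_density_def)

locale measurable_action = group G + prob_space X
  for G :: "('a, 'b) monoid_scheme" (structure) and X :: "'x measure" and act :: "'a \<Rightarrow> 'x \<Rightarrow> 'x" +
  assumes countable_group: "countable (carrier G)"
    and act_measurable: "g \<in> carrier G \<Longrightarrow> act g \<in> X \<rightarrow>\<^sub>M X"
    and act_one: "x \<in> space X \<Longrightarrow> act \<one> x = x"
    and act_mult: "g \<in> carrier G \<Longrightarrow> g' \<in> carrier G \<Longrightarrow> x \<in> space X \<Longrightarrow> act (g \<otimes> g') x = act g (act g' x)"
begin

abbreviation r :: "'a \<Rightarrow> 'x \<Rightarrow> real" where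
  "r \<equiv> translation_density X act"

text \<open>The action need not preserve the measure class of \<open>X\<close>: stationarity yields absolute continuity only
  for translates by group elements that the walk can reach.\<close>

definition nonsingular :: "'a \<Rightarrow> bool" where
  "nonsingular g \<longleftrightarrow> g \<in> carrier G \<and> absolutely_continuous X (translate X act g)"

lemma act_closed: "g \<in> carrier G \<Longrightarrow> x \<in> space X \<Longrightarrow> act g x \<in> space X"
  using act_measurable[THEN measurable_space] by auto

lemma act_inv: "g \<in> carrier G \<Longrightarrow> x \<in> space X \<Longrightarrow> act (inv g) (act g x) = x"
  using act_mult[of "inv g" g x] act_one[of x] by simp

lemma measurable_act [measurable (raw)]:
  assumes "f \<in> N \<rightarrow>\<^sub>M count_space (carrier G)" "b \<in> N \<rightarrow>\<^sub>M X"
  shows "(\<lambda>x. act (f x) (b x)) \<in> N \<rightarrow>\<^sub>M X"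
  by (rule measurable_compose_countable'[OF _ assms(1) countable_group])
    (rule measurable_compose[OF assms(2) act_measurable])

lemma measurable_r [measurable (raw)]:
  assumes "f \<in> N \<rightarrow>\<^sub>M count_space (carrier G)" "b \<in> N \<rightarrow>\<^sub>M X"
  shows "(\<lambda>x. r (f x) (b x)) \<in> borel_measurable N"
  by (rule measurable_compose_countable'[OF _ assms(1) countable_group])
    (rule measurable_compose[OF assms(2) translation_density_measurable])

lemma nn_integral_translate:
  assumes "nonsingular g" and [measurable]: "f \<in> borel_measurable X"
  shows "(\<integral>\<^sup>+ y. f (act g y) \<partial>X) = (\<integral>\<^sup>+ y. ennreal (r g y) * f y \<partial>X)"
proof -
  have g: "g \<in> carrier G" and ac: "absolutely_continuous X (translate X act g)"
    using assms by (auto simp: nonsingular_def)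
  have [measurable]: "act g \<in> X \<rightarrow>\<^sub>M X" using g by (rule act_measurable)
  interpret gX: prob_space "translate X act g"
    unfolding translate_def by (rule prob_space_distr) measurable
  have s: "sets (translate X act g) = sets X" by (simp add: translate_def)
  have "AE y in X. RN_deriv X (translate X act g) y \<noteq> \<infinity>"
    by (rule RN_deriv_finite) (use ac s gX.sigma_finite_measure_axioms in auto)
  then have fin: "AE y in X. RN_deriv X (translate X act g) y = ennreal (r g y)"
    by eventually_elim (simp add: translation_density_def top.not_eq_extremum)
  have "(\<integral>\<^sup>+ y. f (act g y) \<partial>X) = (\<integral>\<^sup>+ y. f y \<partial>translate X act g)"
    unfolding translate_def by (rule nn_integral_distr[symmetric]) auto
  also have "\<dots> = (\<integral>\<^sup>+ y. RN_deriv X (translate X act g) y * f y \<partial>X)"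
    by (rule RN_deriv_nn_integral) (use ac s in auto)
  also have "\<dots> = (\<integral>\<^sup>+ y. ennreal (r g y) * f y \<partial>X)"
    using fin by (intro nn_integral_cong_AE) auto
  finally show ?thesis .
qed

lemma AE_translate:
  assumes "nonsingular g" and "AE y in X. P y"
  shows "AE y in X. P (act g y)"
proof -
  have g: "g \<in> carrier G" and ac: "absolutely_continuous X (translate X act g)"
    using assms by (auto simp: nonsingular_def)
  have "AE y in translate X act g. P y"
    using ac assms(2) by (rule absolutely_continuous_AE[rotated]) (simp add: translate_def)
  then show ?thesis
    unfolding translate_def using act_measurable[OF g] by (rule AE_distrD[rotated])
qed

lemma nonsingular_mult:
  assumes "nonsingular g" "nonsingular g'"
  shows "nonsingular (g \<otimes> g')"
  unfolding nonsingular_def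
proof
  have [simp]: "g \<in> carrier G" "g' \<in> carrier G"
    using assms by (auto simp: nonsingular_def)
  then show "g \<otimes> g' \<in> carrier G" by simp
  show "absolutely_continuous X (translate X act (g \<otimes> g'))"
    unfolding absolutely_continuous_def
  proof
    fix N assume N: "N \<in> null_sets X"
    then have "AE y in X. y \<notin> N" by (rule AE_not_in)
    then have "AE y in X. act g y \<notin> N" by (rule AE_translate[OF assms(1)])
    then have "AE y in X. act g (act g' y) \<notin> N" by (rule AE_translate[OF assms(2)])
    then have *: "AE y in X. act (g \<otimes> g') y \<notin> N"
      using AE_space by eventually_elim (simp add: act_mult)
    have [measurable]: "N \<in> sets X" using N by auto
    have "emeasure (translate X act (g \<otimes> g')) N
        = emeasure X (act (g \<otimes> g') -` N \<inter> space X)"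
      unfolding translate_def by (rule emeasure_distr) (auto intro: act_measurable)
    also have "\<dots> = 0"
      using * by (subst AE_iff_measurable[symmetric]) (auto intro: measurable_sets[OF act_measurable])
    finally show "N \<in> null_sets (translate X act (g \<otimes> g'))"
      by (auto simp: translate_def null_sets_def)
  qed
qed

lemma density_AE_unique:
  fixes u v :: "'x \<Rightarrow> real"
  assumes [measurable]: "u \<in> borel_measurable X" "v \<in> borel_measurable X"
    and "\<And>y. 0 \<le> u y" "\<And>y. 0 \<le> v y"
    and "(\<integral>\<^sup>+ y. ennreal (u y) \<partial>X) < \<infinity>"
    and eq: "\<And>A. A \<in> sets X \<Longrightarrow> (\<integral>\<^sup>+ y. ennreal (u y) * indicator A y \<partial>X) = (\<integral>\<^sup>+ y. ennreal (v y) * indicator A y \<partial>X)"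
  shows "AE y in X. u y = v y"
proof -
  have "density X (\<lambda>y. ennreal (u y)) = density X (\<lambda>y. ennreal (v y))"
    by (rule measure_eqI) (auto simp: emeasure_density eq)
  then have "AE y in X. ennreal (u y) = ennreal (v y)"
    using assms(5) by (subst finite_density_unique[symmetric]) auto
  then show ?thesis
    by eventually_elim (use assms in auto)
qed

lemma nn_integral_r: "nonsingular g \<Longrightarrow> (\<integral>\<^sup>+ y. ennreal (r g y) \<partial>X) = 1"
  using nn_integral_translate[of g "\<lambda>_. 1"] by (simp add: emeasure_space_1)

text \<open>The chain rule for Radon-Nikodym derivatives, applied to \<open>X\<close>, its translate by \<open>g\<close>, and the translate
  by \<open>g\<close> of its translate by \<open>g'\<close>.\<close>

lemma r_cocycle:
  assumes "nonsingular g" "nonsingular g'"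
  shows "AE y in X. r (g \<otimes> g') y = r g y * r g' (act (inv g) y)"
proof (rule density_AE_unique)
  have [simp]: "g \<in> carrier G" "g' \<in> carrier G"
    using assms by (auto simp: nonsingular_def)
  have [measurable]: "act g \<in> X \<rightarrow>\<^sub>M X" "act (inv g) \<in> X \<rightarrow>\<^sub>M X"
    by (auto intro: act_measurable)
  show "(\<lambda>y. r g y * r g' (act (inv g) y)) \<in> borel_measurable X" by measurable
  fix A assume [measurable]: "A \<in> sets X"
  have "(\<integral>\<^sup>+ y. ennreal (r (g \<otimes> g') y) * indicator A y \<partial>X) = (\<integral>\<^sup>+ y. indicator A (act (g \<otimes> g') y) \<partial>X)"
    using assms by (intro nn_integral_translate[symmetric] nonsingular_mult) auto
  also have "\<dots> = (\<integral>\<^sup>+ y. indicator A (act g (act g' y)) \<partial>X)"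
    by (intro nn_integral_cong) (simp add: act_mult)
  also have "\<dots> = (\<integral>\<^sup>+ y. ennreal (r g' y) * indicator A (act g y) \<partial>X)"
    by (rule nn_integral_translate[OF assms(2)]) measurable
  also have "\<dots> = (\<integral>\<^sup>+ y. ennreal (r g' (act (inv g) (act g y))) * indicator A (act g y) \<partial>X)"
    by (intro nn_integral_cong) (simp add: act_inv)
  also have "\<dots> = (\<integral>\<^sup>+ y. ennreal (r g y) * (ennreal (r g' (act (inv g) y)) * indicator A y) \<partial>X)"
    by (rule nn_integral_translate[OF assms(1)]) measurable
  finally show "(\<integral>\<^sup>+ y. ennreal (r (g \<otimes> g') y) * indicator A y \<partial>X)
      = (\<integral>\<^sup>+ y. ennreal (r g y * r g' (act (inv g) y)) * indicator A y \<partial>X)"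
    by (simp add: ennreal_mult mult.assoc)
qed (use assms in \<open>auto simp: nn_integral_r nonsingular_mult\<close>)

end

section \<open>Stationary systems\<close>

text \<open>An abstract boundary of the walk. The equation for \<open>\<beta>\<close> combines invariance of the boundary map under
  the time shift with its equivariance: shifting the path \<open>x\<close> in time gives the translate by \<open>h 0\<close>
  of the path with increments \<open>shift h\<close>.\<close>

locale boundary_system = random_walk G \<mu> + measurable_action G X act
  for G :: "('a, 'b) monoid_scheme" (structure) and \<mu> :: "'a pmf"
    and X :: "'x measure" and act :: "'a \<Rightarrow> 'x \<Rightarrow> 'x" +
  fixes \<beta> :: "(nat \<Rightarrow> 'a) \<Rightarrow> 'x"
  assumes \<beta>_measurable [measurable]: "\<beta> \<in> incs \<rightarrow>\<^sub>M X"
    and distr_\<beta>: "distr incs X \<beta> = X"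
    and equivariant: "AE h in incs. \<beta> h = act (h 0) (\<beta> (shift h))"
begin

lemma nn_integral_\<beta>: "f \<in> borel_measurable X \<Longrightarrow> (\<integral>\<^sup>+ h. f (\<beta> h) \<partial>incs) = (\<integral>\<^sup>+ y. f y \<partial>X)"
  using nn_integral_distr[OF \<beta>_measurable, of f] by (simp add: distr_\<beta>)

lemma AE_\<beta>: "AE y in X. P y \<Longrightarrow> AE h in incs. P (\<beta> h)"
  using AE_distrD[OF \<beta>_measurable, where P = P] by (simp only: distr_\<beta>)

lemma equivariant_pos: "AE h in incs. \<beta> h = act (pos h n) (\<beta> ((shift ^^ n) h))"
proof (induction n)
  case 0
  show ?case
    by (rule AE_I2) (use \<beta>_measurable[THEN measurable_space] in \<open>simp add: act_one\<close>)
next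
  case (Suc n)
  note Suc AE_shift[OF equivariant, of n]
  then show ?case
    using AE_space
  proof eventually_elim
    fix h assume h: "h \<in> space incs" and
      1: "\<beta> h = act (pos h n) (\<beta> ((shift ^^ n) h))" and
      2: "\<beta> ((shift ^^ n) h) = act ((shift ^^ n) h 0) (\<beta> (shift ((shift ^^ n) h)))"
    have "(shift ^^ Suc n) h \<in> space incs"
      using measurable_space[OF measurable_shift_funpow h] .
    then show "\<beta> h = act (pos h (Suc n)) (\<beta> ((shift ^^ Suc n) h))"
      using h 1 2 measurable_space[OF \<beta>_measurable, of "(shift ^^ Suc n) h"] walk_closed[of \<one> h n]
      by (simp add: shift_funpow_apply act_mult space_incs Pi_iff)
  qed
qed

text \<open>Given the first \<open>n\<close> increments, \<open>\<beta> h\<close> is the translate by \<open>x\<^sub>n\<close> of a boundary point that depends only on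
  the later increments and has law \<open>X\<close>.\<close>

lemma nn_integral_pos_\<beta>:
  assumes f: "f \<in> borel_measurable (count_space (carrier G) \<Otimes>\<^sub>M X)"
  shows "(\<integral>\<^sup>+ h. f (pos h n, \<beta> h) \<partial>incs)
       = (\<integral>\<^sup>+ h. (\<integral>\<^sup>+ y. f (pos h n, act (pos h n) y) \<partial>X) \<partial>incs)"
proof -
  note [measurable] = f
  have "(\<integral>\<^sup>+ h. f (pos h n, \<beta> h) \<partial>incs) = (\<integral>\<^sup>+ h. f (pos h n, act (pos h n) (\<beta> ((shift ^^ n) h))) \<partial>incs)"
    by (rule nn_integral_cong_AE) (use equivariant_pos[of n] in eventually_elim, simp)
  also have "\<dots> = (\<integral>\<^sup>+ h. (\<integral>\<^sup>+ h'. f (pos h n, act (pos h n) (\<beta> h')) \<partial>incs) \<partial>incs)"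
  proof -
    have "(\<lambda>(g, h'). f (g, act g (\<beta> h'))) \<in> borel_measurable (count_space (carrier G) \<Otimes>\<^sub>M incs)"
      by measurable
    from nn_integral_split_pos[OF this, of n] show ?thesis by simp
  qed
  also have "\<dots> = (\<integral>\<^sup>+ h. (\<integral>\<^sup>+ y. f (pos h n, act (pos h n) y) \<partial>X) \<partial>incs)"
  proof (rule nn_integral_cong)
    fix h assume "h \<in> space incs"
    then have [simp]: "pos h n \<in> carrier G" by (simp add: walk_closed)
    have [measurable]: "act (pos h n) \<in> X \<rightarrow>\<^sub>M X" by (rule act_measurable) simp
    show "(\<integral>\<^sup>+ h'. f (pos h n, act (pos h n) (\<beta> h')) \<partial>incs) = (\<integral>\<^sup>+ y. f (pos h n, act (pos h n) y) \<partial>X)"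
      by (rule nn_integral_\<beta>) measurable
  qed
  finally show ?thesis .
qed

text \<open>The left side is the probability that the walk is at \<open>g\<close> at time \<open>n\<close> and \<open>\<beta>\<close> lies in \<open>A\<close>.\<close>

lemma pos_prob_translate_le:
  assumes "g \<in> carrier G" and [measurable]: "A \<in> sets X"
  shows "ennreal (pos_prob n g) * (\<integral>\<^sup>+ y. indicator A (act g y) \<partial>X) \<le> emeasure X A"
proof -
  have "(\<integral>\<^sup>+ h. (\<integral>\<^sup>+ y. indicator A (act (pos h n) y) \<partial>X) \<partial>incs) = (\<integral>\<^sup>+ h. indicator A (\<beta> h) \<partial>incs)"
    using nn_integral_pos_\<beta>[of "\<lambda>(g, y). indicator A y" n] by simp
  also have "\<dots> = emeasure X A"
    by (subst nn_integral_\<beta>) auto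
  finally have *: "(\<integral>\<^sup>+ x. ennreal (pos_prob n x) * (\<integral>\<^sup>+ y. indicator A (act x y) \<partial>X) \<partial>count_space (carrier G)) = emeasure X A"
    by (simp add: nn_integral_pos[of "\<lambda>x. \<integral>\<^sup>+ y. indicator A (act x y) \<partial>X"])
  have "ennreal (pos_prob n g) * (\<integral>\<^sup>+ y. indicator A (act g y) \<partial>X)
      = (\<integral>\<^sup>+ x. ennreal (pos_prob n x) * (\<integral>\<^sup>+ y. indicator A (act x y) \<partial>X) * indicator {g} x \<partial>count_space (carrier G))"
    by (simp add: nn_integral_point assms)
  also have "\<dots> \<le> emeasure X A"
    unfolding *[symmetric] by (intro nn_integral_mono) (auto simp: indicator_def)
  finally show ?thesis .
qed

lemma nonsingular_of_pos_prob:
  assumes "0 < pos_prob n g" "g \<in> carrier G"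
  shows "nonsingular g"
  unfolding nonsingular_def absolutely_continuous_def
proof (intro conjI subsetI)
  fix N assume N: "N \<in> null_sets X"
  then have [measurable]: "N \<in> sets X" by auto
  have "emeasure (translate X act g) N = (\<integral>\<^sup>+ y. indicator N y \<partial>translate X act g)"
    by (simp add: translate_def)
  also have "\<dots> = (\<integral>\<^sup>+ y. indicator N (act g y) \<partial>X)"
    unfolding translate_def by (rule nn_integral_distr) (auto intro: act_measurable assms)
  also have "\<dots> = 0"
    using pos_prob_translate_le[OF assms(2), of N n] N assms(1) by auto
  finally show "N \<in> null_sets (translate X act g)"
    by (auto simp: translate_def null_sets_def)
qed fact

text \<open>The left side is the conditional probability of being at \<open>g\<close> at time \<open>n\<close> given \<open>\<beta> h = y\<close>.\<close>

lemma pos_prob_r_le_1: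
  assumes "0 < pos_prob n g" "g \<in> carrier G"
  shows "AE y in X. pos_prob n g * r g y \<le> 1"
proof -
  let ?A = "{y \<in> space X. 1 < pos_prob n g * r g y}"
  have [measurable]: "?A \<in> sets X" by measurable
  have ns: "nonsingular g" using nonsingular_of_pos_prob assms .
  have fin: "(\<integral>\<^sup>+ y. indicator ?A y \<partial>X) < \<infinity>" by (simp add: less_top[symmetric])
  have "(\<integral>\<^sup>+ y. ennreal (pos_prob n g * r g y) * indicator ?A y \<partial>X)
      = ennreal (pos_prob n g) * (\<integral>\<^sup>+ y. indicator ?A (act g y) \<partial>X)"
    by (subst nn_integral_translate[OF ns])
      (auto simp: nn_integral_cmult[symmetric] ennreal_mult pos_prob_nonneg mult.assoc intro!: nn_integral_cong)
  also have "\<dots> \<le> (\<integral>\<^sup>+ y. indicator ?A y \<partial>X)"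
    using pos_prob_translate_le[OF assms(2), of ?A n] by simp
  finally have le: "(\<integral>\<^sup>+ y. ennreal (pos_prob n g * r g y) * indicator ?A y \<partial>X) \<le> (\<integral>\<^sup>+ y. indicator ?A y \<partial>X)" .
  have "(\<integral>\<^sup>+ y. (ennreal (pos_prob n g * r g y) * indicator ?A y) - indicator ?A y \<partial>X)
      = (\<integral>\<^sup>+ y. ennreal (pos_prob n g * r g y) * indicator ?A y \<partial>X) - (\<integral>\<^sup>+ y. indicator ?A y \<partial>X)"
    using fin by (intro nn_integral_diff) (auto simp: indicator_def ennreal_ge_1 intro!: AE_I2)
  also have "\<dots> = 0" using le order.strict_trans1[OF le fin] by (simp add: diff_eq_0_iff_ennreal)
  finally have "AE y in X. (ennreal (pos_prob n g * r g y) * indicator ?A y) - indicator ?A y = 0"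
    by (subst (asm) nn_integral_0_iff_AE) auto
  then show ?thesis using AE_space
  proof eventually_elim
    fix y assume 1: "ennreal (pos_prob n g * r g y) * indicator ?A y - indicator ?A y = 0" and y: "y \<in> space X"
    show "pos_prob n g * r g y \<le> 1"
    proof (rule ccontr)
      assume gt: "\<not> pos_prob n g * r g y \<le> 1"
      then have "ennreal (pos_prob n g * r g y) - 1 = 0" using 1 y by simp
      then show False using gt by (simp add: diff_eq_0_iff_ennreal)
    qed
  qed
qed

text \<open>Under the joint law of \<open>x\<^sub>n\<close> and \<open>\<beta>\<close> the two coordinates are independent up to the density
  \<open>r\<close>. This turns expectations along the path into integrals over the product of the marginals.\<close>

lemma nn_integral_pos_\<beta>_density:
  assumes f: "f \<in> borel_measurable (count_space (carrier G) \<Otimes>\<^sub>M X)"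
  shows "(\<integral>\<^sup>+ h. f (pos h n, \<beta> h) \<partial>incs)
       = (\<integral>\<^sup>+ h. (\<integral>\<^sup>+ y. ennreal (r (pos h n) y) * f (pos h n, y) \<partial>X) \<partial>incs)"
  unfolding nn_integral_pos_\<beta>[OF f]
proof (rule nn_integral_cong_AE)
  show "AE h in incs. (\<integral>\<^sup>+ y. f (pos h n, act (pos h n) y) \<partial>X) = (\<integral>\<^sup>+ y. ennreal (r (pos h n) y) * f (pos h n, y) \<partial>X)"
    using AE_pos_prob_pos[of n] AE_space
  proof eventually_elim
    fix h assume "0 < pos_prob n (pos h n)" and [simp]: "h \<in> space incs"
    then have "nonsingular (pos h n)" by (intro nonsingular_of_pos_prob[of n] walk_closed) auto
    moreover have "pos h n \<in> carrier G" by (simp add: walk_closed)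
    then have "(\<lambda>y. f (pos h n, y)) \<in> borel_measurable X"
      using f by (auto intro: measurable_compose[OF _ f])
    ultimately show "(\<integral>\<^sup>+ y. f (pos h n, act (pos h n) y) \<partial>X) = (\<integral>\<^sup>+ y. ennreal (r (pos h n) y) * f (pos h n, y) \<partial>X)"
      by (rule nn_integral_translate)
  qed
qed

lemma nonsingular_pos: "AE h in incs. nonsingular (pos h n)"
  using AE_pos_prob_pos[of n] AE_space by eventually_elim (rule nonsingular_of_pos_prob[OF _ walk_closed], auto)

lemma nonsingular_inc: "AE h in incs. nonsingular (h n)"
proof -
  have "AE h in incs. 0 < pos_prob 1 (pos ((shift ^^ n) h) 1)"
    using AE_pos_prob_pos by (rule AE_shift)
  then show ?thesis
    using AE_space
  proof eventually_elim
    fix h assume "0 < pos_prob 1 (pos ((shift ^^ n) h) 1)" "h \<in> space incs"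
    then show "nonsingular (h n)"
      by (intro nonsingular_of_pos_prob[of 1]) (auto simp: shift_funpow_apply space_incs Pi_iff)
  qed
qed

lemma r_pos_positive: "AE h in incs. 0 < r (pos h n) (\<beta> h)"
proof -
  let ?f = "\<lambda>(g, y). indicator {p. p \<in> carrier G \<times> space X \<and> r (fst p) (snd p) = 0} (g, y) :: ennreal"
  have [measurable]: "?f \<in> borel_measurable (count_space (carrier G) \<Otimes>\<^sub>M X)"
  proof -
    have "{p \<in> space (count_space (carrier G) \<Otimes>\<^sub>M X). r (fst p) (snd p) = 0} \<in> sets (count_space (carrier G) \<Otimes>\<^sub>M X)"
      by measurable
    then show ?thesis by (simp add: space_pair_measure conj_commute)
  qed
  have "(\<integral>\<^sup>+ h. ?f (pos h n, \<beta> h) \<partial>incs) = 0"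
    unfolding nn_integral_pos_\<beta>_density[OF \<open>?f \<in> _\<close>]
    by (intro nn_integral_zero' AE_I2) (auto simp: indicator_def intro!: nn_integral_zero')
  then have "AE h in incs. ?f (pos h n, \<beta> h) = 0"
    by (subst (asm) nn_integral_0_iff_AE) measurable
  then show ?thesis using AE_space
  proof eventually_elim
    fix h assume 1: "?f (pos h n, \<beta> h) = 0" and h: "h \<in> space incs"
    have "\<beta> h \<in> space X" "pos h n \<in> carrier G"
      using h measurable_space[OF \<beta>_measurable h] by (auto intro: walk_closed)
    with 1 have "r (pos h n) (\<beta> h) \<noteq> 0" by (auto simp: indicator_def split: if_splits)
    then show "0 < r (pos h n) (\<beta> h)"
      by (intro le_neq_trans) auto
  qed
qed

lemma r_one: "AE y in X. r \<one> y = 1"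
proof (rule density_AE_unique)
  have "pos_prob 0 \<one> = 1"
    using iid.P.prob_space by (simp add: pos_prob_def)
  then have "nonsingular \<one>" by (intro nonsingular_of_pos_prob[of 0]) auto
  then show "(\<integral>\<^sup>+ y. ennreal (r \<one> y) \<partial>X) < \<infinity>" by (simp add: nn_integral_r)
  fix A assume [measurable]: "A \<in> sets X"
  have "(\<integral>\<^sup>+ y. ennreal (r \<one> y) * indicator A y \<partial>X) = (\<integral>\<^sup>+ y. indicator A (act \<one> y) \<partial>X)"
    by (rule nn_integral_translate[symmetric, OF \<open>nonsingular \<one>\<close>]) measurable
  also have "\<dots> = (\<integral>\<^sup>+ y. ennreal 1 * indicator A y \<partial>X)"
    by (rule nn_integral_cong) (simp add: act_one)
  finally show "(\<integral>\<^sup>+ y. ennreal (r \<one> y) * indicator A y \<partial>X) = (\<integral>\<^sup>+ y. ennreal 1 * indicator A y \<partial>X)" .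
qed auto

text \<open>The cocycle identity at \<open>g = x\<^sub>n\<close> and \<open>g' = h\<^sub>n\<close>: the inverse of \<open>x\<^sub>n\<close> carries \<open>\<beta> h\<close> to the boundary
  point of the walk restarted at time \<open>n\<close>.\<close>

lemma r_pos_Suc:
  "AE h in incs. r (pos h (Suc n)) (\<beta> h) = r (pos h n) (\<beta> h) * r (h n) (\<beta> ((shift ^^ n) h))"
proof -
  have "AE y in X. \<forall>g \<in> carrier G. \<forall>g' \<in> carrier G.
      nonsingular g \<longrightarrow> nonsingular g' \<longrightarrow> r (g \<otimes> g') y = r g y * r g' (act (inv g) y)"
    by (intro AE_ball_countable[THEN iffD2] countable_group ballI AE_impI r_cocycle)
  then have "AE h in incs. \<forall>g \<in> carrier G. \<forall>g' \<in> carrier G.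
      nonsingular g \<longrightarrow> nonsingular g' \<longrightarrow> r (g \<otimes> g') (\<beta> h) = r g (\<beta> h) * r g' (act (inv g) (\<beta> h))"
    by (rule AE_\<beta>)
  then show ?thesis
    using nonsingular_pos[of n] nonsingular_inc[of n] equivariant_pos[of n] AE_space
  proof eventually_elim
    fix h assume coc: "\<forall>g \<in> carrier G. \<forall>g' \<in> carrier G.
      nonsingular g \<longrightarrow> nonsingular g' \<longrightarrow> r (g \<otimes> g') (\<beta> h) = r g (\<beta> h) * r g' (act (inv g) (\<beta> h))"
      and ns: "nonsingular (pos h n)" "nonsingular (h n)"
      and eq: "\<beta> h = act (pos h n) (\<beta> ((shift ^^ n) h))" and h: "h \<in> space incs"
    have c: "pos h n \<in> carrier G" "h n \<in> carrier G"
      using ns by (auto simp: nonsingular_def)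
    have "\<beta> ((shift ^^ n) h) \<in> space X"
      by (rule measurable_space[OF \<beta>_measurable measurable_space[OF measurable_shift_funpow h]])
    then have "act (inv (pos h n)) (\<beta> h) = \<beta> ((shift ^^ n) h)"
      by (subst eq) (simp add: act_inv c)
    then show "r (pos h (Suc n)) (\<beta> h) = r (pos h n) (\<beta> h) * r (h n) (\<beta> ((shift ^^ n) h))"
      using coc c ns by simp
  qed
qed

definition log_r :: "(nat \<Rightarrow> 'a) \<Rightarrow> real" where
  "log_r h = ln (r (h 0) (\<beta> h))"

lemma measurable_log_r [measurable]: "log_r \<in> borel_measurable incs"
  unfolding log_r_def by measurable

lemma r_first_positive: "AE h in incs. 0 < r (h 0) (\<beta> h)"
  using r_pos_positive[of 1] AE_space
  by eventually_elim (auto simp: space_incs Pi_iff)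

lemma ln_r_pos: "AE h in incs. ln (r (pos h n) (\<beta> h)) = (\<Sum>i<n. log_r ((shift ^^ i) h))"
proof (induction n)
  case 0
  show ?case using AE_\<beta>[OF r_one] by eventually_elim simp
next
  case (Suc n)
  note Suc r_pos_Suc[of n] r_pos_positive[of n] AE_shift[OF r_first_positive, of n]
  then show ?case
    by eventually_elim (simp add: ln_mult log_r_def shift_funpow_apply[where k = 0])
qed

text \<open>The information gained from observing \<open>x\<^sub>n\<close> when \<open>\<beta> h\<close> is already known; its mean is the conditional
  entropy of \<open>x\<^sub>n\<close> given the boundary.\<close>

definition info :: "nat \<Rightarrow> (nat \<Rightarrow> 'a) \<Rightarrow> real" where
  "info n h = - ln (pos_prob n (pos h n) * r (pos h n) (\<beta> h))"

lemma measurable_info [measurable]: "info n \<in> borel_measurable incs"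
  unfolding info_def using borel_measurable_discrete[OF measurable_pos, of "pos_prob n"] by measurable

lemma info_nonneg: "AE h in incs. 0 \<le> info n h"
proof -
  have "AE y in X. \<forall>g \<in> carrier G. 0 < pos_prob n g \<longrightarrow> pos_prob n g * r g y \<le> 1"
    by (intro AE_ball_countable[THEN iffD2] countable_group ballI AE_impI pos_prob_r_le_1)
  then have "AE h in incs. \<forall>g \<in> carrier G. 0 < pos_prob n g \<longrightarrow> pos_prob n g * r g (\<beta> h) \<le> 1"
    by (rule AE_\<beta>)
  then show ?thesis
    using AE_pos_prob_pos[of n] r_pos_positive[of n] AE_space
  proof eventually_elim
    fix h assume 1: "\<forall>g \<in> carrier G. 0 < pos_prob n g \<longrightarrow> pos_prob n g * r g (\<beta> h) \<le> 1" and
      2: "0 < pos_prob n (pos h n)" "0 < r (pos h n) (\<beta> h)" and h: "h \<in> space incs"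
    have "pos_prob n (pos h n) * r (pos h n) (\<beta> h) \<le> 1"
      using 1 2 walk_closed[OF one_closed h, of n] by auto
    then show "0 \<le> info n h"
      using 2 by (simp add: info_def)
  qed
qed

text \<open>Both factors of the conditional probability cooperate: the densities multiply along the path by
  the cocycle identity, and the unconditional probabilities are supermultiplicative.\<close>

lemma info_subadditive: "AE h in incs. info n h \<le> (\<Sum>i<n. info 1 ((shift ^^ i) h))"
proof (induction n)
  case 0
  have "pos_prob 0 \<one> = 1"
    using iid.P.prob_space by (simp add: pos_prob_def)
  then show ?case
    using AE_\<beta>[OF r_one] by (auto simp: info_def)
next
  case (Suc n)
  note Suc r_pos_Suc[of n] r_pos_positive[of n] AE_shift[OF r_first_positive, of n]
    AE_pos_prob_pos[of n] AE_shift[OF AE_pos_prob_pos[of 1], of n] AE_space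
  then show ?case
  proof eventually_elim
    fix h assume ih: "info n h \<le> (\<Sum>i<n. info 1 ((shift ^^ i) h))"
      and r: "r (pos h (Suc n)) (\<beta> h) = r (pos h n) (\<beta> h) * r (h n) (\<beta> ((shift ^^ n) h))"
      and p: "0 < r (pos h n) (\<beta> h)" "0 < r ((shift ^^ n) h 0) (\<beta> ((shift ^^ n) h))"
      and w: "0 < pos_prob n (pos h n)" "0 < pos_prob 1 (pos ((shift ^^ n) h) 1)" and h: "h \<in> space incs"
    have c: "h n \<in> carrier G" "pos h n \<in> carrier G" "pos ((shift ^^ n) h) 1 = h n"
      using h by (auto simp: space_incs Pi_iff shift_funpow_apply intro: walk_closed)
    have "info (Suc n) h = - ln (pos_prob (Suc n) (pos h n \<otimes> h n) * (r (pos h n) (\<beta> h) * r (h n) (\<beta> ((shift ^^ n) h))))"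
      using r by (simp add: info_def)
    also have "\<dots> \<le> - ln (pos_prob n (pos h n) * pos_prob 1 (h n) * (r (pos h n) (\<beta> h) * r (h n) (\<beta> ((shift ^^ n) h))))"
      using pos_prob_Suc[OF c(2,1), of n] p w unfolding pos_prob_1[OF c(1), symmetric] c(3)
      by (intro le_imp_neg_le ln_mono mult_right_mono mult_pos_pos) (auto simp: shift_funpow_apply)
    also have "\<dots> = info n h + info 1 ((shift ^^ n) h)"
      using p w c(3) by (simp add: info_def ln_mult shift_funpow_apply del: walk.simps)
    finally show "info (Suc n) h \<le> (\<Sum>i<Suc n. info 1 ((shift ^^ i) h))"
      using ih by simp
  qed
qed

lemma nn_integral_neg_ln_pos_prob:
  "(\<integral>\<^sup>+ h. ennreal (- ln (pos_prob 1 (pos h 1))) \<partial>incs) = entropy_on G \<mu>"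
proof -
  have "(\<integral>\<^sup>+ h. ennreal (- ln (pos_prob 1 (pos h 1))) \<partial>incs)
      = (\<integral>\<^sup>+ g. ennreal (pos_prob 1 g) * ennreal (- ln (pos_prob 1 g)) \<partial>count_space (carrier G))"
    by (rule nn_integral_pos)
  also have "\<dots> = (\<integral>\<^sup>+ g. ennreal (- pmf \<mu> g * ln (pmf \<mu> g)) \<partial>count_space (carrier G))"
  proof (rule nn_integral_cong, simp only: space_count_space)
    fix g assume g: "g \<in> carrier G"
    show "ennreal (pos_prob 1 g) * ennreal (- ln (pos_prob 1 g)) = ennreal (- pmf \<mu> g * ln (pmf \<mu> g))"
      unfolding pos_prob_1[OF g] by (simp add: ennreal_mult'[symmetric])
  qed
  finally show ?thesis by (simp add: entropy_on_def)
qed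

text \<open>The density cancels its own inverse, except where it vanishes.\<close>

lemma nn_integral_inverse_r: "(\<integral>\<^sup>+ h. ennreal (1 / r (pos h n) (\<beta> h)) \<partial>incs) \<le> 1"
proof -
  have m: "(\<lambda>(g, y). ennreal (1 / r g y)) \<in> borel_measurable (count_space (carrier G) \<Otimes>\<^sub>M X)"
    by measurable
  have "(\<integral>\<^sup>+ h. ennreal (1 / r (pos h n) (\<beta> h)) \<partial>incs)
      = (\<integral>\<^sup>+ h. (\<integral>\<^sup>+ y. ennreal (r (pos h n) y) * ennreal (1 / r (pos h n) y) \<partial>X) \<partial>incs)"
    using nn_integral_pos_\<beta>_density[OF m, of n] by simp
  also have "\<dots> \<le> (\<integral>\<^sup>+ h. (\<integral>\<^sup>+ y. 1 \<partial>X) \<partial>incs)"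
    by (intro nn_integral_mono) (simp add: ennreal_mult[symmetric])
  also have "\<dots> = 1"
    by (simp add: emeasure_space_1 iid.P.emeasure_space_1)
  finally show ?thesis .
qed

text \<open>The bound \<open>- ln r \<le> 1 / r\<close> reduces integrability to finite entropy and to the
  integrability of \<open>1 / r\<close> along the path.\<close>

lemma integrable_info:
  assumes "entropy_on G \<mu> < \<infinity>"
  shows "integrable incs (info 1)"
proof (rule integrableI_nonneg)
  have "(\<integral>\<^sup>+ h. ennreal (info 1 h) \<partial>incs)
      \<le> (\<integral>\<^sup>+ h. ennreal (- ln (pos_prob 1 (pos h 1))) + ennreal (1 / r (pos h 1) (\<beta> h)) \<partial>incs)"
  proof (rule nn_integral_mono_AE)
    show "AE h in incs. ennreal (info 1 h) \<le> ennreal (- ln (pos_prob 1 (pos h 1))) + ennreal (1 / r (pos h 1) (\<beta> h))"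
      using AE_pos_prob_pos[of 1] r_pos_positive[of 1]
    proof eventually_elim
      fix h assume p: "0 < pos_prob 1 (pos h 1)" "0 < r (pos h 1) (\<beta> h)"
      have "- ln (r (pos h 1) (\<beta> h)) \<le> 1 / r (pos h 1) (\<beta> h)"
        using ln_add_one_self_le_self2[of "1 / r (pos h 1) (\<beta> h) - 1"] p by (simp add: ln_div)
      then have "info 1 h \<le> - ln (pos_prob 1 (pos h 1)) + 1 / r (pos h 1) (\<beta> h)"
        using p by (simp add: info_def ln_mult del: walk.simps)
      moreover have "0 \<le> - ln (pos_prob 1 (pos h 1))"
        using p by (simp add: pos_prob_le_1 del: walk.simps)
      ultimately show "ennreal (info 1 h) \<le> ennreal (- ln (pos_prob 1 (pos h 1))) + ennreal (1 / r (pos h 1) (\<beta> h))"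
        by (subst ennreal_plus[symmetric]) (auto simp: ennreal_leI simp del: walk.simps)
    qed
  qed
  also have "\<dots> = entropy_on G \<mu> + (\<integral>\<^sup>+ h. ennreal (1 / r (pos h 1) (\<beta> h)) \<partial>incs)"
    unfolding nn_integral_neg_ln_pos_prob[symmetric]
  proof (rule nn_integral_add)
    show "(\<lambda>h. ennreal (- ln (pos_prob 1 (pos h 1)))) \<in> borel_measurable incs"
      by (rule borel_measurable_discrete[OF measurable_pos])
  qed measurable
  also have "\<dots> < \<infinity>"
    using assms order.strict_trans1[OF nn_integral_inverse_r[of 1]] by (simp del: walk.simps)
  finally show "(\<integral>\<^sup>+ h. ennreal (info 1 h) \<partial>incs) < \<infinity>" .
qed (use info_nonneg[of 1] in auto)

lemma integrable_log_r:
  assumes "entropy_on G \<mu> < \<infinity>"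
  shows "integrable incs log_r"
proof -
  have "integrable incs (\<lambda>h. - ln (pos_prob 1 (pos h 1)))"
  proof (rule integrableI_nonneg)
    show "(\<lambda>h. - ln (pos_prob 1 (pos h 1))) \<in> borel_measurable incs"
      by (rule borel_measurable_discrete[OF measurable_pos])
    show "AE h in incs. 0 \<le> - ln (pos_prob 1 (pos h 1))"
      using AE_pos_prob_pos[of 1] by eventually_elim (simp add: pos_prob_le_1 del: walk.simps)
    show "(\<integral>\<^sup>+ h. ennreal (- ln (pos_prob 1 (pos h 1))) \<partial>incs) < \<infinity>"
      unfolding nn_integral_neg_ln_pos_prob by fact
  qed
  then have "integrable incs (\<lambda>h. - ln (pos_prob 1 (pos h 1)) - info 1 h)"
    using integrable_info[OF assms] by (rule Bochner_Integration.integrable_diff)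
  then show ?thesis
  proof (rule integrable_cong_AE_imp)
    show "AE h in incs. - ln (pos_prob 1 (pos h 1)) - info 1 h = log_r h"
      using AE_pos_prob_pos[of 1] r_first_positive AE_space
      by eventually_elim (auto simp: info_def log_r_def ln_mult space_incs Pi_iff)
  qed auto
qed

text \<open>A union bound for the conditional law of \<open>x\<^sub>n\<close> given \<open>\<beta> h = y\<close>: each point of the section of \<open>W\<close> over
  \<open>y\<close> whose conditional probability is at most \<open>c\<close> contributes at most \<open>c\<close>.\<close>

lemma unlikely_positions:
  assumes [measurable]: "W \<in> sets (count_space (carrier G) \<Otimes>\<^sub>M X)"
  shows "emeasure incs {h \<in> space incs. (pos h n, \<beta> h) \<in> W \<and> pos_prob n (pos h n) * r (pos h n) (\<beta> h) \<le> c}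
    \<le> ennreal c * (\<integral>\<^sup>+ y. emeasure (count_space (carrier G)) {g \<in> carrier G. (g, y) \<in> W} \<partial>X)"
proof -
  let ?C = "{p \<in> space (count_space (carrier G) \<Otimes>\<^sub>M X). pos_prob n (fst p) * r (fst p) (snd p) \<le> c}"
  have pos_prob [measurable]: "(\<lambda>p. pos_prob n (fst p)) \<in> borel_measurable (count_space (carrier G) \<Otimes>\<^sub>M X)"
    by (rule borel_measurable_discrete) measurable
  have [measurable]: "?C \<in> sets (count_space (carrier G) \<Otimes>\<^sub>M X)" by measurable
  have W: "W \<subseteq> carrier G \<times> space X"
    using sets.sets_into_space[OF assms] by (simp add: space_pair_measure)
  let ?f = "\<lambda>p. indicator (W \<inter> ?C) p :: ennreal"
  have f: "?f \<in> borel_measurable (count_space (carrier G) \<Otimes>\<^sub>M X)" by measurable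
  have slice: "(\<lambda>y. indicator W (g, y) :: ennreal) \<in> borel_measurable X" if "g \<in> carrier G" for g
    using measurable_compose[OF measurable_Pair1'[of g "count_space (carrier G)" X], of "indicator W" borel] that
    by simp
  have eq: "{h \<in> space incs. (pos h n, \<beta> h) \<in> W \<and> pos_prob n (pos h n) * r (pos h n) (\<beta> h) \<le> c}
      = {h \<in> space incs. (pos h n, \<beta> h) \<in> W \<inter> ?C}"
    using W by (auto simp: space_pair_measure)
  have "emeasure incs {h \<in> space incs. (pos h n, \<beta> h) \<in> W \<inter> ?C} = (\<integral>\<^sup>+ h. indicator {h \<in> space incs. (pos h n, \<beta> h) \<in> W \<inter> ?C} h \<partial>incs)"
    by (rule nn_integral_indicator[symmetric]) measurable
  also have "\<dots> = (\<integral>\<^sup>+ h. ?f (pos h n, \<beta> h) \<partial>incs)"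
    by (rule nn_integral_cong) (simp add: indicator_def)
  also have "\<dots> = (\<integral>\<^sup>+ g. ennreal (pos_prob n g) * (\<integral>\<^sup>+ y. ennreal (r g y) * ?f (g, y) \<partial>X) \<partial>count_space (carrier G))"
    unfolding nn_integral_pos_\<beta>_density[OF f]
    by (rule nn_integral_pos[of "\<lambda>g. \<integral>\<^sup>+ y. ennreal (r g y) * ?f (g, y) \<partial>X"])
  also have "\<dots> \<le> (\<integral>\<^sup>+ g. (\<integral>\<^sup>+ y. ennreal c * indicator W (g, y) \<partial>X) \<partial>count_space (carrier G))"
  proof (rule nn_integral_mono)
    fix g assume "g \<in> space (count_space (carrier G))"
    then have g: "g \<in> carrier G" by simp
    have "(\<lambda>y. ?f (g, y)) \<in> borel_measurable X"
      using measurable_compose[OF measurable_Pair1'[of g "count_space (carrier G)" X] f] g by simp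
    then have "ennreal (pos_prob n g) * (\<integral>\<^sup>+ y. ennreal (r g y) * ?f (g, y) \<partial>X)
        = (\<integral>\<^sup>+ y. ennreal (pos_prob n g * r g y) * ?f (g, y) \<partial>X)"
      by (subst nn_integral_cmult[symmetric]) (auto simp: ennreal_mult pos_prob_nonneg mult.assoc)
    also have "\<dots> \<le> (\<integral>\<^sup>+ y. ennreal c * indicator W (g, y) \<partial>X)"
      by (rule nn_integral_mono) (auto simp: indicator_def intro!: ennreal_leI)
    finally show "ennreal (pos_prob n g) * (\<integral>\<^sup>+ y. ennreal (r g y) * ?f (g, y) \<partial>X)
        \<le> (\<integral>\<^sup>+ y. ennreal c * indicator W (g, y) \<partial>X)" .
  qed
  also have "\<dots> = (\<integral>\<^sup>+ y. (\<integral>\<^sup>+ g. ennreal c * indicator W (g, y) \<partial>count_space (carrier G)) \<partial>X)"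
  proof -
    have "(\<integral>\<^sup>+ y. (\<integral>\<^sup>+ g. ennreal c * indicator W (g, y) \<partial>count_space (carrier G)) \<partial>X)
        = (\<integral>\<^sup>+ y. (\<integral>\<^sup>+ g. indicator (carrier G) g * (ennreal c * indicator W (g, y)) \<partial>count_space (carrier G)) \<partial>X)"
      by (intro nn_integral_cong) simp
    also have "\<dots> = (\<integral>\<^sup>+ g. (\<integral>\<^sup>+ y. indicator (carrier G) g * (ennreal c * indicator W (g, y)) \<partial>X) \<partial>count_space (carrier G))"
    proof (rule nn_integral_count_space_nn_integral[OF countable_carrier])
      fix g show "(\<lambda>y. indicator (carrier G) g * (ennreal c * indicator W (g, y))) \<in> borel_measurable X"
        using slice[of g] by (cases "g \<in> carrier G") auto
    qed
    also have "\<dots> = (\<integral>\<^sup>+ g. (\<integral>\<^sup>+ y. ennreal c * indicator W (g, y) \<partial>X) \<partial>count_space (carrier G))"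
      by (intro nn_integral_cong) simp
    finally show ?thesis by simp
  qed
  also have "\<dots> = (\<integral>\<^sup>+ y. ennreal c * emeasure (count_space (carrier G)) {g \<in> carrier G. (g, y) \<in> W} \<partial>X)"
  proof (rule nn_integral_cong)
    fix y
    have "(\<integral>\<^sup>+ g. ennreal c * indicator W (g, y) \<partial>count_space (carrier G))
        = (\<integral>\<^sup>+ g. ennreal c * indicator {g \<in> carrier G. (g, y) \<in> W} g \<partial>count_space (carrier G))"
      by (rule nn_integral_cong) (simp add: indicator_def)
    then show "(\<integral>\<^sup>+ g. ennreal c * indicator W (g, y) \<partial>count_space (carrier G))
        = ennreal c * emeasure (count_space (carrier G)) {g \<in> carrier G. (g, y) \<in> W}"
      by (simp add: nn_integral_cmult_indicator)
  qed
  also have "\<dots> = ennreal c * (\<integral>\<^sup>+ y. emeasure (count_space (carrier G)) {g \<in> carrier G. (g, y) \<in> W} \<partial>X)"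
  proof (rule nn_integral_cmult)
    have "(\<lambda>y. \<integral>\<^sup>+ g. indicator W (g, y) \<partial>count_space (carrier G)) \<in> borel_measurable X"
      using sigma_finite_measure.borel_measurable_nn_integral[OF sigma_finite_measure_count_space_countable[OF countable_carrier], of "\<lambda>y g. indicator W (g, y)" X]
      by (simp add: case_prod_beta)
    moreover have "(\<integral>\<^sup>+ g. indicator W (g, y) \<partial>count_space (carrier G)) = emeasure (count_space (carrier G)) {g \<in> carrier G. (g, y) \<in> W}" for y
    proof -
      have "(\<integral>\<^sup>+ g. indicator W (g, y) \<partial>count_space (carrier G))
          = (\<integral>\<^sup>+ g. indicator {g \<in> carrier G. (g, y) \<in> W} g \<partial>count_space (carrier G))"
        by (rule nn_integral_cong) (simp add: indicator_def)
      then show ?thesis by simp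
    qed
    ultimately show "(\<lambda>y. emeasure (count_space (carrier G)) {g \<in> carrier G. (g, y) \<in> W}) \<in> borel_measurable X"
      by simp
  qed
  finally show ?thesis unfolding eq .
qed

end

section \<open>The Poisson boundary and its quotients as stationary systems\<close>

lemma standard_borel_separated:
  assumes "standard_borel M"
  obtains f :: "'x \<Rightarrow> real" and h :: "real \<Rightarrow> 'x" and A where
    "f \<in> borel_measurable M" "A \<in> sets borel" "h \<in> restrict_space borel A \<rightarrow>\<^sub>M M"
    "\<And>p. p \<in> space M \<Longrightarrow> f p \<in> A" "\<And>p. p \<in> space M \<Longrightarrow> h (f p) = p"
proof -
  obtain A :: "real set" and f h where A: "A \<in> sets borel" and f: "f \<in> M \<rightarrow>\<^sub>M restrict_space borel A"
    and h: "h \<in> restrict_space borel A \<rightarrow>\<^sub>M M" and hf: "\<forall>p \<in> space M. h (f p) = p"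
    using assms unfolding standard_borel_def by blast
  show thesis
  proof (rule that[OF _ A h])
    show "f \<in> borel_measurable M" using f by (simp add: measurable_restrict_space2_iff)
    show "f p \<in> A" if "p \<in> space M" for p
      using measurable_space[OF f that] by (simp add: space_restrict_space)
    show "h (f p) = p" if "p \<in> space M" for p using hf that by simp
  qed
qed

context random_walk
begin

lemma measurable_walk_path:
  "(\<lambda>(y, h). walk G y h) \<in> count_space (carrier G) \<Otimes>\<^sub>M incs \<rightarrow>\<^sub>M path_space G"
  unfolding path_space_def
proof (rule measurable_PiM_single')
  fix n
  show "(\<lambda>p. (case p of (y, h) \<Rightarrow> walk G y h) n) \<in> count_space (carrier G) \<Otimes>\<^sub>M incs \<rightarrow>\<^sub>M count_space (carrier G)"
    unfolding case_prod_beta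
    by (rule measurable_walk) auto
next
  show "(\<lambda>p n. (case p of (y, h) \<Rightarrow> walk G y h) n) \<in> space (count_space (carrier G) \<Otimes>\<^sub>M incs) \<rightarrow> (\<Pi>\<^sub>E i\<in>UNIV. space (count_space (carrier G)))"
    by (auto simp: space_pair_measure intro: walk_closed)
qed

lemma measurable_walk_from: "y \<in> carrier G \<Longrightarrow> walk G y \<in> incs \<rightarrow>\<^sub>M path_space G"
  using measurable_compose[OF measurable_Pair1' measurable_walk_path, of y] by simp

lemma walk_measure_eq: "walk_measure G \<mu> = distr incs (path_space G) pos"
  unfolding walk_measure_def markov_measure_def inc_def[symmetric]
proof (rule measure_eqI)
  let ?R = "return (count_space (carrier G)) \<one>"
  fix A assume "A \<in> sets (distr (?R \<Otimes>\<^sub>M incs) (path_space G) (\<lambda>(y, h). walk G y h))"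
  then have A [measurable]: "A \<in> sets (path_space G)" by simp
  have R: "sets (?R \<Otimes>\<^sub>M incs) = sets (count_space (carrier G) \<Otimes>\<^sub>M incs)"
    by (intro sets_pair_measure_cong) auto
  have m: "(\<lambda>(y, h). walk G y h) \<in> ?R \<Otimes>\<^sub>M incs \<rightarrow>\<^sub>M path_space G"
    using measurable_walk_path by (simp add: measurable_cong_sets[OF R refl])
  have mi: "(\<lambda>p. indicator A (case p of (y, h) \<Rightarrow> walk G y h) :: ennreal) \<in> borel_measurable (?R \<Otimes>\<^sub>M incs)"
    using m by measurable
  have "emeasure (distr (?R \<Otimes>\<^sub>M incs) (path_space G) (\<lambda>(y, h). walk G y h)) A
      = (\<integral>\<^sup>+ p. indicator A (case p of (y, h) \<Rightarrow> walk G y h) \<partial>(?R \<Otimes>\<^sub>M incs))"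
    by (subst nn_integral_distr[OF m, symmetric]) auto
  also have "\<dots> = (\<integral>\<^sup>+ y. (\<integral>\<^sup>+ h. indicator A (walk G y h) \<partial>incs) \<partial>?R)"
    by (subst iid.P.nn_integral_fst[OF mi, symmetric]) simp
  also have "\<dots> = (\<integral>\<^sup>+ h. indicator A (pos h) \<partial>incs)"
    by (rule nn_integral_return) auto
  also have "\<dots> = emeasure (distr incs (path_space G) pos) A"
    by (subst nn_integral_distr[OF measurable_walk_from, symmetric]) auto
  finally show "emeasure (distr (?R \<Otimes>\<^sub>M incs) (path_space G) (\<lambda>(y, h). walk G y h)) A
      = emeasure (distr incs (path_space G) pos) A" .
qed simp

text \<open>The starting point is charged by the counting measure, so an almost sure property of the walk with
  this infinite initial distribution holds almost surely from every starting point at once.\<close>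

lemma AE_walk_measure_counting:
  assumes "AE x in walk_measure_counting G \<mu>. P x"
  shows "AE h in incs. \<forall>y \<in> carrier G. P (walk G y h)"
proof -
  have 1: "AE p in count_space (carrier G) \<Otimes>\<^sub>M incs. P (case p of (y, h) \<Rightarrow> walk G y h)"
    using assms unfolding walk_measure_counting_def markov_measure_def inc_def[symmetric]
    by (rule AE_distrD[OF measurable_walk_path])
  interpret pair_sigma_finite "count_space (carrier G)" incs
    by (intro pair_sigma_finite.intro sigma_finite_measure_count_space_countable countable_carrier
      iid.P.sigma_finite_measure_axioms)
  from 1 have "AE y in count_space (carrier G). AE h in incs. P (walk G y h)"
    using AE_pair[of "\<lambda>p. P (case p of (y, h) \<Rightarrow> walk G y h)"] by simp
  then show ?thesis
    by (subst AE_ball_countable) (auto simp: AE_count_space countable_carrier)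
qed

lemma space_path: "space (path_space G) = UNIV \<rightarrow> carrier G"
  by (auto simp: path_space_def space_PiM PiE_def)

text \<open>Each measurable set of the boundary corresponds to a shift-invariant set of paths, which
  cannot tell a path from its shift; countably many such sets separate the points of the boundary.\<close>

lemma bnd_shift:
  assumes "poisson_boundary G \<mu> \<Gamma> act bnd"
  shows "AE h in incs. bnd (shift (pos h)) = bnd (pos h)"
proof -
  have bnd: "bnd \<in> path_space G \<rightarrow>\<^sub>M \<Gamma>"
    and inv: "\<And>E. E \<in> sets \<Gamma> \<Longrightarrow> \<exists>A \<in> shift_invariant_sets G.
        AE x in walk_measure_counting G \<mu>. x \<in> A \<longleftrightarrow> bnd x \<in> E"
    and sb: "standard_borel \<Gamma>"
    using assms unfolding poisson_boundary_def by blast+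
  obtain f :: "_ \<Rightarrow> real" and k and A where f [measurable]: "f \<in> borel_measurable \<Gamma>"
    and k: "\<And>p. p \<in> space \<Gamma> \<Longrightarrow> k (f p) = p"
    by (rule standard_borel_separated[OF sb]) blast
  have E: "AE h in incs. bnd (shift (pos h)) \<in> E \<longleftrightarrow> bnd (pos h) \<in> E" if E: "E \<in> sets \<Gamma>" for E
  proof -
    obtain A where A: "A \<in> shift_invariant_sets G"
      and AE: "AE x in walk_measure_counting G \<mu>. x \<in> A \<longleftrightarrow> bnd x \<in> E"
      using inv[OF E] by blast
    note 1 = AE_walk_measure_counting[OF AE]
    show ?thesis
      using 1 AE_shift[OF 1, of 1] AE_space
    proof eventually_elim
      fix h assume *: "\<forall>y \<in> carrier G. walk G y h \<in> A \<longleftrightarrow> bnd (walk G y h) \<in> E"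
        and "\<forall>y \<in> carrier G. walk G y ((shift ^^ 1) h) \<in> A \<longleftrightarrow> bnd (walk G y ((shift ^^ 1) h)) \<in> E"
        and h: "h \<in> space incs"
      moreover have "h 0 \<in> carrier G" using h by (auto simp: space_incs)
      moreover have "walk G (h 0) (shift h) = shift (pos h)"
        using \<open>h 0 \<in> carrier G\<close> shift_walk[OF one_closed h] by (simp add: shift_def[of "pos h"] fun_eq_iff)
      ultimately have 2: "shift (pos h) \<in> A \<longleftrightarrow> bnd (shift (pos h)) \<in> E" by auto
      have "pos h \<in> space (path_space G)"
        using h by (auto simp: space_path intro: walk_closed)
      then have "shift (pos h) \<in> A \<longleftrightarrow> pos h \<in> A"
        using A unfolding shift_invariant_sets_def by blast
      then show "bnd (shift (pos h)) \<in> E \<longleftrightarrow> bnd (pos h) \<in> E"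
        using * 2 by blast
    qed
  qed
  have "AE h in incs. \<forall>q::rat. bnd (shift (pos h)) \<in> {p \<in> space \<Gamma>. f p \<le> of_rat q} \<longleftrightarrow> bnd (pos h) \<in> {p \<in> space \<Gamma>. f p \<le> of_rat q}"
    unfolding AE_all_countable by (intro allI E) measurable
  then show ?thesis
    using AE_space
  proof eventually_elim
    fix h assume q: "\<forall>q::rat. bnd (shift (pos h)) \<in> {p \<in> space \<Gamma>. f p \<le> of_rat q} \<longleftrightarrow> bnd (pos h) \<in> {p \<in> space \<Gamma>. f p \<le> of_rat q}"
      and h: "h \<in> space incs"
    have "pos h \<in> space (path_space G)" "shift (pos h) \<in> space (path_space G)"
      using h by (auto simp: space_path shift_def walk_closed[OF one_closed h] simp del: walk.simps)
    then have s: "bnd (pos h) \<in> space \<Gamma>" "bnd (shift (pos h)) \<in> space \<Gamma>"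
      by (auto intro: measurable_space[OF bnd])
    then have *: "f (bnd (shift (pos h))) \<le> of_rat q \<longleftrightarrow> f (bnd (pos h)) \<le> of_rat q" for q
      using q by simp
    have "f (bnd (shift (pos h))) = f (bnd (pos h))"
    proof (rule ccontr)
      assume "f (bnd (shift (pos h))) \<noteq> f (bnd (pos h))"
      then consider "f (bnd (shift (pos h))) < f (bnd (pos h))" | "f (bnd (pos h)) < f (bnd (shift (pos h)))"
        by linarith
      then show False
      proof cases
        case 1
        then obtain q where "f (bnd (shift (pos h))) < of_rat q" "of_rat q < f (bnd (pos h))"
          using of_rat_dense by blast
        then show False using *[of q] by simp
      next
        case 2
        then obtain q where "f (bnd (pos h)) < of_rat q" "of_rat q < f (bnd (shift (pos h)))"
          using of_rat_dense by blast
        then show False using *[of q] by simp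
      qed
    qed
    then show "bnd (shift (pos h)) = bnd (pos h)"
      using k[OF s(1)] k[OF s(2)] by simp
  qed
qed

lemma poisson_boundary_system:
  assumes "poisson_boundary G \<mu> \<Gamma> act bnd"
  shows "boundary_system G \<mu> \<Gamma> act (\<lambda>h. bnd (pos h))"
proof -
  have bnd: "bnd \<in> path_space G \<rightarrow>\<^sub>M \<Gamma>"
    and "group_action G (space \<Gamma>) act" and am: "\<forall>g \<in> carrier G. act g \<in> \<Gamma> \<rightarrow>\<^sub>M \<Gamma>"
    and eq: "\<And>g. g \<in> carrier G \<Longrightarrow> AE x in walk_measure_counting G \<mu>. bnd (\<lambda>n. g \<otimes> x n) = act g (bnd x)"
    and distr: "distr (walk_measure G \<mu>) \<Gamma> bnd = \<Gamma>"
    using assms unfolding poisson_boundary_def by blast+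
  interpret group_action G "space \<Gamma>" act by fact
  have m: "(\<lambda>h. bnd (pos h)) \<in> incs \<rightarrow>\<^sub>M \<Gamma>"
    by (rule measurable_compose[OF measurable_walk_from bnd]) simp
  have d: "distr incs \<Gamma> (\<lambda>h. bnd (pos h)) = \<Gamma>"
    using distr bnd measurable_walk_from[OF one_closed]
    by (simp add: walk_measure_eq distr_distr comp_def)
  have "prob_space (distr incs \<Gamma> (\<lambda>h. bnd (pos h)))"
    by (rule iid.P.prob_space_distr[OF m])
  then have p: "prob_space \<Gamma>" by (simp add: d)
  have "AE h in incs. \<forall>g \<in> carrier G. \<forall>y \<in> carrier G. bnd (\<lambda>n. g \<otimes> walk G y h n) = act g (bnd (walk G y h))"
    by (intro AE_ball_countable[THEN iffD2] countable_carrier ballI AE_walk_measure_counting eq)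
  then have "AE h in incs. \<forall>g \<in> carrier G. \<forall>y \<in> carrier G.
      bnd (\<lambda>n. g \<otimes> walk G y ((shift ^^ 1) h) n) = act g (bnd (walk G y ((shift ^^ 1) h)))"
    by (rule AE_shift)
  then have e: "AE h in incs. bnd (pos h) = act (h 0) (bnd (pos (shift h)))"
    using bnd_shift[OF assms] AE_space
  proof eventually_elim
    fix h assume *: "\<forall>g \<in> carrier G. \<forall>y \<in> carrier G.
        bnd (\<lambda>n. g \<otimes> walk G y ((shift ^^ 1) h) n) = act g (bnd (walk G y ((shift ^^ 1) h)))"
      and b: "bnd (shift (pos h)) = bnd (pos h)" and h: "h \<in> space incs"
    have h0: "h 0 \<in> carrier G" using h by (auto simp: space_incs)
    have "shift (pos h) = (\<lambda>n. h 0 \<otimes> pos (shift h) n)"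
      using pos_Suc_left[OF h] by (simp add: shift_def[of "pos h"] del: walk.simps)
    then show "bnd (pos h) = act (h 0) (bnd (pos (shift h)))"
      using * h0 b by simp
  qed
  have one: "act \<one> x = x" if "x \<in> space \<Gamma>" for x
    using that fun_cong[OF id_eq_one, of x] by simp
  interpret prob_space \<Gamma> by (rule p)
  show ?thesis
    apply unfold_locales
    using am countable_carrier apply auto[2]
    using one apply simp
    apply (rule composition_rule; assumption)
    by (rule m d e)+
qed

end

text \<open>Points of the quotient are blocks, and its measurable sets are the sets of blocks with measurable
  union, so that \<open>G\<close> acts on it by images.\<close>

locale quotient_system = boundary_system G \<mu> X act \<beta>
  for G :: "('a, 'b) monoid_scheme" (structure) and \<mu> :: "'a pmf"
    and X :: "'x measure" and act :: "'a \<Rightarrow> 'x \<Rightarrow> 'x" and \<beta> +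
  fixes \<xi> :: "'x set set"
  assumes partition: "measurable_partition X \<xi>"
    and invariant: "invariant_partition G act \<xi>"
begin

abbreviation \<pi> :: "'x \<Rightarrow> 'x set" where
  "\<pi> \<equiv> block_of \<xi>"

abbreviation Q :: "'x set measure" where
  "Q \<equiv> quotient_measure X \<xi>"

lemma partition_on_\<xi>: "partition_on (space X) \<xi>"
  using partition by (simp add: measurable_partition_def)

lemma blocks_disjoint: "C \<in> \<xi> \<Longrightarrow> D \<in> \<xi> \<Longrightarrow> p \<in> C \<Longrightarrow> p \<in> D \<Longrightarrow> C = D"
  using partition_on_\<xi> by (auto simp: partition_on_def disjoint_def)

lemma block_subset_space: "C \<in> \<xi> \<Longrightarrow> C \<subseteq> space X"
  using partition_on_\<xi> by (auto simp: partition_on_def)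

lemma block_nonempty: "C \<in> \<xi> \<Longrightarrow> C \<noteq> {}"
  using partition_on_\<xi> by (auto simp: partition_on_def)

lemma block_of_unique: "C \<in> \<xi> \<Longrightarrow> p \<in> C \<Longrightarrow> \<pi> p = C"
  unfolding block_of_def by (rule the_equality) (blast, elim conjE, rule blocks_disjoint)

lemma block_of_mem: "p \<in> space X \<Longrightarrow> p \<in> \<pi> p" "p \<in> space X \<Longrightarrow> \<pi> p \<in> \<xi>"
proof -
  assume "p \<in> space X"
  then obtain C where "C \<in> \<xi>" "p \<in> C"
    using partition_on_\<xi> by (auto simp: partition_on_def)
  then show "p \<in> \<pi> p" "\<pi> p \<in> \<xi>" by (simp_all add: block_of_unique)
qed

lemma vimage_block_of: "\<A> \<subseteq> \<xi> \<Longrightarrow> \<pi> -` \<A> \<inter> space X = \<Union>\<A>"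
  using block_of_mem block_of_unique block_subset_space by (auto, blast+)

lemma sigma_algebra_quotient: "sigma_algebra \<xi> {\<A>. \<A> \<subseteq> \<xi> \<and> \<Union>\<A> \<in> sets X}"
  unfolding sigma_algebra_iff2
proof (intro conjI ballI allI impI)
  fix \<A> assume "\<A> \<in> {\<A>. \<A> \<subseteq> \<xi> \<and> \<Union>\<A> \<in> sets X}"
  then have A: "\<A> \<subseteq> \<xi>" "\<Union>\<A> \<in> sets X" by auto
  have "\<Union>(\<xi> - \<A>) = space X - \<Union>\<A>"
    using A partition_on_\<xi> blocks_disjoint unfolding partition_on_def by blast
  then show "\<xi> - \<A> \<in> {\<A>. \<A> \<subseteq> \<xi> \<and> \<Union>\<A> \<in> sets X}"
    using A by auto
next
  fix \<F> :: "nat \<Rightarrow> 'x set set" assume "range \<F> \<subseteq> {\<A>. \<A> \<subseteq> \<xi> \<and> \<Union>\<A> \<in> sets X}"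
  then have F: "\<And>i. \<F> i \<subseteq> \<xi>" "\<And>i. \<Union>(\<F> i) \<in> sets X" by auto
  have "\<Union>(\<Union>i. \<F> i) = (\<Union>i. \<Union>(\<F> i))" by auto
  also have "\<dots> \<in> sets X" using F by auto
  finally show "(\<Union>i. \<F> i) \<in> {\<A>. \<A> \<subseteq> \<xi> \<and> \<Union>\<A> \<in> sets X}"
    using F by auto
qed auto

lemma sets_Q: "sets Q = {\<A>. \<A> \<subseteq> \<xi> \<and> \<Union>\<A> \<in> sets X}" and space_Q: "space Q = \<xi>"
proof -
  interpret A: sigma_algebra \<xi> "{\<A>. \<A> \<subseteq> \<xi> \<and> \<Union>\<A> \<in> sets X}"
    by (rule sigma_algebra_quotient)
  show "sets Q = {\<A>. \<A> \<subseteq> \<xi> \<and> \<Union>\<A> \<in> sets X}" "space Q = \<xi>"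
    by (simp_all add: quotient_measure_def space_measure_of_conv)
qed

lemma measurable_block_of [measurable]: "\<pi> \<in> X \<rightarrow>\<^sub>M Q"
proof (rule measurableI)
  show "\<pi> p \<in> space Q" if "p \<in> space X" for p
    using that by (simp add: space_Q block_of_mem)
  show "\<pi> -` \<A> \<inter> space X \<in> sets X" if "\<A> \<in> sets Q" for \<A>
    using that by (auto simp: sets_Q vimage_block_of)
qed

lemma distr_block_of: "distr X Q \<pi> = Q"
proof -
  have "sets Q = sets (sigma \<xi> {\<A>. \<A> \<subseteq> \<xi> \<and> \<Union>\<A> \<in> sets X})"
    by (simp add: quotient_measure_def)
  then show ?thesis
    unfolding quotient_measure_def by (intro distr_cong) auto
qed

lemma act_block: "g \<in> carrier G \<Longrightarrow> C \<in> \<xi> \<Longrightarrow> act g ` C \<in> \<xi>"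
  using invariant by (simp add: invariant_partition_def)

lemma block_of_act: "g \<in> carrier G \<Longrightarrow> p \<in> space X \<Longrightarrow> \<pi> (act g p) = act g ` \<pi> p"
  by (intro block_of_unique act_block) (auto simp: block_of_mem)

lemma measurable_act_block: "g \<in> carrier G \<Longrightarrow> (\<lambda>C. act g ` C) \<in> Q \<rightarrow>\<^sub>M Q"
proof (rule measurableI)
  assume g: "g \<in> carrier G"
  show "act g ` C \<in> space Q" if "C \<in> space Q" for C
    using that g by (simp add: space_Q act_block)
  fix \<A> assume "\<A> \<in> sets Q"
  then have A: "\<A> \<subseteq> \<xi>" "\<Union>\<A> \<in> sets X" by (auto simp: sets_Q)
  have "\<Union>((\<lambda>C. act g ` C) -` \<A> \<inter> space Q) = act g -` (\<Union>\<A>) \<inter> space X"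
  proof (intro Set.set_eqI iffI)
    fix p assume "p \<in> \<Union>((\<lambda>C. act g ` C) -` \<A> \<inter> space Q)"
    then obtain C where "C \<in> \<xi>" "p \<in> C" "act g ` C \<in> \<A>" by (auto simp: space_Q)
    then show "p \<in> act g -` (\<Union>\<A>) \<inter> space X" using block_subset_space by auto
  next
    fix p assume p: "p \<in> act g -` (\<Union>\<A>) \<inter> space X"
    then obtain D where D: "D \<in> \<A>" "act g p \<in> D" by auto
    then have "\<pi> (act g p) = D" using A by (intro block_of_unique) auto
    then have "act g ` \<pi> p = D" using p g by (simp add: block_of_act)
    then show "p \<in> \<Union>((\<lambda>C. act g ` C) -` \<A> \<inter> space Q)"
      using p D block_of_mem by (auto simp: space_Q)
  qed
  also have "\<dots> \<in> sets X"
    using act_measurable[OF g] A(2) by (rule measurable_sets)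
  finally show "(\<lambda>C. act g ` C) -` \<A> \<inter> space Q \<in> sets Q"
    by (auto simp: sets_Q space_Q)
qed

lemma quotient: "boundary_system G \<mu> Q (\<lambda>g C. act g ` C) (\<lambda>h. \<pi> (\<beta> h))"
proof -
  have "prob_space (distr X Q \<pi>)" by (rule prob_space_distr) measurable
  then have p: "prob_space Q" by (simp add: distr_block_of)
  have m: "(\<lambda>h. \<pi> (\<beta> h)) \<in> incs \<rightarrow>\<^sub>M Q" by measurable
  have "distr incs Q (\<lambda>h. \<pi> (\<beta> h)) = distr (distr incs X \<beta>) Q \<pi>"
    by (subst distr_distr) (auto simp: comp_def)
  also have "\<dots> = Q" by (simp add: distr_\<beta> distr_block_of)
  finally have d: "distr incs Q (\<lambda>h. \<pi> (\<beta> h)) = Q" .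
  have e: "AE h in incs. \<pi> (\<beta> h) = act (h 0) ` \<pi> (\<beta> (shift h))"
    using equivariant AE_space
  proof eventually_elim
    fix h assume "\<beta> h = act (h 0) (\<beta> (shift h))" and h: "h \<in> space incs"
    moreover have "\<beta> (shift h) \<in> space X" "h 0 \<in> carrier G"
      using h shift_in_space[OF h] \<beta>_measurable[THEN measurable_space] by (auto simp: space_incs)
    ultimately show "\<pi> (\<beta> h) = act (h 0) ` \<pi> (\<beta> (shift h))"
      using block_of_act by metis
  qed
  interpret Q: prob_space Q by (rule p)
  show ?thesis
  proof unfold_locales
    fix C assume C: "C \<in> space Q"
    then have s: "C \<subseteq> space X" by (simp add: space_Q block_subset_space)
    then show "act \<one> ` C = C" using act_one by (auto simp: image_iff subset_iff)
    fix g g' assume "g \<in> carrier G" "g' \<in> carrier G"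
    then have "\<And>x. x \<in> C \<Longrightarrow> act (g \<otimes> g') x = act g (act g' x)"
      using s act_mult by auto
    then show "act (g \<otimes> g') ` C = act g ` act g' ` C"
      by (auto simp: image_image)
  qed (use measurable_act_block countable_carrier m d e in auto)
qed

end

section \<open>Mean information\<close>

context boundary_system
begin

lemma integrable_shift:
  fixes f :: "(nat \<Rightarrow> 'a) \<Rightarrow> real"
  assumes "integrable incs f"
  shows "integrable incs (\<lambda>h. f ((shift ^^ n) h))"
    and "(\<integral>h. f ((shift ^^ n) h) \<partial>incs) = (\<integral>h. f h \<partial>incs)"
proof -
  have f [measurable]: "f \<in> borel_measurable incs" using assms by auto
  show "integrable incs (\<lambda>h. f ((shift ^^ n) h))"
    using assms integrable_distr_eq[OF measurable_shift_funpow, of f n] by (simp add: distr_shift)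
  show "(\<integral>h. f ((shift ^^ n) h) \<partial>incs) = (\<integral>h. f h \<partial>incs)"
    using integral_distr[OF measurable_shift_funpow, of f n] by (simp add: distr_shift)
qed

lemma excess_tendsto_0:
  fixes f :: "(nat \<Rightarrow> 'a) \<Rightarrow> real"
  assumes "integrable incs f"
  shows "(\<lambda>M. \<integral>h. max 0 (f h - real M) \<partial>incs) \<longlonglongrightarrow> 0"
proof -
  have [measurable]: "f \<in> borel_measurable incs" using assms by auto
  have "(\<lambda>M. \<integral>h. max 0 (f h - real M) \<partial>incs) \<longlonglongrightarrow> (\<integral>h. 0 \<partial>incs)"
  proof (rule integral_dominated_convergence)
    show "integrable incs (\<lambda>h. \<bar>f h\<bar>)" using assms by simp
    show "AE h in incs. (\<lambda>M. max 0 (f h - real M)) \<longlonglongrightarrow> 0"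
    proof (rule AE_I2)
      fix h
      obtain N :: nat where N: "f h \<le> real N" using real_arch_simple by blast
      have "\<forall>\<^sub>F M in sequentially. max 0 (f h - real M) = 0"
        using eventually_ge_at_top[of N] by eventually_elim (use N in simp)
      then show "(\<lambda>M. max 0 (f h - real M)) \<longlonglongrightarrow> 0" by (rule tendsto_eventually)
    qed
  qed auto
  then show ?thesis by simp
qed

text \<open>Convergence to zero in probability of \<open>info n / n\<close> upgrades to convergence of the means:
  on the exceptional event \<open>info n\<close> is at most a sum of \<open>n\<close> identically distributed integrable
  variables.\<close>

lemma mean_info_small:
  assumes entropy: "entropy_on G \<mu> < \<infinity>"
    and prob: "\<And>\<epsilon> \<eta>. 0 < \<epsilon> \<Longrightarrow> 0 < \<eta> \<Longrightarrow>
      \<forall>\<^sub>F n in sequentially. measure incs {h \<in> space incs. \<epsilon> * real n < info n h} \<le> \<eta>"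
    and \<epsilon>: "0 < \<epsilon>"
  obtains n where "1 \<le> n" "integrable incs (info n)" "(\<integral>h. info n h \<partial>incs) \<le> \<epsilon> * real n"
proof -
  note int1 = integrable_info[OF entropy]
  have "\<forall>\<^sub>F M in sequentially. (\<integral>h. max 0 (info 1 h - real M) \<partial>incs) < \<epsilon> / 3"
    using excess_tendsto_0[OF int1] \<epsilon> by (intro order_tendstoD) auto
  then obtain M where M: "(\<integral>h. max 0 (info 1 h - real M) \<partial>incs) < \<epsilon> / 3"
    by (auto simp: eventually_sequentially)
  \<comment> \<open>The three parts of \<open>\<epsilon>\<close> pay for the good event, for the truncated summands on the bad event, and
    for the excess of the summands over the level \<open>M\<close>.\<close>
  define \<eta> where "\<eta> = \<epsilon> / 3 / (real M + 1)"
  have \<eta>: "0 < \<eta>" and M\<eta>: "real M * \<eta> \<le> \<epsilon> / 3"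
    using \<epsilon> by (auto simp: \<eta>_def field_simps)
  have "\<forall>\<^sub>F n in sequentially. 1 \<le> n \<and> measure incs {h \<in> space incs. \<epsilon> / 3 * real n < info n h} \<le> \<eta>"
    using prob[of "\<epsilon> / 3" \<eta>] \<epsilon> \<eta> by (intro eventually_conj eventually_ge_at_top) auto
  then obtain n where n: "1 \<le> n" and bad: "measure incs {h \<in> space incs. \<epsilon> / 3 * real n < info n h} \<le> \<eta>"
    by (auto simp: eventually_sequentially)
  define B where "B = {h \<in> space incs. \<epsilon> / 3 * real n < info n h}"
  have B [measurable]: "B \<in> sets incs" unfolding B_def by measurable
  define U where "U h = \<epsilon> / 3 * real n + (\<Sum>i<n. real M * indicator B h + max 0 (info 1 ((shift ^^ i) h) - real M))" for h
  have int_ex: "integrable incs (\<lambda>h. max 0 (info 1 h - real M))"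
    by (rule Bochner_Integration.integrable_bound[OF int1]) auto
  have intU: "integrable incs U"
    unfolding U_def
    by (intro Bochner_Integration.integrable_add Bochner_Integration.integrable_sum integrable_mult_right integrable_shift(1)[OF int_ex])
      (auto intro!: integrable_real_indicator simp: less_top[symmetric])
  have le: "AE h in incs. info n h \<le> U h"
    using info_subadditive[of n] AE_space
  proof eventually_elim
    fix h assume sub: "info n h \<le> (\<Sum>i<n. info 1 ((shift ^^ i) h))" and h: "h \<in> space incs"
    show "info n h \<le> U h"
    proof (cases "h \<in> B")
      case True
      have "info n h \<le> (\<Sum>i<n. real M * indicator B h + max 0 (info 1 ((shift ^^ i) h) - real M))"
        using True by (intro order_trans[OF sub] sum_mono) auto
      moreover have "0 \<le> \<epsilon> / 3 * real n" using \<epsilon> by simp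
      ultimately show ?thesis unfolding U_def by linarith
    next
      case False
      then have "info n h \<le> \<epsilon> / 3 * real n" using h by (auto simp: B_def)
      moreover have "0 \<le> (\<Sum>i<n. real M * indicator B h + max 0 (info 1 ((shift ^^ i) h) - real M))"
        by (intro sum_nonneg) auto
      ultimately show ?thesis by (simp add: U_def)
    qed
  qed
  have int: "integrable incs (info n)"
  proof (rule Bochner_Integration.integrable_bound[OF intU])
    show "AE h in incs. norm (info n h) \<le> norm (U h)"
      using le info_nonneg[of n] by eventually_elim auto
  qed measurable
  have "(\<integral>h. info n h \<partial>incs) \<le> (\<integral>h. U h \<partial>incs)"
    using int intU le by (rule integral_mono_AE)
  also have "\<dots> = \<epsilon> / 3 * real n + real n * (real M * measure incs B + (\<integral>h. max 0 (info 1 h - real M) \<partial>incs))"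
  proof -
    have "(\<integral>h. real M * indicator B h + max 0 (info 1 ((shift ^^ i) h) - real M) \<partial>incs)
        = real M * measure incs B + (\<integral>h. max 0 (info 1 h - real M) \<partial>incs)" for i
      using integrable_shift[OF int_ex, of i]
      by (subst Bochner_Integration.integral_add) (auto intro!: integrable_real_indicator simp: less_top[symmetric])
    moreover have "integrable incs (\<lambda>h. real M * indicator B h + max 0 (info 1 ((shift ^^ i) h) - real M))" for i
      by (intro Bochner_Integration.integrable_add integrable_mult_right integrable_shift(1)[OF int_ex])
        (auto intro!: integrable_real_indicator simp: less_top[symmetric])
    ultimately show ?thesis
      unfolding U_def
      by (subst Bochner_Integration.integral_add)
        (auto simp: Bochner_Integration.integral_sum iid.P.prob_space intro!: Bochner_Integration.integrable_sum)
  qed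
  also have "\<dots> \<le> \<epsilon> / 3 * real n + real n * (real M * \<eta> + \<epsilon> / 3)"
    using M bad by (intro add_left_mono mult_left_mono add_mono) (auto simp: B_def)
  also have "\<dots> \<le> \<epsilon> / 3 * real n + real n * (\<epsilon> / 3 + \<epsilon> / 3)"
    using M\<eta> by (intro add_left_mono mult_left_mono add_mono) auto
  also have "\<dots> = \<epsilon> * real n" by (simp add: field_simps)
  finally show thesis using that n int by blast
qed

text \<open>On an event determined by the first \<open>n\<close> increments, the conditional law of \<open>\<beta>\<close> is the translate of
  \<open>X\<close> by \<open>x\<^sub>n\<close>, which has density \<open>r x\<^sub>n\<close>.\<close>

lemma nn_integral_cylinder:
  assumes E: "E \<in> sets incs" and f: "f \<in> borel_measurable X"
    and cyl: "\<And>h h'. h \<in> space incs \<Longrightarrow> h' \<in> space incs \<Longrightarrow> comb_seq n h h' \<in> E \<longleftrightarrow> h \<in> E"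
  shows "(\<integral>\<^sup>+ h. f (\<beta> h) * indicator E h \<partial>incs)
    = (\<integral>\<^sup>+ h. (\<integral>\<^sup>+ y. ennreal (r (pos h n) y) * f y \<partial>X) * indicator E h \<partial>incs)"
proof -
  note [measurable] = E f
  have "(\<integral>\<^sup>+ h. f (\<beta> h) * indicator E h \<partial>incs)
      = (\<integral>\<^sup>+ h. f (act (pos h n) (\<beta> ((shift ^^ n) h))) * indicator E h \<partial>incs)"
    by (rule nn_integral_cong_AE) (use equivariant_pos[of n] in eventually_elim, simp)
  also have "\<dots> = (\<integral>\<^sup>+ h. (\<integral>\<^sup>+ h'. f (act (pos h n) (\<beta> h')) * indicator E h \<partial>incs) \<partial>incs)"
    by (subst nn_integral_split[of _ n], measurable)
      (intro nn_integral_cong, simp add: walk_comb_seq shift_comb_seq cyl indicator_def)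
  also have "\<dots> = (\<integral>\<^sup>+ h. (\<integral>\<^sup>+ y. ennreal (r (pos h n) y) * f y \<partial>X) * indicator E h \<partial>incs)"
  proof (rule nn_integral_cong_AE)
    show "AE h in incs. (\<integral>\<^sup>+ h'. f (act (pos h n) (\<beta> h')) * indicator E h \<partial>incs)
        = (\<integral>\<^sup>+ y. ennreal (r (pos h n) y) * f y \<partial>X) * indicator E h"
      using nonsingular_pos[of n]
    proof eventually_elim
      fix h assume ns: "nonsingular (pos h n)"
      then have [measurable]: "act (pos h n) \<in> X \<rightarrow>\<^sub>M X" by (auto simp: nonsingular_def act_measurable)
      have "(\<integral>\<^sup>+ h'. f (act (pos h n) (\<beta> h')) * indicator E h \<partial>incs)
          = (\<integral>\<^sup>+ h'. f (act (pos h n) (\<beta> h')) \<partial>incs) * indicator E h"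
        by (rule nn_integral_multc) measurable
      also have "(\<integral>\<^sup>+ h'. f (act (pos h n) (\<beta> h')) \<partial>incs) = (\<integral>\<^sup>+ y. f (act (pos h n) y) \<partial>X)"
        by (rule nn_integral_\<beta>) measurable
      also have "\<dots> = (\<integral>\<^sup>+ y. ennreal (r (pos h n) y) * f y \<partial>X)"
        by (rule nn_integral_translate[OF ns f])
      finally show "(\<integral>\<^sup>+ h'. f (act (pos h n) (\<beta> h')) * indicator E h \<partial>incs)
        = (\<integral>\<^sup>+ y. ennreal (r (pos h n) y) * f y \<partial>X) * indicator E h" .
    qed
  qed
  finally show ?thesis .
qed

end

section \<open>Comparing a system with its quotient\<close>

context quotient_system
begin

sublocale quot: boundary_system G \<mu> Q "\<lambda>g C. act g ` C" "\<lambda>h. \<pi> (\<beta> h)"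
  by (rule quotient)

abbreviation \<rho> :: "'a \<Rightarrow> 'x \<Rightarrow> real" where
  "\<rho> g y \<equiv> quot.r g (\<pi> y)"

lemma nn_integral_quotient: "f \<in> borel_measurable Q \<Longrightarrow> (\<integral>\<^sup>+ y. f (\<pi> y) \<partial>X) = (\<integral>\<^sup>+ C. f C \<partial>Q)"
  using nn_integral_distr[OF measurable_block_of, of f] by (simp add: distr_block_of)

text \<open>The logarithm of the ratio of densities is additive along the path, and the probabilities of \<open>x\<^sub>n\<close>
  cancel in the difference of the two informations. Hence \<open>n\<close> times the mean is the
  mean of \<open>quot.info n - info n\<close>, and \<open>info n\<close> is nonnegative.\<close>

lemma log_ratio_mean_le:
  assumes entropy: "entropy_on G \<mu> < \<infinity>" and int: "integrable incs (quot.info n)"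
  shows "real n * (\<integral>h. log_r h - quot.log_r h \<partial>incs) \<le> (\<integral>h. quot.info n h \<partial>incs)"
proof -
  define L where "L h = log_r h - quot.log_r h" for h
  have L: "integrable incs L"
    unfolding L_def using integrable_log_r[OF entropy] quot.integrable_log_r[OF entropy]
    by (rule Bochner_Integration.integrable_diff)
  have "real n * (\<integral>h. L h \<partial>incs) = (\<integral>h. (\<Sum>i<n. L ((shift ^^ i) h)) \<partial>incs)"
    using integrable_shift[OF L] by (subst Bochner_Integration.integral_sum) auto
  also have "\<dots> \<le> (\<integral>h. quot.info n h \<partial>incs)"
  proof (rule integral_mono_AE)
    show "integrable incs (\<lambda>h. \<Sum>i<n. L ((shift ^^ i) h))"
      by (intro Bochner_Integration.integrable_sum integrable_shift(1)[OF L])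
    show "AE h in incs. (\<Sum>i<n. L ((shift ^^ i) h)) \<le> quot.info n h"
      using ln_r_pos[of n] quot.ln_r_pos[of n] info_nonneg[of n] AE_pos_prob_pos[of n]
        r_pos_positive[of n] quot.r_pos_positive[of n]
    proof eventually_elim
      fix h assume "ln (r (pos h n) (\<beta> h)) = (\<Sum>i<n. log_r ((shift ^^ i) h))"
        "ln (\<rho> (pos h n) (\<beta> h)) = (\<Sum>i<n. quot.log_r ((shift ^^ i) h))"
        "0 \<le> info n h" and p: "0 < pos_prob n (pos h n)" "0 < r (pos h n) (\<beta> h)" "0 < \<rho> (pos h n) (\<beta> h)"
      moreover have "info n h = - ln (pos_prob n (pos h n)) - ln (r (pos h n) (\<beta> h))"
        "quot.info n h = - ln (pos_prob n (pos h n)) - ln (\<rho> (pos h n) (\<beta> h))"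
        using p by (auto simp: info_def quot.info_def ln_mult)
      ultimately show "(\<Sum>i<n. L ((shift ^^ i) h)) \<le> quot.info n h"
        by (simp add: L_def sum_subtractf)
    qed
  qed fact
  finally show ?thesis by (simp add: L_def)
qed

lemma mean_ratio_le_1: "(\<integral>\<^sup>+ h. ennreal (\<rho> (pos h n) (\<beta> h) / r (pos h n) (\<beta> h)) \<partial>incs) \<le> 1"
proof -
  have m: "(\<lambda>(g, y). ennreal (\<rho> g y / r g y)) \<in> borel_measurable (count_space (carrier G) \<Otimes>\<^sub>M X)"
    by measurable
  have "(\<integral>\<^sup>+ h. ennreal (\<rho> (pos h n) (\<beta> h) / r (pos h n) (\<beta> h)) \<partial>incs)
      = (\<integral>\<^sup>+ h. (\<integral>\<^sup>+ y. ennreal (r (pos h n) y) * ennreal (\<rho> (pos h n) y / r (pos h n) y) \<partial>X) \<partial>incs)"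
    using nn_integral_pos_\<beta>_density[OF m, of n] by simp
  also have "\<dots> \<le> (\<integral>\<^sup>+ h. (\<integral>\<^sup>+ y. ennreal (\<rho> (pos h n) y) \<partial>X) \<partial>incs)"
    by (intro nn_integral_mono) (simp add: ennreal_mult[symmetric])
  also have "\<dots> = (\<integral>\<^sup>+ h. 1 \<partial>incs)"
  proof (rule nn_integral_cong_AE)
    show "AE h in incs. (\<integral>\<^sup>+ y. ennreal (\<rho> (pos h n) y) \<partial>X) = 1"
      using quot.nonsingular_pos[of n]
      by eventually_elim
        (simp add: nn_integral_quotient[of "\<lambda>C. ennreal (quot.r _ C)"] quot.nn_integral_r)
  qed
  also have "\<dots> = 1" by (simp add: iid.P.emeasure_space_1)
  finally show ?thesis .
qed

text \<open>The equality case of Gibbs' inequality: for the ratio \<open>t\<close> of the densities, \<open>t - 1 - ln t\<close> is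
  nonnegative and vanishes only at one, while its mean is at most the mean of \<open>- ln t\<close>.\<close>

lemma densities_agree_first:
  assumes entropy: "entropy_on G \<mu> < \<infinity>"
    and le: "(\<integral>h. log_r h - quot.log_r h \<partial>incs) \<le> 0"
  shows "AE h in incs. r (h 0) (\<beta> h) = \<rho> (h 0) (\<beta> h)"
proof -
  define t where "t h = \<rho> (h 0) (\<beta> h) / r (h 0) (\<beta> h)" for h
  have [measurable]: "t \<in> borel_measurable incs" unfolding t_def by measurable
  have t0: "0 \<le> t h" for h by (simp add: t_def)
  have "(\<integral>\<^sup>+ h. ennreal (t h) \<partial>incs) = (\<integral>\<^sup>+ h. ennreal (\<rho> (pos h 1) (\<beta> h) / r (pos h 1) (\<beta> h)) \<partial>incs)"
    by (rule nn_integral_cong) (auto simp: t_def space_incs Pi_iff)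
  then have t1: "(\<integral>\<^sup>+ h. ennreal (t h) \<partial>incs) \<le> 1"
    using mean_ratio_le_1[of 1] by (simp del: walk.simps)
  have int_t: "integrable incs t"
    using t0 t1 by (intro integrableI_nonneg) (auto intro: order.strict_trans1)
  have "ennreal (\<integral>h. t h \<partial>incs) \<le> 1"
    using t1 nn_integral_eq_integral[OF int_t] t0 by simp
  then have mean_t: "(\<integral>h. t h \<partial>incs) \<le> 1" by simp
  define L where "L h = log_r h - quot.log_r h" for h
  have int_L: "integrable incs L"
    unfolding L_def using integrable_log_r[OF entropy] quot.integrable_log_r[OF entropy]
    by (rule Bochner_Integration.integrable_diff)
  have L: "AE h in incs. L h = - ln (t h) \<and> 0 < t h"
    using r_first_positive quot.r_first_positive
    by eventually_elim (simp add: L_def t_def log_r_def quot.log_r_def ln_div)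
  have int: "integrable incs (\<lambda>h. t h - 1 + L h)"
    using int_t int_L by simp
  have nonneg: "AE h in incs. 0 \<le> t h - 1 + L h"
    using L by eventually_elim (use ln_le_minus_one in fastforce)
  have "(\<integral>h. t h - 1 + L h \<partial>incs) = (\<integral>h. t h \<partial>incs) - 1 + (\<integral>h. L h \<partial>incs)"
    using int_t int_L by (simp add: iid.P.prob_space)
  then have "(\<integral>h. t h - 1 + L h \<partial>incs) = 0"
    using mean_t le integral_nonneg_AE[OF nonneg] by (simp add: L_def)
  then have "AE h in incs. t h - 1 + L h = 0"
    using integral_nonneg_eq_0_iff_AE[OF int nonneg] by simp
  then show ?thesis
    using L r_first_positive
  proof eventually_elim
    fix h assume "t h - 1 + L h = 0" "L h = - ln (t h) \<and> 0 < t h" "0 < r (h 0) (\<beta> h)"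
    then have "t h = 1" by (intro ln_eq_minus_one) auto
    then show "r (h 0) (\<beta> h) = \<rho> (h 0) (\<beta> h)"
      using \<open>0 < r (h 0) (\<beta> h)\<close> by (simp add: t_def)
  qed
qed

lemma densities_agree_path:
  assumes "AE h in incs. r (h 0) (\<beta> h) = \<rho> (h 0) (\<beta> h)"
  shows "AE h in incs. r (pos h n) (\<beta> h) = \<rho> (pos h n) (\<beta> h)"
proof (induction n)
  case 0
  show ?case
    using AE_\<beta>[OF r_one] quot.AE_\<beta>[OF quot.r_one] by eventually_elim simp
next
  case (Suc n)
  note Suc r_pos_Suc[of n] quot.r_pos_Suc[of n] AE_shift[OF assms, of n]
  then show ?case
    by eventually_elim (simp add: shift_funpow_apply[where k = 0])
qed

text \<open>Agreement along the path says that the two densities agree where \<open>r\<close> is positive; both are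
  nonnegative with integral one, so no mass of \<open>\<rho>\<close> is left where \<open>r\<close> vanishes.\<close>

lemma densities_agree:
  assumes agree: "AE h in incs. r (pos h n) (\<beta> h) = \<rho> (pos h n) (\<beta> h)"
  shows "AE h in incs. AE y in X. r (pos h n) y = \<rho> (pos h n) y"
proof -
  let ?D = "{p \<in> space (count_space (carrier G) \<Otimes>\<^sub>M X). r (fst p) (snd p) \<noteq> \<rho> (fst p) (snd p)}"
  have D [measurable]: "?D \<in> sets (count_space (carrier G) \<Otimes>\<^sub>M X)" by measurable
  let ?f = "indicator ?D :: _ \<Rightarrow> ennreal"
  have f: "?f \<in> borel_measurable (count_space (carrier G) \<Otimes>\<^sub>M X)" by measurable
  have "(\<integral>\<^sup>+ h. (\<integral>\<^sup>+ y. ennreal (r (pos h n) y) * ?f (pos h n, y) \<partial>X) \<partial>incs) = (\<integral>\<^sup>+ h. ?f (pos h n, \<beta> h) \<partial>incs)"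
    by (rule nn_integral_pos_\<beta>_density[OF f, symmetric])
  also have "\<dots> = 0"
    using agree by (intro nn_integral_zero') (auto elim!: eventually_mono simp: indicator_def)
  finally have "(\<integral>\<^sup>+ h. (\<integral>\<^sup>+ y. ennreal (r (pos h n) y) * ?f (pos h n, y) \<partial>X) \<partial>incs) = 0" .
  moreover have m: "(\<lambda>h. \<integral>\<^sup>+ y. ennreal (r (pos h n) y) * ?f (pos h n, y) \<partial>X) \<in> borel_measurable incs"
    by measurable
  ultimately have "AE h in incs. (\<integral>\<^sup>+ y. ennreal (r (pos h n) y) * ?f (pos h n, y) \<partial>X) = 0"
    by (simp add: nn_integral_0_iff_AE)
  then show ?thesis
    using nonsingular_pos[of n] quot.nonsingular_pos[of n]
  proof eventually_elim
    fix h assume 0: "(\<integral>\<^sup>+ y. ennreal (r (pos h n) y) * ?f (pos h n, y) \<partial>X) = 0"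
      and ns: "nonsingular (pos h n)" "quot.nonsingular (pos h n)"
    let ?g = "pos h n"
    have g: "?g \<in> carrier G" using ns by (simp add: nonsingular_def)
    have "(\<lambda>y. ?f (?g, y)) \<in> borel_measurable X"
      using measurable_compose[OF measurable_Pair1'[of ?g "count_space (carrier G)" X] f] g by simp
    then have "AE y in X. ennreal (r ?g y) * ?f (?g, y) = 0"
      using 0 by (subst (asm) nn_integral_0_iff_AE) auto
    then have dich: "AE y in X. r ?g y = 0 \<or> r ?g y = \<rho> ?g y"
      using AE_space
      by eventually_elim (use g in \<open>auto simp: indicator_def space_pair_measure split: if_splits\<close>)
    have one: "(\<integral>\<^sup>+ y. ennreal (\<rho> ?g y) \<partial>X) = 1"
      using nn_integral_quotient[of "\<lambda>C. ennreal (quot.r ?g C)"] quot.nn_integral_r[OF ns(2)] by simp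
    have "(\<integral>\<^sup>+ y. ennreal (\<rho> ?g y) - ennreal (r ?g y) \<partial>X) = (\<integral>\<^sup>+ y. ennreal (\<rho> ?g y) \<partial>X) - (\<integral>\<^sup>+ y. ennreal (r ?g y) \<partial>X)"
      using dich nn_integral_r[OF ns(1)] by (intro nn_integral_diff) (auto elim!: eventually_mono)
    also have "\<dots> = 0" using one nn_integral_r[OF ns(1)] by simp
    finally have "AE y in X. ennreal (\<rho> ?g y) - ennreal (r ?g y) = 0"
      by (subst (asm) nn_integral_0_iff_AE) auto
    then show "AE y in X. r ?g y = \<rho> ?g y"
      using dich
      by eventually_elim (auto simp: diff_eq_0_iff_ennreal intro!: antisym)
  qed
qed

text \<open>If the densities of the translates are functions on the quotient, then \<open>f\<close> and its conditional
  expectation given the quotient have the same integral against each of them, hence the same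
  integral, after composition with \<open>\<beta>\<close>, over every cylinder set of increments. As \<open>\<beta>\<close> is a function of
  the increments, they coincide.\<close>

lemma function_on_quotient:
  fixes f :: "'x \<Rightarrow> real"
  assumes agree: "\<And>n. AE h in incs. AE y in X. r (pos h n) y = \<rho> (pos h n) y"
    and f [measurable]: "f \<in> borel_measurable X" and f0: "\<And>y. 0 \<le> f y" and f1: "\<And>y. f y \<le> c"
  obtains f' :: "'x set \<Rightarrow> real" where "f' \<in> borel_measurable Q" "AE y in X. f y = f' (\<pi> y)"
proof -
  let ?F = "density X (\<lambda>y. ennreal (f y))"
  define N where "N = distr ?F Q \<pi>"
  have F: "finite_measure ?F"
  proof
    have "emeasure ?F (space X) = (\<integral>\<^sup>+ y. ennreal (f y) * indicator (space X) y \<partial>X)"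
      by (rule emeasure_density) auto
    also have "\<dots> \<le> (\<integral>\<^sup>+ y. ennreal c \<partial>X)"
      by (intro nn_integral_mono) (simp add: f1 ennreal_leI)
    also have "\<dots> < \<infinity>" by (simp add: emeasure_space_1)
    finally show "emeasure ?F (space ?F) \<noteq> \<infinity>" by (simp add: less_top)
  qed
  interpret N: finite_measure N
    unfolding N_def by (rule finite_measure.finite_measure_distr[OF F]) simp
  have sN: "sets N = sets Q" by (simp add: N_def)
  have ac: "absolutely_continuous Q N"
    unfolding absolutely_continuous_def
  proof
    fix \<A> assume A: "\<A> \<in> null_sets Q"
    then have m [measurable]: "\<A> \<in> sets Q" by auto
    have "AE y in X. \<pi> y \<notin> \<A>"
      using AE_distrD[OF measurable_block_of, where P = "\<lambda>C. C \<notin> \<A>"] AE_not_in[OF A]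
      by (simp only: distr_block_of)
    have "emeasure N \<A> = emeasure ?F (\<pi> -` \<A> \<inter> space X)"
      unfolding N_def by (subst emeasure_distr) (auto simp: m)
    also have "\<dots> = (\<integral>\<^sup>+ y. ennreal (f y) * indicator (\<pi> -` \<A> \<inter> space X) y \<partial>X)"
      by (rule emeasure_density) (auto intro: measurable_sets)
    also have "\<dots> = 0"
      using \<open>AE y in X. \<pi> y \<notin> \<A>\<close> by (intro nn_integral_zero') (auto elim!: eventually_mono simp: indicator_def)
    finally show "\<A> \<in> null_sets N" using m by (auto simp: null_sets_def sN)
  qed
  \<comment> \<open>The conditional expectation of \<open>f\<close> given the quotient, as a function on the quotient.\<close>
  define f' where "f' C = enn2real (RN_deriv Q N C)" for C
  have f' [measurable]: "f' \<in> borel_measurable Q" unfolding f'_def by measurable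
  have "AE C in Q. RN_deriv Q N C \<noteq> \<infinity>"
    using N.sigma_finite_measure_axioms ac sN by (rule quot.RN_deriv_finite)
  then have fin: "AE C in Q. RN_deriv Q N C = ennreal (f' C)"
    by eventually_elim (simp add: f'_def top.not_eq_extremum)
  have test: "(\<integral>\<^sup>+ y. ennreal (f y) * \<phi> (\<pi> y) \<partial>X) = (\<integral>\<^sup>+ y. ennreal (f' (\<pi> y)) * \<phi> (\<pi> y) \<partial>X)"
    if \<phi> [measurable]: "\<phi> \<in> borel_measurable Q" for \<phi>
  proof -
    have "(\<integral>\<^sup>+ y. ennreal (f y) * \<phi> (\<pi> y) \<partial>X) = (\<integral>\<^sup>+ y. \<phi> (\<pi> y) \<partial>?F)"
      by (rule nn_integral_density[symmetric]) measurable
    also have "\<dots> = (\<integral>\<^sup>+ C. \<phi> C \<partial>N)"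
      unfolding N_def by (rule nn_integral_distr[symmetric]) (simp_all add: \<phi>)
    also have "\<dots> = (\<integral>\<^sup>+ C. RN_deriv Q N C * \<phi> C \<partial>Q)"
      using ac sN \<phi> by (rule quot.RN_deriv_nn_integral)
    also have "\<dots> = (\<integral>\<^sup>+ C. ennreal (f' C) * \<phi> C \<partial>Q)"
      using fin by (intro nn_integral_cong_AE) auto
    also have "\<dots> = (\<integral>\<^sup>+ y. ennreal (f' (\<pi> y)) * \<phi> (\<pi> y) \<partial>X)"
      by (rule nn_integral_quotient[symmetric]) measurable
    finally show ?thesis .
  qed
  let ?u = "\<lambda>h. ennreal (f (\<beta> h))" and ?v = "\<lambda>h. ennreal (f' (\<pi> (\<beta> h)))"
  have mass: "(\<integral>\<^sup>+ h. ?u h \<partial>incs) < \<infinity>"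
  proof -
    have "(\<integral>\<^sup>+ h. ?u h \<partial>incs) \<le> (\<integral>\<^sup>+ h. ennreal c \<partial>incs)"
      by (intro nn_integral_mono ennreal_leI f1)
    also have "\<dots> < \<infinity>" by (simp add: iid.P.emeasure_space_1)
    finally show ?thesis .
  qed
  have cyl: "(\<integral>\<^sup>+ h. ?u h * indicator E h \<partial>incs) = (\<integral>\<^sup>+ h. ?v h * indicator E h \<partial>incs)"
    if E: "E \<in> sets incs" and c: "\<And>h h'. h \<in> space incs \<Longrightarrow> h' \<in> space incs \<Longrightarrow> comb_seq n h h' \<in> E \<longleftrightarrow> h \<in> E" for E n
  proof -
    have "(\<integral>\<^sup>+ h. ?u h * indicator E h \<partial>incs) = (\<integral>\<^sup>+ h. (\<integral>\<^sup>+ y. ennreal (r (pos h n) y) * ennreal (f y) \<partial>X) * indicator E h \<partial>incs)"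
      by (rule nn_integral_cylinder[OF E _ c]) auto
    also have "\<dots> = (\<integral>\<^sup>+ h. (\<integral>\<^sup>+ y. ennreal (r (pos h n) y) * ennreal (f' (\<pi> y)) \<partial>X) * indicator E h \<partial>incs)"
    proof (rule nn_integral_cong_AE)
      show "AE h in incs. (\<integral>\<^sup>+ y. ennreal (r (pos h n) y) * ennreal (f y) \<partial>X) * indicator E h
          = (\<integral>\<^sup>+ y. ennreal (r (pos h n) y) * ennreal (f' (\<pi> y)) \<partial>X) * indicator E h"
        using agree[of n]
      proof eventually_elim
        fix h assume a: "AE y in X. r (pos h n) y = \<rho> (pos h n) y"
        have "(\<integral>\<^sup>+ y. ennreal (r (pos h n) y) * ennreal (f y) \<partial>X) = (\<integral>\<^sup>+ y. ennreal (f y) * ennreal (\<rho> (pos h n) y) \<partial>X)"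
          using a by (intro nn_integral_cong_AE) (auto elim!: eventually_mono simp: mult.commute)
        also have "\<dots> = (\<integral>\<^sup>+ y. ennreal (f' (\<pi> y)) * ennreal (\<rho> (pos h n) y) \<partial>X)"
          by (rule test[of "\<lambda>C. ennreal (quot.r (pos h n) C)"]) measurable
        also have "\<dots> = (\<integral>\<^sup>+ y. ennreal (r (pos h n) y) * ennreal (f' (\<pi> y)) \<partial>X)"
          using a by (intro nn_integral_cong_AE) (auto elim!: eventually_mono simp: mult.commute)
        finally show "(\<integral>\<^sup>+ y. ennreal (r (pos h n) y) * ennreal (f y) \<partial>X) * indicator E h
          = (\<integral>\<^sup>+ y. ennreal (r (pos h n) y) * ennreal (f' (\<pi> y)) \<partial>X) * indicator E h" by simp
      qed
    qed
    also have "\<dots> = (\<integral>\<^sup>+ h. ?v h * indicator E h \<partial>incs)"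
      by (rule nn_integral_cylinder[OF E _ c, symmetric]) auto
    finally show ?thesis .
  qed
  have "density incs ?u = density incs ?v"
  proof (rule measure_eqI_PiM_infinite[where I = UNIV and M = "\<lambda>_. inc"])
    show "finite_measure (density incs ?u)"
    proof
      show "emeasure (density incs ?u) (space (density incs ?u)) \<noteq> \<infinity>"
        using mass by (simp add: emeasure_density less_top cong: nn_integral_cong)
    qed
    fix J :: "nat set" and A assume J: "finite J" and A: "\<And>i. i \<in> J \<Longrightarrow> A i \<in> sets inc"
    let ?E = "prod_emb UNIV (\<lambda>_. inc) J (Pi\<^sub>E J A)"
    have E: "?E \<in> sets incs" using J A by (intro sets_PiM_I) auto
    obtain n where n: "\<And>j. j \<in> J \<Longrightarrow> j < n" using J unfolding finite_nat_set_iff_bounded by auto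
    have "comb_seq n h h' \<in> ?E \<longleftrightarrow> h \<in> ?E" if "h \<in> space incs" "h' \<in> space incs" for h h'
    proof -
      have restrict_eq: "restrict (comb_seq n h h') J = restrict h J"
        using n by (auto simp: restrict_def comb_seq_less)
      have "comb_seq n h h' \<in> space incs" using that by (auto simp: space_incs comb_seq_def Pi_iff)
      then show ?thesis
        using that restrict_eq by (simp add: prod_emb_iff space_incs Pi_iff)
    qed
    from cyl[OF E this]
    show "emeasure (density incs ?u) ?E = emeasure (density incs ?v) ?E"
      using E by (simp add: emeasure_density)
  qed auto
  then have "AE h in incs. ?u h = ?v h"
    using mass by (subst finite_density_unique[symmetric]) auto
  then have "AE h in incs. f (\<beta> h) = f' (\<pi> (\<beta> h))"
    by eventually_elim (simp add: f0 f'_def)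
  then have "AE y in distr incs X \<beta>. f y = f' (\<pi> y)"
    by (subst AE_distr_iff) auto
  then have "AE y in X. f y = f' (\<pi> y)" by (simp only: distr_\<beta>)
  with f' show thesis by (rule that)
qed

end

section \<open>Strips force small information\<close>

lemma (in finite_measure) measure_eventually_not_in:
  assumes [measurable]: "\<And>n::nat. A n \<in> sets M" and "AE x in M. \<forall>\<^sub>F n in sequentially. x \<notin> A n"
  shows "(\<lambda>n. measure M (A n)) \<longlonglongrightarrow> 0"
proof -
  have "(\<lambda>n. \<integral>x. indicat_real (A n) x \<partial>M) \<longlonglongrightarrow> (\<integral>x. 0 \<partial>M)"
  proof (rule integral_dominated_convergence[where w = "\<lambda>_. 1" and s = "\<lambda>n. indicat_real (A n)"])
    show "AE x in M. (\<lambda>n. indicat_real (A n) x) \<longlonglongrightarrow> 0"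
      using assms(2)
    proof eventually_elim
      fix x assume "\<forall>\<^sub>F n in sequentially. x \<notin> A n"
      then have "\<forall>\<^sub>F n in sequentially. indicat_real (A n) x = 0"
        by eventually_elim simp
      then show "(\<lambda>n. indicat_real (A n) x) \<longlonglongrightarrow> 0" by (rule tendsto_eventually)
    qed
    show "integrable M (\<lambda>_. 1 :: real)" by simp
  qed (auto simp: indicator_def)
  moreover have "(\<integral>x. indicat_real (A n) x \<partial>M) = measure M (A n)" for n
    by simp
  ultimately show ?thesis by simp
qed

lemma log_card_le:
  assumes "A \<subseteq> B" "log_card B \<le> ereal c"
  shows "finite A" "real (card A) \<le> exp c"
proof -
  have fin: "finite B" using assms(2) by (auto simp: log_card_def split: if_splits)
  then show "finite A" using assms(1) finite_subset by blast
  have "real (card B) \<le> exp c"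
  proof (cases "B = {}")
    case False
    then have "ln (real (card B)) \<le> c" "0 < real (card B)"
      using fin assms(2) by (auto simp: log_card_def card_gt_0_iff)
    then show ?thesis by (metis exp_le_cancel_iff exp_ln)
  qed simp
  then show "real (card A) \<le> exp c"
    using card_mono[OF fin assms(1)] by linarith
qed

text \<open>The system \<open>Y\<close> is the boundary of the walk and \<open>Z\<close> the boundary of the reflected walk. The
  boundary of the reflected walk enters through its stationarity under inverted increments.\<close>

locale strips = boundary_system G \<mu> Y act \<beta> + Z: measurable_action G Z actz
  for G :: "('a, 'b) monoid_scheme" (structure) and \<mu> :: "'a pmf"
    and Y :: "'y measure" and act :: "'a \<Rightarrow> 'y \<Rightarrow> 'y" and \<beta>
    and Z :: "'z measure" and actz :: "'a \<Rightarrow> 'z \<Rightarrow> 'z" +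
  fixes S :: "'z \<Rightarrow> 'y \<Rightarrow> 'a set" and \<G> :: "nat \<Rightarrow> 'a set"
  assumes Z_stationary: "\<And>f. f \<in> borel_measurable Z \<Longrightarrow>
      (\<integral>\<^sup>+ g. (\<integral>\<^sup>+ b. f (actz (inv g) b) \<partial>Z) \<partial>inc) = (\<integral>\<^sup>+ b. f b \<partial>Z)"
    and gauge: "gauge_on G \<G>"
    and S_measurable: "case_prod S \<in> Z \<Otimes>\<^sub>M Y \<rightarrow>\<^sub>M subset_space G"
    and S_nonempty: "AE (b, y) in Z \<Otimes>\<^sub>M Y. S b y \<noteq> {}"
    and S_equivariant: "\<And>g. g \<in> carrier G \<Longrightarrow>
      AE (b, y) in Z \<Otimes>\<^sub>M Y. S (actz g b) (act g y) = g <# S b y"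
    and S_growth: "\<And>g. g \<in> carrier G \<Longrightarrow>
      AE (b, y) in Z \<Otimes>\<^sub>M Y.
        tendsto_zero_in_prob (walk_measure G \<mu>)
          (\<lambda>n x. ereal (1 / real n) * log_card ((S b y #> g) \<inter> \<G> (gauge_fun \<G> (x n))))"
begin

abbreviation J :: "((nat \<Rightarrow> 'a) \<times> 'z) measure" where
  "J \<equiv> incs \<Otimes>\<^sub>M Z"

sublocale ZY: pair_prob_space Z Y ..

sublocale J: pair_prob_space incs Z ..

sublocale inc_incs: pair_sigma_finite inc incs ..

sublocale incs_incs: pair_sigma_finite incs incs ..

text \<open>Stationarity applies one increment at a time because the inverse of \<open>x\<^bsub>n+1\<^esub>\<close> acts by the inverse of the
  first increment first, and the first increment is independent of the others.\<close>

lemma Z_stationary_pos: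
  assumes "f \<in> borel_measurable Z"
  shows "(\<integral>\<^sup>+ h. (\<integral>\<^sup>+ b. f (actz (inv (pos h n)) b) \<partial>Z) \<partial>incs) = (\<integral>\<^sup>+ b. f b \<partial>Z)"
  using assms
proof (induction n arbitrary: f)
  case 0
  have "(\<integral>\<^sup>+ b. f (actz (inv \<one>) b) \<partial>Z) = (\<integral>\<^sup>+ b. f b \<partial>Z)"
    by (intro nn_integral_cong) (simp add: Z.act_one)
  then show ?case by (simp add: iid.P.emeasure_space_1)
next
  case (Suc n)
  note [measurable] = Suc.prems
  let ?F = "\<lambda>(g, h). \<integral>\<^sup>+ b. f (actz (inv (pos h n)) (actz (inv g) b)) \<partial>Z"
  have F: "?F \<in> borel_measurable (inc \<Otimes>\<^sub>M incs)"
    by measurable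
  have "(\<integral>\<^sup>+ h. (\<integral>\<^sup>+ b. f (actz (inv (pos h (Suc n))) b) \<partial>Z) \<partial>incs) = (\<integral>\<^sup>+ h. ?F (h 0, shift h) \<partial>incs)"
  proof (rule nn_integral_cong)
    fix h assume h: "h \<in> space incs"
    have c: "h 0 \<in> carrier G" "pos (shift h) n \<in> carrier G"
      using h walk_closed[OF one_closed shift_in_space[OF h]] by (auto simp: space_incs)
    have "(\<integral>\<^sup>+ b. f (actz (inv (pos h (Suc n))) b) \<partial>Z) = (\<integral>\<^sup>+ b. f (actz (inv (pos (shift h) n)) (actz (inv (h 0)) b)) \<partial>Z)"
      unfolding pos_Suc_left[OF h]
      by (intro nn_integral_cong) (use c in \<open>simp add: inv_mult_group Z.act_mult\<close>)
    then show "(\<integral>\<^sup>+ b. f (actz (inv (pos h (Suc n))) b) \<partial>Z) = ?F (h 0, shift h)" by simp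
  qed
  also have "\<dots> = (\<integral>\<^sup>+ g. (\<integral>\<^sup>+ h. ?F (g, h) \<partial>incs) \<partial>inc)"
    by (rule nn_integral_split_first[OF F])
  also have "\<dots> = (\<integral>\<^sup>+ h. (\<integral>\<^sup>+ g. ?F (g, h) \<partial>inc) \<partial>incs)"
    using inc_incs.Fubini'[of "\<lambda>g h. ?F (g, h)"] F by simp
  also have "\<dots> = (\<integral>\<^sup>+ h. (\<integral>\<^sup>+ b. f (actz (inv (pos h n)) b) \<partial>Z) \<partial>incs)"
  proof (rule nn_integral_cong)
    fix h assume "h \<in> space incs"
    then have "actz (inv (pos h n)) \<in> Z \<rightarrow>\<^sub>M Z" by (intro Z.act_measurable) (auto intro: walk_closed)
    from Z_stationary[OF measurable_compose[OF this Suc.prems]]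
    show "(\<integral>\<^sup>+ g. ?F (g, h) \<partial>inc) = (\<integral>\<^sup>+ b. f (actz (inv (pos h n)) b) \<partial>Z)" by simp
  qed
  also have "\<dots> = (\<integral>\<^sup>+ b. f b \<partial>Z)" by (rule Suc.IH[OF Suc.prems])
  finally show ?case .
qed

lemma measurable_pull_back:
  "(\<lambda>(h, b). (actz (inv (pos h n)) b, \<beta> ((shift ^^ n) h))) \<in> J \<rightarrow>\<^sub>M Z \<Otimes>\<^sub>M Y"
  by measurable

text \<open>The pair of boundary points, moved by the inverse of \<open>x\<^sub>n\<close>, has the law of the original pair: the
  second coordinate depends only on the increments from time \<open>n\<close> on, the first only on the earlier
  ones and on \<open>Z\<close>. This invariance plays the role of the shift on bilateral paths.\<close>

lemma distr_pull_back:
  "distr J (Z \<Otimes>\<^sub>M Y) (\<lambda>(h, b). (actz (inv (pos h n)) b, \<beta> ((shift ^^ n) h))) = Z \<Otimes>\<^sub>M Y"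
proof (rule measure_eqI)
  let ?V = "\<lambda>(h, b). (actz (inv (pos h n)) b, \<beta> ((shift ^^ n) h))"
  fix A assume "A \<in> sets (distr J (Z \<Otimes>\<^sub>M Y) ?V)"
  then have A [measurable]: "A \<in> sets (Z \<Otimes>\<^sub>M Y)" by simp
  have "emeasure (distr J (Z \<Otimes>\<^sub>M Y) ?V) A = (\<integral>\<^sup>+ q. indicator A (?V q) \<partial>J)"
    by (subst nn_integral_distr[OF measurable_pull_back, symmetric]) auto
  also have "\<dots> = (\<integral>\<^sup>+ h. (\<integral>\<^sup>+ b. indicator A (actz (inv (pos h n)) b, \<beta> ((shift ^^ n) h)) \<partial>Z) \<partial>incs)"
    using Z.nn_integral_fst[OF measurable_compose[OF measurable_pull_back, of "indicator A" borel n], symmetric] by simp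
  also have "\<dots> = (\<integral>\<^sup>+ h. (\<integral>\<^sup>+ h'. (\<integral>\<^sup>+ b. indicator A (actz (inv (pos h n)) b, \<beta> h') \<partial>Z) \<partial>incs) \<partial>incs)"
  proof -
    have "(\<lambda>(g, h'). \<integral>\<^sup>+ b. indicator A (actz (inv g) b, \<beta> h') \<partial>Z) \<in> borel_measurable (count_space (carrier G) \<Otimes>\<^sub>M incs)"
      by measurable
    from nn_integral_split_pos[OF this, of n] show ?thesis by simp
  qed
  also have "\<dots> = (\<integral>\<^sup>+ h'. (\<integral>\<^sup>+ h. (\<integral>\<^sup>+ b. indicator A (actz (inv (pos h n)) b, \<beta> h') \<partial>Z) \<partial>incs) \<partial>incs)"
    by (rule incs_incs.Fubini'[symmetric]) measurable
  also have "\<dots> = (\<integral>\<^sup>+ h'. (\<integral>\<^sup>+ b. indicator A (b, \<beta> h') \<partial>Z) \<partial>incs)"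
  proof (rule nn_integral_cong)
    fix h' assume "h' \<in> space incs"
    then have "\<beta> h' \<in> space Y" by (rule measurable_space[OF \<beta>_measurable])
    then have "(\<lambda>b. indicator A (b, \<beta> h') :: ennreal) \<in> borel_measurable Z"
      using measurable_compose[OF measurable_Pair2'[of "\<beta> h'" Y Z], of "indicator A" borel] by simp
    from Z_stationary_pos[OF this, of n]
    show "(\<integral>\<^sup>+ h. (\<integral>\<^sup>+ b. indicator A (actz (inv (pos h n)) b, \<beta> h') \<partial>Z) \<partial>incs) = (\<integral>\<^sup>+ b. indicator A (b, \<beta> h') \<partial>Z)"
      by simp
  qed
  also have "\<dots> = (\<integral>\<^sup>+ y. (\<integral>\<^sup>+ b. indicator A (b, y) \<partial>Z) \<partial>Y)"
    by (rule nn_integral_\<beta>) measurable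
  also have "\<dots> = emeasure (Z \<Otimes>\<^sub>M Y) A"
    by (subst ZY.nn_integral_snd) auto
  finally show "emeasure (distr J (Z \<Otimes>\<^sub>M Y) ?V) A = emeasure (Z \<Otimes>\<^sub>M Y) A" .
qed simp

lemma distr_endpoints: "distr J (Z \<Otimes>\<^sub>M Y) (\<lambda>(h, b). (b, \<beta> h)) = Z \<Otimes>\<^sub>M Y"
proof -
  have "distr J (Z \<Otimes>\<^sub>M Y) (\<lambda>(h, b). (b, \<beta> h))
      = distr J (Z \<Otimes>\<^sub>M Y) (\<lambda>(h, b). (actz (inv (pos h 0)) b, \<beta> ((shift ^^ 0) h)))"
    by (rule distr_cong) (auto simp: space_pair_measure Z.act_one)
  then show ?thesis by (simp only: distr_pull_back)
qed

lemma measurable_endpoints [measurable]: "(\<lambda>q. (snd q, \<beta> (fst q))) \<in> J \<rightarrow>\<^sub>M Z \<Otimes>\<^sub>M Y"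
  by measurable

lemma AE_endpoints: "AE p in Z \<Otimes>\<^sub>M Y. P p \<Longrightarrow> AE q in J. P (snd q, \<beta> (fst q))"
  using AE_distrD[OF measurable_endpoints, of P] distr_endpoints[unfolded case_prod_beta] by (simp only:)

lemma AE_path: "AE h in incs. P h \<Longrightarrow> AE q in J. P (fst q)"
  using AE_distrD[OF measurable_fst[of incs Z], where P = P] by (simp only: Z.distr_pair_fst)

lemma measure_path: "A \<in> sets incs \<Longrightarrow> measure J {q \<in> space J. fst q \<in> A} = measure incs A"
proof -
  assume A: "A \<in> sets incs"
  have "measure (distr J incs fst) A = measure J (fst -` A \<inter> space J)"
    using A by (intro measure_distr) auto
  also have "fst -` A \<inter> space J = {q \<in> space J. fst q \<in> A}" by auto
  finally show ?thesis by (simp add: Z.distr_pair_fst)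
qed

lemma S_subset: "b \<in> space Z \<Longrightarrow> y \<in> space Y \<Longrightarrow> S b y \<subseteq> carrier G"
  using measurable_space[OF S_measurable, of "(b, y)"]
  by (simp add: space_pair_measure subset_space_def space_measure_of_conv)

lemma measurable_member:
  assumes "k \<in> carrier G"
  shows "{p \<in> space (Z \<Otimes>\<^sub>M Y). k \<in> S (fst p) (snd p)} \<in> sets (Z \<Otimes>\<^sub>M Y)"
proof -
  have "{A \<in> Pow (carrier G). k \<in> A} \<in> sets (subset_space G)"
    unfolding subset_space_def using assms by (auto intro!: in_measure_of)
  from measurable_sets[OF S_measurable this]
  have "case_prod S -` {A \<in> Pow (carrier G). k \<in> A} \<inter> space (Z \<Otimes>\<^sub>M Y) \<in> sets (Z \<Otimes>\<^sub>M Y)" .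
  also have "case_prod S -` {A \<in> Pow (carrier G). k \<in> A} \<inter> space (Z \<Otimes>\<^sub>M Y)
      = {p \<in> space (Z \<Otimes>\<^sub>M Y). k \<in> S (fst p) (snd p)}"
    using S_subset by (auto simp: space_pair_measure)
  finally show ?thesis .
qed

lemma pred_member [measurable (raw)]:
  assumes "f \<in> N \<rightarrow>\<^sub>M count_space (carrier G)" "u \<in> N \<rightarrow>\<^sub>M Z" "v \<in> N \<rightarrow>\<^sub>M Y"
  shows "Measurable.pred N (\<lambda>x. f x \<in> S (u x) (v x))"
proof (rule measurable_compose_countable'[OF _ assms(1) countable_carrier])
  fix k assume "k \<in> carrier G"
  then have "Measurable.pred (Z \<Otimes>\<^sub>M Y) (\<lambda>p. k \<in> S (fst p) (snd p))"
    using measurable_member by (simp add: pred_def)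
  from measurable_compose[OF measurable_Pair[OF assms(2,3)] this]
  show "Measurable.pred N (\<lambda>x. k \<in> S (u x) (v x))" by simp
qed

text \<open>The pairs of boundary points for which the identity lies in the right translate of the strip by
  the inverse of some \<open>c\<close> in \<open>F\<close>.\<close>

definition hits :: "'a set \<Rightarrow> ('z \<times> 'y) set" where
  "hits F = {p \<in> space (Z \<Otimes>\<^sub>M Y). \<exists>c\<in>F. c \<in> S (fst p) (snd p)}"

lemma hits_measurable: "F \<subseteq> carrier G \<Longrightarrow> hits F \<in> sets (Z \<Otimes>\<^sub>M Y)"
proof -
  assume F: "F \<subseteq> carrier G"
  have "hits F = (\<Union>c\<in>F. {p \<in> space (Z \<Otimes>\<^sub>M Y). c \<in> S (fst p) (snd p)})"
    by (auto simp: hits_def)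
  also have "\<dots> \<in> sets (Z \<Otimes>\<^sub>M Y)"
    using F countable_subset[OF F countable_carrier] measurable_member by (intro sets.countable_UN') auto
  finally show ?thesis .
qed

text \<open>By equivariance and invariance the walk is near the strip at every time with the same
  probability as at time zero.\<close>

lemma prob_near_strip:
  assumes F: "F \<subseteq> carrier G"
  shows "{q \<in> space J. \<exists>c\<in>F. pos (fst q) n \<otimes> c \<in> S (snd q) (\<beta> (fst q))} \<in> sets J" (is "?A \<in> _")
    and "measure J {q \<in> space J. \<exists>c\<in>F. pos (fst q) n \<otimes> c \<in> S (snd q) (\<beta> (fst q))} = measure (Z \<Otimes>\<^sub>M Y) (hits F)"
proof -
  have cF: "countable F" using F countable_carrier by (rule countable_subset)
  have [measurable]: "(\<lambda>q. c) \<in> J \<rightarrow>\<^sub>M count_space (carrier G)" if "c \<in> F" for c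
    using that F by auto
  have [measurable]: "(\<lambda>q. pos (fst q) n) \<in> J \<rightarrow>\<^sub>M count_space (carrier G)"
    by (rule measurable_compose[OF measurable_fst measurable_pos])
  have "{q \<in> space J. pos (fst q) n \<otimes> c \<in> S (snd q) (\<beta> (fst q))} \<in> sets J" if "c \<in> F" for c
    using that by measurable
  then have "(\<Union>c\<in>F. {q \<in> space J. pos (fst q) n \<otimes> c \<in> S (snd q) (\<beta> (fst q))}) \<in> sets J"
    using cF by (intro sets.countable_UN') auto
  also have "(\<Union>c\<in>F. {q \<in> space J. pos (fst q) n \<otimes> c \<in> S (snd q) (\<beta> (fst q))}) = ?A" by auto
  finally show A: "?A \<in> sets J" .
  let ?V = "\<lambda>(h, b). (actz (inv (pos h n)) b, \<beta> ((shift ^^ n) h))"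
  have "AE p in Z \<Otimes>\<^sub>M Y. \<forall>g\<in>carrier G. S (actz g (fst p)) (act g (snd p)) = g <# S (fst p) (snd p)"
    using S_equivariant by (subst AE_ball_countable[OF countable_carrier]) (simp add: case_prod_beta)
  then have "AE q in J. \<forall>g\<in>carrier G. S (actz g (snd q)) (act g (\<beta> (fst q))) = g <# S (snd q) (\<beta> (fst q))"
    by (rule AE_endpoints[where P = "\<lambda>p. \<forall>g\<in>carrier G. S (actz g (fst p)) (act g (snd p)) = g <# S (fst p) (snd p)", simplified])
  then have eq: "AE q in J. q \<in> ?A \<longleftrightarrow> q \<in> ?V -` hits F \<inter> space J"
    using AE_path[OF equivariant_pos[of n]] AE_space
  proof eventually_elim
    fix q assume e: "\<forall>g\<in>carrier G. S (actz g (snd q)) (act g (\<beta> (fst q))) = g <# S (snd q) (\<beta> (fst q))"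
      and b: "\<beta> (fst q) = act (pos (fst q) n) (\<beta> ((shift ^^ n) (fst q)))" and q: "q \<in> space J"
    let ?x = "pos (fst q) n"
    have h: "fst q \<in> space incs" and z: "snd q \<in> space Z"
      using q by (auto simp: space_pair_measure)
    have x: "?x \<in> carrier G" using h by (auto intro: walk_closed)
    have s: "\<beta> ((shift ^^ n) (fst q)) \<in> space Y" "\<beta> (fst q) \<in> space Y"
      using measurable_space[OF \<beta>_measurable measurable_space[OF measurable_shift_funpow h]]
        measurable_space[OF \<beta>_measurable h] by auto
    have sub: "S (snd q) (\<beta> (fst q)) \<subseteq> carrier G" using S_subset z s by auto
    have "act (inv ?x) (\<beta> (fst q)) = \<beta> ((shift ^^ n) (fst q))"
      by (subst b) (simp add: act_inv x s)
    then have S: "S (actz (inv ?x) (snd q)) (\<beta> ((shift ^^ n) (fst q))) = inv ?x <# S (snd q) (\<beta> (fst q))"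
      using e x by (metis inv_closed)
    have "c \<in> inv ?x <# S (snd q) (\<beta> (fst q)) \<longleftrightarrow> ?x \<otimes> c \<in> S (snd q) (\<beta> (fst q))" if "c \<in> F" for c
    proof -
      have c: "c \<in> carrier G" using that F by auto
      show ?thesis
      proof
        assume "c \<in> inv ?x <# S (snd q) (\<beta> (fst q))"
        then obtain k where "k \<in> S (snd q) (\<beta> (fst q))" "c = inv ?x \<otimes> k" by (auto simp: l_coset_def)
        then show "?x \<otimes> c \<in> S (snd q) (\<beta> (fst q))" using sub x by (auto simp: m_assoc[symmetric])
      next
        assume "?x \<otimes> c \<in> S (snd q) (\<beta> (fst q))"
        moreover have "c = inv ?x \<otimes> (?x \<otimes> c)" using x c by (simp add: m_assoc[symmetric])
        ultimately show "c \<in> inv ?x <# S (snd q) (\<beta> (fst q))" unfolding l_coset_def by blast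
      qed
    qed
    then show "q \<in> ?A \<longleftrightarrow> q \<in> ?V -` hits F \<inter> space J"
      using q S x z s by (auto simp: hits_def space_pair_measure case_prod_beta Z.act_closed)
  qed
  have "measure J ?A = measure J (?V -` hits F \<inter> space J)"
    using eq A measurable_sets[OF measurable_pull_back hits_measurable[OF F]]
    by (rule J.finite_measure_eq_AE)
  also have "\<dots> = measure (distr J (Z \<Otimes>\<^sub>M Y) ?V) (hits F)"
    by (rule measure_distr[symmetric, OF measurable_pull_back hits_measurable[OF F]])
  finally show "measure J ?A = measure (Z \<Otimes>\<^sub>M Y) (hits F)"
    by (simp only: distr_pull_back)
qed

text \<open>A nonempty strip contains some element of the group, and finite sets exhaust the countable group.\<close>

lemma finite_translates_suffice:
  assumes "0 < \<eta>"
  obtains F where "finite F" "F \<subseteq> carrier G" "1 - \<eta> < measure (Z \<Otimes>\<^sub>M Y) (hits F)"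
proof -
  define F where "F n = from_nat_into (carrier G) ` {..<n}" for n :: nat
  have ne: "carrier G \<noteq> {}" using one_closed by blast
  have sub: "F n \<subseteq> carrier G" for n using from_nat_into[OF ne] by (auto simp: F_def)
  have un: "(\<Union>n. F n) = carrier G"
    using sub from_nat_into_surj[OF countable_carrier] by (fastforce simp: F_def)
  have "incseq (\<lambda>n. hits (F n))"
    by (auto simp: incseq_def hits_def F_def)
  then have "(\<lambda>n. measure (Z \<Otimes>\<^sub>M Y) (hits (F n))) \<longlonglongrightarrow> measure (Z \<Otimes>\<^sub>M Y) (\<Union>n. hits (F n))"
    using sub by (intro ZY.finite_Lim_measure_incseq) (auto intro: hits_measurable)
  also have "(\<Union>n. hits (F n)) = hits (carrier G)"
    unfolding un[symmetric] by (auto simp: hits_def)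
  also have "measure (Z \<Otimes>\<^sub>M Y) (hits (carrier G)) = 1"
  proof -
    have "AE p in Z \<Otimes>\<^sub>M Y. p \<in> hits (carrier G)"
      using S_nonempty AE_space
      by eventually_elim (use S_subset in \<open>fastforce simp: hits_def space_pair_measure\<close>)
    then show ?thesis by (simp add: ZY.prob_eq_1 hits_measurable)
  qed
  finally have "\<forall>\<^sub>F n in sequentially. 1 - \<eta> < measure (Z \<Otimes>\<^sub>M Y) (hits (F n))"
    using assms by (intro order_tendstoD) auto
  then obtain n where "1 - \<eta> < measure (Z \<Otimes>\<^sub>M Y) (hits (F n))"
    by (auto simp: eventually_sequentially)
  then show thesis using that[of "F n"] sub by (auto simp: F_def)
qed

lemma gauge_mono:
  assumes "1 \<le> k" "k \<le> l"
  shows "\<G> k \<subseteq> \<G> l"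
  using assms(2)
proof (induction l rule: dec_induct)
  case (step l)
  then have "\<G> l \<subseteq> \<G> (Suc l)"
    using gauge assms(1) unfolding gauge_on_def by simp
  with step.IH show ?case by (rule subset_trans)
qed simp

lemma gauge_fun_props:
  assumes "g \<in> carrier G"
  shows "1 \<le> gauge_fun \<G> g" "g \<in> \<G> (gauge_fun \<G> g)"
proof -
  have "g \<in> (\<Union>k\<in>{1..}. \<G> k)"
    using assms gauge unfolding gauge_on_def by simp
  then obtain k where "1 \<le> k \<and> g \<in> \<G> k" by blast
  then have "1 \<le> gauge_fun \<G> g \<and> g \<in> \<G> (gauge_fun \<G> g)"
    unfolding gauge_fun_def by (rule LeastI)
  then show "1 \<le> gauge_fun \<G> g" "g \<in> \<G> (gauge_fun \<G> g)" by auto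
qed

lemma measurable_pos_mem: "{h \<in> space incs. pos h n \<in> D} \<in> sets incs"
proof -
  have "{h \<in> space incs. pos h n \<in> D} = (\<lambda>h. pos h n) -` (D \<inter> carrier G) \<inter> space incs"
    by (auto intro: walk_closed)
  also have "\<dots> \<in> sets incs"
    by (rule measurable_sets[OF measurable_pos]) simp
  finally show ?thesis .
qed

text \<open>The smallest \<open>k\<close> for which the set \<open>\<G> k\<close> of the gauge captures \<open>x\<^sub>n\<close> with probability at least \<open>1 - \<eta>\<close>.
  Minimality is what lets a growth condition at the random index \<open>gauge_fun \<G> x\<^sub>n\<close> control the
  intersection with \<open>\<G> k\<close> at a deterministic one.\<close>

lemma quantile_radius:
  assumes "0 < \<eta>"
  shows "\<exists>k. 1 \<le> k \<and> 1 - \<eta> \<le> measure incs {h \<in> space incs. pos h n \<in> \<G> k} \<and>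
    (k = 1 \<or> measure incs {h \<in> space incs. pos h n \<in> \<G> (k - 1)} < 1 - \<eta>)"
proof -
  let ?E = "\<lambda>k. {h \<in> space incs. pos h n \<in> \<G> k}"
  have "incseq (\<lambda>k. ?E (Suc k))"
    using gauge_mono by (fastforce simp: incseq_def)
  then have "(\<lambda>k. measure incs (?E (Suc k))) \<longlonglongrightarrow> measure incs (\<Union>k. ?E (Suc k))"
    by (intro iid.P.finite_Lim_measure_incseq) (auto intro: measurable_pos_mem)
  also have "(\<Union>k. ?E (Suc k)) = space incs"
  proof -
    have "\<exists>k. pos h n \<in> \<G> (Suc k)" if "h \<in> space incs" for h
      using gauge_fun_props[OF walk_closed[OF one_closed that, of n]] by (metis Suc_le_D One_nat_def)
    then show ?thesis by auto
  qed
  also have "measure incs (space incs) = 1" by (rule iid.P.prob_space)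
  finally have "\<forall>\<^sub>F k in sequentially. 1 - \<eta> < measure incs (?E (Suc k))"
    using assms by (intro order_tendstoD) auto
  then obtain k where "1 - \<eta> < measure incs (?E (Suc k))"
    by (auto simp: eventually_sequentially)
  then have ex: "\<exists>k. 1 \<le> k \<and> 1 - \<eta> \<le> measure incs (?E k)"
    by (intro exI[of _ "Suc k"]) auto
  define K where "K = (LEAST k. 1 \<le> k \<and> 1 - \<eta> \<le> measure incs (?E k))"
  have K: "1 \<le> K \<and> 1 - \<eta> \<le> measure incs (?E K)"
    unfolding K_def using ex by (rule LeastI_ex)
  have min: "measure incs (?E (K - 1)) < 1 - \<eta>" if "K \<noteq> 1"
    using not_less_Least[of "K - 1" "\<lambda>k. 1 \<le> k \<and> 1 - \<eta> \<le> measure incs (?E k)"] that K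
    unfolding K_def[symmetric] by auto
  show ?thesis
  proof (intro exI[of _ K] conjI)
    show "K = 1 \<or> measure incs (?E (K - 1)) < 1 - \<eta>" using min by (cases "K = 1") simp_all
  qed (simp_all only: K)
qed

lemma walk_measure_pos:
  "measure (walk_measure G \<mu>) {x \<in> space (walk_measure G \<mu>). x n \<in> D} = measure incs {h \<in> space incs. pos h n \<in> D}"
proof -
  have m: "pos \<in> incs \<rightarrow>\<^sub>M path_space G" by (rule measurable_walk_from) simp
  have "(\<lambda>x. x n) \<in> path_space G \<rightarrow>\<^sub>M count_space (carrier G)"
    unfolding path_space_def by measurable
  then have "(\<lambda>x. x n) -` (D \<inter> carrier G) \<inter> space (path_space G) \<in> sets (path_space G)"
    by (rule measurable_sets) simp
  also have "(\<lambda>x. x n) -` (D \<inter> carrier G) \<inter> space (path_space G) = {x \<in> space (path_space G). x n \<in> D}"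
    by (auto simp: space_path)
  finally have s: "{x \<in> space (path_space G). x n \<in> D} \<in> sets (path_space G)" .
  have "measure (walk_measure G \<mu>) {x \<in> space (walk_measure G \<mu>). x n \<in> D}
      = measure incs (pos -` {x \<in> space (path_space G). x n \<in> D} \<inter> space incs)"
    unfolding walk_measure_eq space_distr by (rule measure_distr[OF m s])
  also have "pos -` {x \<in> space (path_space G). x n \<in> D} \<inter> space incs = {h \<in> space incs. pos h n \<in> D}"
    using measurable_space[OF m] by auto
  finally show ?thesis .
qed

text \<open>By minimality of \<open>K n\<close> the gauge of \<open>x\<^sub>n\<close> is at least \<open>K n\<close> with probability at least \<open>\<eta>\<close>. Once the
  exceptional event of the growth condition has probability below \<open>\<eta>\<close>, some path avoids it with gauge
  at least \<open>K n\<close>, and the bound at its gauge is inherited by \<open>\<G> (K n)\<close>.\<close>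

lemma growth_at_quantile:
  assumes tend: "tendsto_zero_in_prob (walk_measure G \<mu>)
      (\<lambda>n x. ereal (1 / real n) * log_card (A \<inter> \<G> (gauge_fun \<G> (x n))))"
    and \<eta>: "0 < \<eta>" "\<eta> < 1" and \<epsilon>: "0 < \<epsilon>"
    and K: "\<And>n. 1 \<le> K n"
      "\<And>n. K n = 1 \<or> measure incs {h \<in> space incs. pos h n \<in> \<G> (K n - 1)} < 1 - \<eta>"
  shows "\<forall>\<^sub>F n in sequentially. finite (A \<inter> \<G> (K n)) \<and> real (card (A \<inter> \<G> (K n))) \<le> exp (\<epsilon> * real n)"
proof -
  define D where "D n = {g. \<bar>ereal (1 / real n) * log_card (A \<inter> \<G> (gauge_fun \<G> g))\<bar> > ereal \<epsilon>}" for n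
  have "(\<lambda>n. measure (walk_measure G \<mu>) {x \<in> space (walk_measure G \<mu>). x n \<in> D n}) \<longlonglongrightarrow> 0"
    using tend \<epsilon> unfolding tendsto_zero_in_prob_def D_def by simp
  then have "\<forall>\<^sub>F n in sequentially. measure incs {h \<in> space incs. pos h n \<in> D n} < \<eta>"
    unfolding walk_measure_pos using \<eta> by (intro order_tendstoD)
  then show ?thesis
    using eventually_ge_at_top[of 1]
  proof eventually_elim
    fix n :: nat assume small: "measure incs {h \<in> space incs. pos h n \<in> D n} < \<eta>" and n: "1 \<le> n"
    let ?U = "{h \<in> space incs. K n = 1 \<or> pos h n \<notin> \<G> (K n - 1)}"
    have "\<eta> \<le> measure incs ?U"
    proof (cases "K n = 1")
      case True
      then show ?thesis using \<eta> by (simp add: iid.P.prob_space)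
    next
      case False
      then have "?U = space incs - {h \<in> space incs. pos h n \<in> \<G> (K n - 1)}" by auto
      then show ?thesis
        using False K(2)[of n] iid.P.prob_compl[OF measurable_pos_mem, of n "\<G> (K n - 1)"] by simp
    qed
    moreover have "?U \<in> sets incs"
      using measurable_pos_mem[of n "if K n = 1 then UNIV else - \<G> (K n - 1)"] by (cases "K n = 1") auto
    ultimately have "\<not> ?U \<subseteq> {h \<in> space incs. pos h n \<in> D n}"
      using small iid.P.finite_measure_mono[OF _ measurable_pos_mem, of ?U n "D n"] by linarith
    then obtain h where h: "h \<in> space incs" "K n = 1 \<or> pos h n \<notin> \<G> (K n - 1)" "pos h n \<notin> D n" by auto
    let ?x = "pos h n"
    have x: "?x \<in> carrier G" using h by (auto intro: walk_closed)
    have "K n \<le> gauge_fun \<G> ?x"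
    proof (rule ccontr)
      assume "\<not> K n \<le> gauge_fun \<G> ?x"
      then have "K n \<noteq> 1" "gauge_fun \<G> ?x \<le> K n - 1" using gauge_fun_props(1)[OF x] by auto
      then show False
        using h(2) gauge_mono[OF gauge_fun_props(1)[OF x]] gauge_fun_props(2)[OF x] by blast
    qed
    then have sub: "A \<inter> \<G> (K n) \<subseteq> A \<inter> \<G> (gauge_fun \<G> ?x)"
      using gauge_mono[OF K(1)] by blast
    have "log_card (A \<inter> \<G> (gauge_fun \<G> ?x)) \<le> ereal (\<epsilon> * real n)"
    proof -
      have "\<bar>ereal (1 / real n) * log_card (A \<inter> \<G> (gauge_fun \<G> ?x))\<bar> \<le> ereal \<epsilon>"
        using h(3) by (simp add: D_def not_less)
      then show ?thesis
        using n by (cases "log_card (A \<inter> \<G> (gauge_fun \<G> ?x))") (auto simp: field_simps)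
    qed
    from log_card_le[OF sub this]
    show "finite (A \<inter> \<G> (K n)) \<and> real (card (A \<inter> \<G> (K n))) \<le> exp (\<epsilon> * real n)" by simp
  qed
qed

end

context strips
begin

text \<open>The candidates for the position of the walk: the part inside \<open>\<G> k\<close> of the union of the right
  translates of the strip by the inverses of the elements of \<open>F\<close>.\<close>

definition allowed :: "'a set \<Rightarrow> nat \<Rightarrow> 'z \<Rightarrow> 'y \<Rightarrow> 'a set" where
  "allowed F k b y = {g \<in> carrier G. g \<in> \<G> k \<and> (\<exists>c\<in>F. g \<otimes> c \<in> S b y)}"

lemma pred_allowed [measurable (raw)]:
  assumes F: "F \<subseteq> carrier G"
    and f: "f \<in> N \<rightarrow>\<^sub>M count_space (carrier G)" and u: "u \<in> N \<rightarrow>\<^sub>M Z" and v: "v \<in> N \<rightarrow>\<^sub>M Y"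
  shows "Measurable.pred N (\<lambda>x. f x \<in> allowed F k (u x) (v x))"
proof (rule measurable_compose_countable'[OF _ f countable_carrier])
  fix g assume g: "g \<in> carrier G"
  have "Measurable.pred N (\<lambda>x. g \<otimes> c \<in> S (u x) (v x))" if "c \<in> F" for c
  proof -
    have "(\<lambda>x. g \<otimes> c) \<in> N \<rightarrow>\<^sub>M count_space (carrier G)"
      using g that F by auto
    from pred_member[OF this u v] show ?thesis .
  qed
  then have "(\<Union>c\<in>F. {x \<in> space N. g \<otimes> c \<in> S (u x) (v x)}) \<in> sets N"
    using countable_subset[OF F countable_carrier] by (intro sets.countable_UN') (auto simp: pred_def)
  also have "(\<Union>c\<in>F. {x \<in> space N. g \<otimes> c \<in> S (u x) (v x)}) = {x \<in> space N. \<exists>c\<in>F. g \<otimes> c \<in> S (u x) (v x)}"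
    by auto
  finally have "Measurable.pred N (\<lambda>x. \<exists>c\<in>F. g \<otimes> c \<in> S (u x) (v x))"
    by (simp add: pred_def)
  then show "Measurable.pred N (\<lambda>x. g \<in> allowed F k (u x) (v x))"
    using g by (simp add: allowed_def)
qed

definition size_allowed :: "'a set \<Rightarrow> nat \<Rightarrow> 'z \<times> 'y \<Rightarrow> ennreal" where
  "size_allowed F k p = emeasure (count_space (carrier G)) (allowed F k (fst p) (snd p))"

lemma measurable_size_allowed:
  assumes F: "F \<subseteq> carrier G"
  shows "size_allowed F k \<in> borel_measurable (Z \<Otimes>\<^sub>M Y)"
proof -
  have "Measurable.pred ((Z \<Otimes>\<^sub>M Y) \<Otimes>\<^sub>M count_space (carrier G)) (\<lambda>q. snd q \<in> allowed F k (fst (fst q)) (snd (fst q)))"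
    by (rule pred_allowed[OF F]) measurable
  then have "(\<lambda>(p, g). indicator (allowed F k (fst p) (snd p)) g :: ennreal) \<in> borel_measurable ((Z \<Otimes>\<^sub>M Y) \<Otimes>\<^sub>M count_space (carrier G))"
    unfolding case_prod_beta by (rule borel_measurable_indicator'[unfolded pred_def[symmetric]])
  from sigma_finite_measure.borel_measurable_nn_integral[OF sigma_finite_measure_count_space_countable[OF countable_carrier] this]
  have "(\<lambda>p. \<integral>\<^sup>+ g. indicator (allowed F k (fst p) (snd p)) g \<partial>count_space (carrier G)) \<in> borel_measurable (Z \<Otimes>\<^sub>M Y)" .
  moreover have "(\<integral>\<^sup>+ g. indicator (allowed F k (fst p) (snd p)) g \<partial>count_space (carrier G)) = size_allowed F k p" for p
    unfolding size_allowed_def by (rule nn_integral_indicator) (auto simp: allowed_def)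
  ultimately show ?thesis by simp
qed

lemma size_allowed_le:
  assumes F: "finite F" "F \<subseteq> carrier G" and pt: "b \<in> space Z" "y \<in> space Y"
    and c: "\<And>c. c \<in> F \<Longrightarrow> finite ((S b y #> inv c) \<inter> \<G> k) \<and> real (card ((S b y #> inv c) \<inter> \<G> k)) \<le> C"
  shows "size_allowed F k (b, y) \<le> ennreal (real (card F) * C)"
proof -
  let ?T = "\<Union>c\<in>F. (S b y #> inv c) \<inter> \<G> k"
  have fin: "finite ?T" by (rule finite_UN_I[OF F(1)]) (use c in auto)
  have sub: "allowed F k b y \<subseteq> ?T"
  proof
    fix g assume "g \<in> allowed F k b y"
    then obtain c where g: "g \<in> carrier G" "g \<in> \<G> k" "c \<in> F" "g \<otimes> c \<in> S b y" by (auto simp: allowed_def)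
    then have "g = (g \<otimes> c) \<otimes> inv c" using F by (auto simp: m_assoc)
    then have "g \<in> S b y #> inv c" using g unfolding r_coset_def by blast
    then show "g \<in> ?T" using g by auto
  qed
  have "allowed F k b y \<subseteq> carrier G" by (auto simp: allowed_def)
  then have "size_allowed F k (b, y) = of_nat (card (allowed F k b y))"
    unfolding size_allowed_def using finite_subset[OF sub fin] by (simp add: emeasure_count_space_finite)
  also have "\<dots> = ennreal (real (card (allowed F k b y)))" by (simp add: ennreal_of_nat_eq_real_of_nat)
  also have "\<dots> \<le> ennreal (real (card F) * C)"
  proof (rule ennreal_leI)
    have "card (allowed F k b y) \<le> card ?T" by (rule card_mono[OF fin sub])
    also have "\<dots> \<le> (\<Sum>c\<in>F. card ((S b y #> inv c) \<inter> \<G> k))" by (rule card_UN_le[OF F(1)])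
    finally have "real (card (allowed F k b y)) \<le> (\<Sum>c\<in>F. real (card ((S b y #> inv c) \<inter> \<G> k)))"
      by (simp flip: of_nat_sum)
    also have "\<dots> \<le> (\<Sum>c\<in>F. C)" using c by (intro sum_mono) auto
    finally show "real (card (allowed F k b y)) \<le> real (card F) * C" by simp
  qed
  finally show ?thesis .
qed

text \<open>The factor \<open>card F\<close> is absorbed by doubling the exponential rate.\<close>

lemma few_allowed:
  assumes F: "finite F" "F \<subseteq> carrier G" and \<eta>: "0 < \<eta>" "\<eta> < 1" and \<epsilon>: "0 < \<epsilon>"
    and K: "\<And>n. 1 \<le> K n"
      "\<And>n. K n = 1 \<or> measure incs {h \<in> space incs. pos h n \<in> \<G> (K n - 1)} < 1 - \<eta>"
  shows "(\<lambda>n. measure (Z \<Otimes>\<^sub>M Y) {p \<in> space (Z \<Otimes>\<^sub>M Y). ennreal (exp (2 * \<epsilon> * real n)) < size_allowed F (K n) p}) \<longlonglongrightarrow> 0"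
proof (rule ZY.measure_eventually_not_in)
  note [measurable] = measurable_size_allowed[OF F(2)]
  show "{p \<in> space (Z \<Otimes>\<^sub>M Y). ennreal (exp (2 * \<epsilon> * real n)) < size_allowed F (K n) p} \<in> sets (Z \<Otimes>\<^sub>M Y)" for n
    by measurable
  have "AE p in Z \<Otimes>\<^sub>M Y. \<forall>c\<in>F. tendsto_zero_in_prob (walk_measure G \<mu>)
      (\<lambda>n x. ereal (1 / real n) * log_card ((S (fst p) (snd p) #> inv c) \<inter> \<G> (gauge_fun \<G> (x n))))"
    using S_growth[of "inv _"] F by (intro AE_finite_allI) (auto simp: case_prod_beta)
  then show "AE p in Z \<Otimes>\<^sub>M Y. \<forall>\<^sub>F n in sequentially. p \<notin> {p \<in> space (Z \<Otimes>\<^sub>M Y). ennreal (exp (2 * \<epsilon> * real n)) < size_allowed F (K n) p}"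
    using AE_space
  proof eventually_elim
    fix p assume t: "\<forall>c\<in>F. tendsto_zero_in_prob (walk_measure G \<mu>)
      (\<lambda>n x. ereal (1 / real n) * log_card ((S (fst p) (snd p) #> inv c) \<inter> \<G> (gauge_fun \<G> (x n))))"
      and p: "p \<in> space (Z \<Otimes>\<^sub>M Y)"
    have "\<forall>\<^sub>F n in sequentially. \<forall>c\<in>F. finite ((S (fst p) (snd p) #> inv c) \<inter> \<G> (K n))
        \<and> real (card ((S (fst p) (snd p) #> inv c) \<inter> \<G> (K n))) \<le> exp (\<epsilon> * real n)"
      using F t by (intro eventually_ball_finite ballI growth_at_quantile[OF _ \<eta> \<epsilon> K]) auto
    moreover have "\<forall>\<^sub>F n in sequentially. real (card F) \<le> exp (\<epsilon> * real n)"
    proof -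
      have "filterlim (\<lambda>n. exp (\<epsilon> * real n)) at_top sequentially"
        using \<epsilon> by (intro filterlim_compose[OF exp_at_top] filterlim_tendsto_pos_mult_at_top[OF tendsto_const] filterlim_real_sequentially)
      then show ?thesis by (auto simp: filterlim_at_top)
    qed
    ultimately show "\<forall>\<^sub>F n in sequentially. p \<notin> {p \<in> space (Z \<Otimes>\<^sub>M Y). ennreal (exp (2 * \<epsilon> * real n)) < size_allowed F (K n) p}"
    proof eventually_elim
      fix n assume c: "\<forall>c\<in>F. finite ((S (fst p) (snd p) #> inv c) \<inter> \<G> (K n))
        \<and> real (card ((S (fst p) (snd p) #> inv c) \<inter> \<G> (K n))) \<le> exp (\<epsilon> * real n)"
        and f: "real (card F) \<le> exp (\<epsilon> * real n)"
      have "size_allowed F (K n) (fst p, snd p) \<le> ennreal (real (card F) * exp (\<epsilon> * real n))"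
        using c p by (intro size_allowed_le[OF F]) (auto simp: space_pair_measure)
      also have "\<dots> \<le> ennreal (exp (\<epsilon> * real n) * exp (\<epsilon> * real n))"
        using f by (intro ennreal_leI mult_right_mono) auto
      also have "\<dots> = ennreal (exp (2 * \<epsilon> * real n))" by (simp flip: exp_add)
      finally show "p \<notin> {p \<in> space (Z \<Otimes>\<^sub>M Y). ennreal (exp (2 * \<epsilon> * real n)) < size_allowed F (K n) p}"
        by (simp add: not_less)
    qed
  qed
qed

text \<open>The union bound for conditional probabilities, integrated over an independent first boundary point.\<close>

lemma unlikely_allowed:
  assumes F: "F \<subseteq> carrier G" and C: "0 \<le> C" "0 \<le> c"
  shows "{q \<in> space J. pos (fst q) n \<in> allowed F k (snd q) (\<beta> (fst q)) \<and> size_allowed F k (snd q, \<beta> (fst q)) \<le> ennreal C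
      \<and> pos_prob n (pos (fst q) n) * r (pos (fst q) n) (\<beta> (fst q)) \<le> c} \<in> sets J" (is "?A \<in> _")
    and "measure J {q \<in> space J. pos (fst q) n \<in> allowed F k (snd q) (\<beta> (fst q)) \<and> size_allowed F k (snd q, \<beta> (fst q)) \<le> ennreal C
      \<and> pos_prob n (pos (fst q) n) * r (pos (fst q) n) (\<beta> (fst q)) \<le> c} \<le> c * C"
proof -
  note size = measurable_size_allowed[OF F, of k]
  have [measurable]: "(\<lambda>q. size_allowed F k (snd q, \<beta> (fst q))) \<in> borel_measurable J"
    by (rule measurable_compose[OF measurable_endpoints size])
  have [measurable]: "(\<lambda>q. pos (fst q) n) \<in> J \<rightarrow>\<^sub>M count_space (carrier G)"
    by (rule measurable_compose[OF measurable_fst measurable_pos])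
  have [measurable]: "(\<lambda>q. pos_prob n (pos (fst q) n)) \<in> borel_measurable J"
    by (rule borel_measurable_discrete) measurable
  have [measurable]: "Measurable.pred J (\<lambda>q. pos (fst q) n \<in> allowed F k (snd q) (\<beta> (fst q)))"
    by (rule pred_allowed[OF F]) measurable
  show A: "?A \<in> sets J" by measurable
  have "emeasure J ?A = (\<integral>\<^sup>+ b. emeasure incs ((\<lambda>h. (h, b)) -` ?A) \<partial>Z)"
    by (rule J.emeasure_pair_measure_alt2[OF A])
  also have "\<dots> \<le> (\<integral>\<^sup>+ b. ennreal (c * C) \<partial>Z)"
  proof (rule nn_integral_mono)
    fix b assume b: "b \<in> space Z"
    let ?W = "{p \<in> space (count_space (carrier G) \<Otimes>\<^sub>M Y). fst p \<in> allowed F k b (snd p) \<and> size_allowed F k (b, snd p) \<le> ennreal C}"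
    have "(\<lambda>p. (b, snd p)) \<in> count_space (carrier G) \<Otimes>\<^sub>M Y \<rightarrow>\<^sub>M Z \<Otimes>\<^sub>M Y"
      using b by measurable
    from measurable_compose[OF this size]
    have [measurable]: "(\<lambda>p. size_allowed F k (b, snd p)) \<in> borel_measurable (count_space (carrier G) \<Otimes>\<^sub>M Y)" .
    have [measurable]: "Measurable.pred (count_space (carrier G) \<Otimes>\<^sub>M Y) (\<lambda>p. fst p \<in> allowed F k b (snd p))"
      using b by (intro pred_allowed[OF F]) auto
    have W: "?W \<in> sets (count_space (carrier G) \<Otimes>\<^sub>M Y)" by measurable
    have "(\<lambda>h. (h, b)) -` ?A = {h \<in> space incs. (pos h n, \<beta> h) \<in> ?W \<and> pos_prob n (pos h n) * r (pos h n) (\<beta> h) \<le> c}"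
      using b measurable_space[OF \<beta>_measurable] by (auto simp: space_pair_measure intro: walk_closed)
    then have "emeasure incs ((\<lambda>h. (h, b)) -` ?A)
        \<le> ennreal c * (\<integral>\<^sup>+ y. emeasure (count_space (carrier G)) {g \<in> carrier G. (g, y) \<in> ?W} \<partial>Y)"
      using unlikely_positions[OF W, of n c] by simp
    also have "\<dots> \<le> ennreal c * (\<integral>\<^sup>+ y. ennreal C \<partial>Y)"
    proof (intro mult_left_mono nn_integral_mono)
      fix y assume y: "y \<in> space Y"
      show "emeasure (count_space (carrier G)) {g \<in> carrier G. (g, y) \<in> ?W} \<le> ennreal C"
      proof (cases "size_allowed F k (b, y) \<le> ennreal C")
        case True
        then have "{g \<in> carrier G. (g, y) \<in> ?W} = allowed F k b y"
          using y by (auto simp: space_pair_measure allowed_def)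
        then show ?thesis using True by (simp add: size_allowed_def)
      next
        case False
        then have "{g \<in> carrier G. (g, y) \<in> ?W} = {}" by auto
        then show ?thesis by (simp only: emeasure_empty) simp
      qed
    qed simp
    also have "\<dots> = ennreal (c * C)" using C by (simp add: emeasure_space_1 ennreal_mult)
    finally show "emeasure incs ((\<lambda>h. (h, b)) -` ?A) \<le> ennreal (c * C)" .
  qed
  also have "\<dots> = ennreal (c * C)" by (simp add: Z.emeasure_space_1)
  finally show "measure J ?A \<le> c * C"
    using C by (simp add: J.emeasure_eq_measure)
qed

text \<open>If the information is large, then either \<open>x\<^sub>n\<close> is not a candidate, or there are too many candidates, or
  \<open>x\<^sub>n\<close> is a candidate of small conditional probability among few. Each of these
  events is eventually unlikely.\<close>

lemma info_sublinear_in_probability: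
  assumes \<epsilon>: "0 < \<epsilon>" and \<eta>: "0 < \<eta>"
  shows "\<forall>\<^sub>F n in sequentially. measure incs {h \<in> space incs. \<epsilon> * real n < info n h} \<le> \<eta>"
proof -
  \<comment> \<open>One quarter of \<open>\<eta>\<close> for each of the four exceptional events; as a quantile level it must be below one.\<close>
  define \<delta> where "\<delta> = min (\<eta> / 4) (1 / 2)"
  have \<delta>: "0 < \<delta>" "\<delta> < 1" "4 * \<delta> \<le> \<eta>" using \<eta> by (auto simp: \<delta>_def)
  \<comment> \<open>At most \<open>exp (2 e n)\<close> candidates of conditional probability at most \<open>exp (- 3 e n)\<close> have total
    probability at most \<open>exp (- e n)\<close>.\<close>
  define e where "e = \<epsilon> / 3"
  have e: "0 < e" "\<epsilon> = 3 * e" using \<epsilon> by (auto simp: e_def)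
  obtain F where F: "finite F" "F \<subseteq> carrier G" and hit: "1 - \<delta> < measure (Z \<Otimes>\<^sub>M Y) (hits F)"
    using finite_translates_suffice[OF \<delta>(1)] .
  have "\<forall>n. \<exists>k. 1 \<le> k \<and> 1 - \<delta> \<le> measure incs {h \<in> space incs. pos h n \<in> \<G> k} \<and>
      (k = 1 \<or> measure incs {h \<in> space incs. pos h n \<in> \<G> (k - 1)} < 1 - \<delta>)"
    by (rule allI, rule quantile_radius[OF \<delta>(1)])
  from choice[OF this] obtain K where K0: "\<forall>n. 1 \<le> K n \<and> 1 - \<delta> \<le> measure incs {h \<in> space incs. pos h n \<in> \<G> (K n)} \<and>
      (K n = 1 \<or> measure incs {h \<in> space incs. pos h n \<in> \<G> (K n - 1)} < 1 - \<delta>)"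
    by (rule exE)
  have K: "\<And>n. 1 \<le> K n" "\<And>n. 1 - \<delta> \<le> measure incs {h \<in> space incs. pos h n \<in> \<G> (K n)}"
    "\<And>n. K n = 1 \<or> measure incs {h \<in> space incs. pos h n \<in> \<G> (K n - 1)} < 1 - \<delta>"
    by (simp_all only: K0)
  define T where "T n = {p \<in> space (Z \<Otimes>\<^sub>M Y). ennreal (exp (2 * e * real n)) < size_allowed F (K n) p}" for n
  have T: "T n \<in> sets (Z \<Otimes>\<^sub>M Y)" for n
    using measurable_size_allowed[OF F(2)] unfolding T_def by measurable
  have "\<forall>\<^sub>F n in sequentially. measure (Z \<Otimes>\<^sub>M Y) (T n) < \<delta>"
    using few_allowed[OF F \<delta>(1,2) e(1) K(1,3)] \<delta> unfolding T_def by (intro order_tendstoD) auto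
  moreover have "\<forall>\<^sub>F n in sequentially. exp (- e * real n) < \<delta>"
  proof -
    have "filterlim (\<lambda>n. - e * real n) at_bot sequentially"
      using e by (intro filterlim_tendsto_neg_mult_at_bot[OF tendsto_const] filterlim_real_sequentially) auto
    then have "(\<lambda>n. exp (- e * real n)) \<longlonglongrightarrow> 0"
      by (rule filterlim_compose[OF exp_at_bot])
    then show ?thesis using \<delta> by (intro order_tendstoD) auto
  qed
  ultimately show ?thesis
  proof eventually_elim
    fix n assume Tn: "measure (Z \<Otimes>\<^sub>M Y) (T n) < \<delta>" and en: "exp (- e * real n) < \<delta>"
    define A1 where "A1 = {q \<in> space J. \<exists>c\<in>F. pos (fst q) n \<otimes> c \<in> S (snd q) (\<beta> (fst q))}"
    define A2 where "A2 = {q \<in> space J. fst q \<in> {h \<in> space incs. pos h n \<in> \<G> (K n)}}"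
    define A3 where "A3 = {q \<in> space J. (snd q, \<beta> (fst q)) \<in> T n}"
    define A4 where "A4 = {q \<in> space J. pos (fst q) n \<in> allowed F (K n) (snd q) (\<beta> (fst q))
      \<and> size_allowed F (K n) (snd q, \<beta> (fst q)) \<le> ennreal (exp (2 * e * real n))
      \<and> pos_prob n (pos (fst q) n) * r (pos (fst q) n) (\<beta> (fst q)) \<le> exp (- 3 * e * real n)}"
    define B where "B = {q \<in> space J. fst q \<in> {h \<in> space incs. \<epsilon> * real n < info n h}}"
    have A1: "A1 \<in> sets J" "measure J A1 = measure (Z \<Otimes>\<^sub>M Y) (hits F)"
      unfolding A1_def using prob_near_strip[OF F(2)] by auto
    have A2: "A2 \<in> sets J"
    proof -
      have "fst -` {h \<in> space incs. pos h n \<in> \<G> (K n)} \<inter> space J \<in> sets J"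
        by (rule measurable_sets[OF measurable_fst measurable_pos_mem])
      also have "fst -` {h \<in> space incs. pos h n \<in> \<G> (K n)} \<inter> space J = A2" by (auto simp: A2_def)
      finally show ?thesis .
    qed
    have A2': "measure J A2 = measure incs {h \<in> space incs. pos h n \<in> \<G> (K n)}"
      unfolding A2_def by (rule measure_path[OF measurable_pos_mem])
    have A3eq: "A3 = (\<lambda>q. (snd q, \<beta> (fst q))) -` T n \<inter> space J" by (auto simp: A3_def)
    have A3: "A3 \<in> sets J"
      unfolding A3eq by (rule measurable_sets[OF measurable_endpoints T])
    have A3': "measure J A3 = measure (Z \<Otimes>\<^sub>M Y) (T n)"
      unfolding A3eq measure_distr[OF measurable_endpoints T, symmetric] distr_endpoints[unfolded case_prod_beta] ..
    have A4: "A4 \<in> sets J" "measure J A4 \<le> exp (- 3 * e * real n) * exp (2 * e * real n)"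
      unfolding A4_def using unlikely_allowed[OF F(2), of "exp (2 * e * real n)" "exp (- 3 * e * real n)" n "K n"] by auto
    have "exp (- 3 * e * real n) * exp (2 * e * real n) = exp (- e * real n)"
      by (simp flip: exp_add add: algebra_simps)
    with A4(2) en have A4': "measure J A4 < \<delta>" by simp
    have sub: "B \<subseteq> (space J - A1) \<union> (space J - A2) \<union> A3 \<union> A4"
    proof
      fix q assume q: "q \<in> B"
      then have qJ: "q \<in> space J" and info: "\<epsilon> * real n < info n (fst q)" by (auto simp: B_def)
      let ?p = "pos_prob n (pos (fst q) n) * r (pos (fst q) n) (\<beta> (fst q))"
      have ln: "ln ?p < - 3 * e * real n" using info e by (simp add: info_def)
      have "?p \<le> exp (- 3 * e * real n)"
      proof (cases "?p = 0")
        case False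
        moreover have "0 \<le> ?p" by (simp add: pos_prob_nonneg)
        ultimately have "0 < ?p" by linarith
        then show ?thesis using ln by (metis exp_le_cancel_iff exp_ln less_imp_le)
      qed (simp only: exp_ge_zero)
      moreover have "pos (fst q) n \<in> carrier G"
        using qJ by (auto simp: space_pair_measure intro: walk_closed)
      ultimately show "q \<in> (space J - A1) \<union> (space J - A2) \<union> A3 \<union> A4"
        using qJ measurable_space[OF measurable_endpoints qJ]
        by (auto simp: A1_def A2_def A3_def A4_def T_def allowed_def space_pair_measure not_less)
    qed
    have "measure incs {h \<in> space incs. \<epsilon> * real n < info n h} = measure J B"
      unfolding B_def by (rule measure_path[symmetric]) measurable
    also have "\<dots> \<le> measure J ((space J - A1) \<union> (space J - A2) \<union> A3 \<union> A4)"
      using A1 A2 A3 A4 by (intro J.finite_measure_mono[OF sub]) auto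
    also have "\<dots> \<le> measure J (space J - A1) + measure J (space J - A2) + measure J A3 + measure J A4"
      using A1 A2 A3 A4
      by (intro order_trans[OF measure_subadditive] add_mono measure_subadditive) (auto simp: J.emeasure_eq_measure)
    also have "\<dots> \<le> \<delta> + \<delta> + \<delta> + \<delta>"
      using A1 A2 A2' A3' A4' hit K(2)[of n] Tn J.prob_compl by (intro add_mono) auto
    also have "\<dots> \<le> \<eta>" using \<delta> by simp
    finally show "measure incs {h \<in> space incs. \<epsilon> * real n < info n h} \<le> \<eta>" .
  qed
qed

end

section \<open>From a full quotient to an isomorphism\<close>

context quotient_system
begin

text \<open>On a standard Borel space the identity is coded by one bounded real function. That function
  descends to the quotient, and decoding it gives a measurable map \<open>\<phi>\<close> from the quotient that inverts
  the projection almost everywhere. The two maps are mutually inverse between \<open>D\<close>, where \<open>\<phi> (\<pi> p) = p\<close>,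
  and \<open>R\<close>, where \<open>\<pi> (\<phi> C) = C\<close>; the set \<open>R\<close> is measurable because countably many measurable sets of
  blocks separate the blocks.\<close>

lemma isomorphism_if_densities_agree:
  assumes sb: "standard_borel X"
    and agree: "\<And>n. AE h in incs. AE y in X. r (pos h n) y = \<rho> (pos h n) y"
  shows "isomorphism_mod0 X Q \<pi>"
proof -
  obtain f :: "'x \<Rightarrow> real" and k :: "real \<Rightarrow> 'x" and A where
    f [measurable]: "f \<in> borel_measurable X" and A [measurable]: "A \<in> sets borel"
    and k: "k \<in> restrict_space borel A \<rightarrow>\<^sub>M X"
    and fA: "\<And>p. p \<in> space X \<Longrightarrow> f p \<in> A" and kf: "\<And>p. p \<in> space X \<Longrightarrow> k (f p) = p"
    by (rule standard_borel_separated[OF sb]) (rule that)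
  obtain p0 where p0: "p0 \<in> space X" using not_empty by blast
  \<comment> \<open>The arctangent makes the coding function bounded, and adding two makes it nonnegative.\<close>
  define u where "u p = arctan (f p) + 2" for p
  have "\<bar>arctan t\<bar> < 2" for t
    using arctan_bounded[of t] pi_less_4 by (simp add: abs_less_iff)
  then have u_bounds: "0 \<le> u p" "u p \<le> 4" for p
    by (simp_all add: u_def abs_less_iff) (smt (verit))+
  have [measurable]: "u \<in> borel_measurable X" unfolding u_def by measurable
  obtain u' where u' [measurable]: "u' \<in> borel_measurable Q" and uu': "AE y in X. u y = u' (\<pi> y)"
    by (rule function_on_quotient[OF agree, where f = u and c = 4]) (measurable, auto simp: u_bounds)
  define k' where "k' t = (if t \<in> A then k t else p0)" for t
  have k' [measurable]: "k' \<in> borel \<rightarrow>\<^sub>M X"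
    unfolding k'_def using k p0 by (subst measurable_restrict_space_iff[symmetric]) auto
  define \<phi> where "\<phi> C = k' (tan (u' C - 2))" for C
  have \<phi> [measurable]: "\<phi> \<in> Q \<rightarrow>\<^sub>M X" unfolding \<phi>_def tan_def by measurable
  define D where "D = {p \<in> space X. \<phi> (\<pi> p) = p}"
  have "D = {p \<in> space X. f (\<phi> (\<pi> p)) = f p}"
  proof -
    have "\<phi> (\<pi> p) \<in> space X" if "p \<in> space X" for p
      using measurable_space[OF \<phi> measurable_space[OF measurable_block_of that]] .
    then show ?thesis unfolding D_def by (auto dest: arg_cong[of _ _ k] simp: kf)
  qed
  also have "\<dots> \<in> sets X" by measurable
  finally have D [measurable]: "D \<in> sets X" .
  have AE_D: "AE p in X. p \<in> D"
    using uu' AE_space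
  proof eventually_elim
    fix p assume "u p = u' (\<pi> p)" and p: "p \<in> space X"
    then have "u' (\<pi> p) - 2 = arctan (f p)" by (simp add: u_def)
    then show "p \<in> D" using p by (simp add: D_def \<phi>_def tan_arctan k'_def fA kf)
  qed
  obtain E :: "nat \<Rightarrow> 'x set" where E0: "(\<forall>i. E i \<in> sets X \<and> (\<exists>\<A> \<subseteq> \<xi>. E i = \<Union>\<A>)) \<and>
      (\<forall>C \<in> \<xi>. \<forall>D \<in> \<xi>. C \<noteq> D \<longrightarrow>
        (\<exists>i. (C \<subseteq> E i \<and> D \<inter> E i = {}) \<or> (D \<subseteq> E i \<and> C \<inter> E i = {})))"
    using partition[unfolded measurable_partition_def, THEN conjunct2] by (rule exE)
  have E: "E i \<in> sets X" "\<exists>\<A> \<subseteq> \<xi>. E i = \<Union>\<A>" for i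
    using E0[THEN conjunct1, rule_format, of i] by auto
  note sep = E0[THEN conjunct2, rule_format]
  define \<E> where "\<E> i = {C \<in> \<xi>. C \<subseteq> E i}" for i
  have "\<Union>(\<E> i) = E i" for i
    using E(2)[of i] unfolding \<E>_def by blast
  then have \<E> [measurable]: "\<E> i \<in> sets Q" for i
    using E(1)[of i] unfolding sets_Q by (auto simp: \<E>_def)
  define R where "R = {C \<in> space Q. \<pi> (\<phi> C) = C}"
  have \<pi>\<phi>: "\<pi> (\<phi> C) \<in> \<xi>" if "C \<in> \<xi>" for C
    using measurable_space[OF measurable_block_of measurable_space[OF \<phi>]] that by (simp add: space_Q)
  have "R = {C \<in> space Q. \<forall>i. \<pi> (\<phi> C) \<in> \<E> i \<longleftrightarrow> C \<in> \<E> i}"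
  proof -
    have "\<pi> (\<phi> C) = C" if C: "C \<in> \<xi>" and i: "\<forall>i. \<pi> (\<phi> C) \<in> \<E> i \<longleftrightarrow> C \<in> \<E> i" for C
    proof (rule ccontr)
      assume "\<pi> (\<phi> C) \<noteq> C"
      from sep[OF \<pi>\<phi>[OF C] C this] obtain i where
        "(\<pi> (\<phi> C) \<subseteq> E i \<and> C \<inter> E i = {}) \<or> (C \<subseteq> E i \<and> \<pi> (\<phi> C) \<inter> E i = {})" ..
      then show False
        using i C \<pi>\<phi>[OF C] block_nonempty[OF C] block_nonempty[OF \<pi>\<phi>[OF C]] unfolding \<E>_def by blast
    qed
    then show ?thesis unfolding R_def space_Q by auto
  qed
  also have "\<dots> \<in> sets Q" by measurable
  finally have R [measurable]: "R \<in> sets Q" .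
  have AE_R: "AE C in Q. C \<in> R"
  proof -
    have "AE p in X. \<pi> p \<in> R"
      using AE_D AE_space
      by eventually_elim (simp add: D_def R_def space_Q block_of_mem)
    then have "AE C in distr X Q \<pi>. C \<in> R"
      by (subst AE_distr_iff) auto
    then show ?thesis by (simp only: distr_block_of)
  qed
  have DR: "\<pi> p \<in> R" if "p \<in> D" for p
    using that by (simp add: D_def R_def space_Q block_of_mem)
  have RD: "\<phi> C \<in> D" if "C \<in> R" for C
    using that measurable_space[OF \<phi>, of C] by (simp add: D_def R_def)
  have cD: "space X - (space X - D) = D" and cR: "space Q - (space Q - R) = R"
    by (auto simp: D_def R_def)
  show ?thesis
    unfolding isomorphism_mod0_def
  proof (intro conjI bexI)
    show "\<pi> \<in> X \<rightarrow>\<^sub>M Q" by measurable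
    show "distr X Q \<pi> = Q" by (rule distr_block_of)
    show "space X - D \<in> null_sets X"
      by (rule AE_iff_null_sets[THEN iffD2]) (use D AE_D in \<open>auto elim: eventually_mono\<close>)
    show "space Q - R \<in> null_sets Q"
      by (rule AE_iff_null_sets[THEN iffD2]) (use R AE_R in \<open>auto elim: eventually_mono\<close>)
    show "\<pi> \<in> restrict_space X (space X - (space X - D)) \<rightarrow>\<^sub>M restrict_space Q (space Q - (space Q - R))"
      unfolding cD cR
      by (intro measurable_restrict_space3 measurable_block_of) (use DR in auto)
    show "\<phi> \<in> restrict_space Q (space Q - (space Q - R)) \<rightarrow>\<^sub>M restrict_space X (space X - (space X - D))"
      unfolding cD cR
      by (intro measurable_restrict_space3 \<phi>) (use RD in auto)
    show "\<forall>p\<in>space X - (space X - D). \<phi> (\<pi> p) = p"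
      unfolding cD by (simp add: D_def)
    show "\<forall>C\<in>space Q - (space Q - R). \<pi> (\<phi> C) = C"
      unfolding cR by (simp add: R_def)
  qed
qed

end

section \<open>The reflected walk\<close>

context random_walk
begin

lemma random_walk_reflected: "random_walk G (reflected G \<mu>)"
  by unfold_locales (use countable_carrier support in \<open>auto simp: reflected_def\<close>)

text \<open>A boundary of the reflected walk is stationary for the reflected increments, that is, for the
  inverses of the increments of the walk.\<close>

lemma stationary_under_inverses:
  assumes "boundary_system G (reflected G \<mu>) Z act \<beta>" and f: "f \<in> borel_measurable Z"
  shows "(\<integral>\<^sup>+ g. (\<integral>\<^sup>+ b. f (act (inv g) b) \<partial>Z) \<partial>inc) = (\<integral>\<^sup>+ b. f b \<partial>Z)"
proof -
  interpret B: boundary_system G "reflected G \<mu>" Z act \<beta> by fact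
  have "(\<integral>\<^sup>+ b. f b \<partial>Z) = (\<integral>\<^sup>+ h. f (\<beta> h) \<partial>B.incs)"
    by (rule B.nn_integral_\<beta>[OF f, symmetric])
  also have "\<dots> = (\<integral>\<^sup>+ h. (\<integral>\<^sup>+ b. f (act (B.pos h 1) b) \<partial>Z) \<partial>B.incs)"
    using B.nn_integral_pos_\<beta>[of "\<lambda>(g, b). f b" 1] f by (simp del: walk.simps)
  also have "\<dots> = (\<integral>\<^sup>+ g. (\<integral>\<^sup>+ b. f (act g b) \<partial>Z) \<partial>B.inc)"
    by (rule B.nn_integral_first)
  also have "\<dots> = (\<integral>\<^sup>+ g. (\<integral>\<^sup>+ b. f (act (inv g) b) \<partial>Z) \<partial>inc)"
    unfolding B.nn_integral_inc_pmf nn_integral_inc_pmf by (simp add: reflected_def)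
  finally show ?thesis by simp
qed

end

section \<open>The strip criterion\<close>

lemma mu_boundary_quotient_system:
  assumes "random_walk G \<mu>" "mu_boundary G \<mu> \<Gamma> act bnd \<xi> B"
  shows "quotient_system G \<mu> \<Gamma> act (\<lambda>h. bnd (walk G \<one>\<^bsub>G\<^esub> h)) \<xi>" "B = quotient_measure \<Gamma> \<xi>"
  using assms random_walk.poisson_boundary_system[OF assms(1)]
  by (auto simp: mu_boundary_def quotient_system_def quotient_system_axioms_def)

theorem theorem6p4:
  fixes G :: "('a, 'b) monoid_scheme" (structure)
    and \<mu> :: "'a pmf"
    and \<Gamma>m :: "'p measure" and actm :: "'a \<Rightarrow> 'p \<Rightarrow> 'p" and bndm :: "(nat \<Rightarrow> 'a) \<Rightarrow> 'p"
    and \<xi>m :: "'p set set" and Bm :: "'p set measure"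
    and \<Gamma>p :: "'q measure" and actp :: "'a \<Rightarrow> 'q \<Rightarrow> 'q" and bndp :: "(nat \<Rightarrow> 'a) \<Rightarrow> 'q"
    and \<xi>p :: "'q set set" and Bp :: "'q set measure"
    and \<G> :: "nat \<Rightarrow> 'a set" and S :: "'p set \<Rightarrow> 'q set \<Rightarrow> 'a set"
  assumes "group G" and "countable (carrier G)"
    and "set_pmf \<mu> \<subseteq> carrier G"
    and "entropy_on G \<mu> < \<infinity>"
    and "mu_boundary G (reflected G \<mu>) \<Gamma>m actm bndm \<xi>m Bm"
    and "mu_boundary G \<mu> \<Gamma>p actp bndp \<xi>p Bp"
    and "gauge_on G \<G>"
    and S_measurable: "case_prod S \<in> Bm \<Otimes>\<^sub>M Bp \<rightarrow>\<^sub>M subset_space G"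
    and S_nonempty: "AE (b\<^sub>m, b\<^sub>p) in Bm \<Otimes>\<^sub>M Bp. S b\<^sub>m b\<^sub>p \<noteq> {}"
    and S_equivariant: "\<And>g. g \<in> carrier G \<Longrightarrow>
          AE (b\<^sub>m, b\<^sub>p) in Bm \<Otimes>\<^sub>M Bp. S (actm g ` b\<^sub>m) (actp g ` b\<^sub>p) = g <# S b\<^sub>m b\<^sub>p"
    and S_growth: "\<And>g. g \<in> carrier G \<Longrightarrow>
          AE (b\<^sub>m, b\<^sub>p) in Bm \<Otimes>\<^sub>M Bp.
            tendsto_zero_in_prob (walk_measure G \<mu>)
              (\<lambda>n x. ereal (1 / real n) * log_card ((S b\<^sub>m b\<^sub>p #> g) \<inter> \<G> (gauge_fun \<G> (x n))))"
  shows "maximal_boundary \<Gamma>p \<xi>p Bp"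
proof -
  note entropy = \<open>entropy_on G \<mu> < \<infinity>\<close>
  have walk: "random_walk G \<mu>"
    using assms(1-3) by (intro random_walk.intro random_walk_axioms.intro)
  interpret random_walk G \<mu> by (rule walk)
  note m = mu_boundary_quotient_system[OF random_walk_reflected \<open>mu_boundary G (reflected G \<mu>) \<Gamma>m actm bndm \<xi>m Bm\<close>]
  note p = mu_boundary_quotient_system[OF walk \<open>mu_boundary G \<mu> \<Gamma>p actp bndp \<xi>p Bp\<close>]
  interpret P: quotient_system G \<mu> \<Gamma>p actp "\<lambda>h. bndp (pos h)" \<xi>p by (rule p(1))
  have Bm: "boundary_system G (reflected G \<mu>) Bm (\<lambda>g C. actm g ` C) (\<lambda>h. block_of \<xi>m (bndm (pos h)))"
    unfolding m(2) by (rule quotient_system.quotient[OF m(1)])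
  interpret Bm: boundary_system G "reflected G \<mu>" Bm "\<lambda>g C. actm g ` C" "\<lambda>h. block_of \<xi>m (bndm (pos h))"
    by (rule Bm)
  interpret strips G \<mu> Bp "\<lambda>g C. actp g ` C" "\<lambda>h. block_of \<xi>p (bndp (pos h))" Bm "\<lambda>g C. actm g ` C" S \<G>
  proof (rule strips.intro)
    show "boundary_system G \<mu> Bp (\<lambda>g C. actp g ` C) (\<lambda>h. block_of \<xi>p (bndp (pos h)))"
      unfolding p(2) by (rule P.quotient)
    show "measurable_action G Bm (\<lambda>g C. actm g ` C)" by (rule Bm.measurable_action_axioms)
    show "strips_axioms G \<mu> Bp (\<lambda>g C. actp g ` C) Bm (\<lambda>g C. actm g ` C) S \<G>"
      by (rule strips_axioms.intro)
        (fact stationary_under_inverses[OF Bm] \<open>gauge_on G \<G>\<close> S_measurable S_nonempty S_equivariant S_growth)+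
  qed
  have "(\<integral>h. P.log_r h - P.quot.log_r h \<partial>incs) \<le> \<epsilon>" if pos_\<epsilon>: "0 < \<epsilon>" for \<epsilon>
  proof -
    obtain n where n: "1 \<le> n" "integrable incs (P.quot.info n)" "(\<integral>h. P.quot.info n h \<partial>incs) \<le> \<epsilon> * real n"
      by (rule P.quot.mean_info_small[OF entropy info_sublinear_in_probability[unfolded p(2)] pos_\<epsilon>])
    have "real n * (\<integral>h. P.log_r h - P.quot.log_r h \<partial>incs) \<le> real n * \<epsilon>"
      using P.log_ratio_mean_le[OF entropy n(2)] n(3) by (simp add: mult.commute)
    then show ?thesis using n(1) by simp
  qed
  then have "(\<integral>h. P.log_r h - P.quot.log_r h \<partial>incs) \<le> 0"
    by (rule field_le_epsilon[where y = 0, simplified])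
  then have "AE h in incs. P.r (h 0) (bndp (pos h)) = P.\<rho> (h 0) (bndp (pos h))"
    by (rule P.densities_agree_first[OF entropy])
  note agree = P.densities_agree[OF P.densities_agree_path[OF this]]
  have "standard_borel \<Gamma>p"
    using \<open>mu_boundary G \<mu> \<Gamma>p actp bndp \<xi>p Bp\<close> by (simp add: mu_boundary_def poisson_boundary_def)
  then show ?thesis
    unfolding maximal_boundary_def p(2) by (rule P.isomorphism_if_densities_agree[OF _ agree])
qed

end
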